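(* Let $\beta>1$ be a non-integer such that the greedy expansion of $1$ in base $\beta$ is $1=b_1/\beta+b_2/\beta^2+\cdots+b_n/\beta^n$ with $n\ge2$ and $b_i\ge1$ for $i=1,\ldots,n$, and assume $\beta^2\ne b_1\beta+1$. Let $p\in(0,1)$. Then $Q_{\beta,p}\circ\psi^{-1}$ is a product measure of the form $m_p\otimes\mu$, with $\mu$ a probability measure on $[0,b_1/(\beta-1)]$.
   Context: Note $b_1=\lfloor\beta\rfloor$. Let $J_\beta=[0,b_1/(\beta-1)]$, $\lambda$ the normalized Lebesgue measure on $J_\beta$. The greedy map $T_\beta:J_\beta\to J_\beta$ is $T_\beta(x)=\beta x-d$ for $x\in C(d)$, where $C(j)=[j/\beta,(j+1)/\beta)$ for $0\le j\le b_1-1$ and $C(b_1)=[b_1/\beta,b_1/(\beta-1)]$. The greedy expansion of $x$ is $x=\sum_i d_i(x)\beta^{-i}$ with $d_i(x)=d$ iff $T_\beta^{i-1}(x)\in C(d)$ (trailing zeros omitted). $\Omega=\{0,1\}^{\mathbb N}$; $m_p$ is the Bernoulli measure on $\Omega$: $m_p(\{\omega_1=i_1,\ldots,\omega_m=i_m\})=p^{\sum_j i_j}(1-p)^{m-\sum_j i_j}$. Switch regions: $S_k=\left[\frac{k}{\beta},\frac{b_1}{\beta(\beta-1)}+\frac{k-1}{\beta}\right]$, $1\le k\le b_1$. Equality regions: $E_0=[0,\frac1\beta)$, $E_k=\left(\frac{b_1}{\beta(\beta-1)}+\frac{k-1}{\beta},\frac{k+1}{\beta}\right)$ for $1\le k\le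 b_1-1$, $E_{b_1}=\left(\frac{b_1}{\beta(\beta-1)}+\frac{b_1-1}{\beta},\frac{b_1}{\beta-1}\right]$. Let $\mathcal E=\{E_0,S_1,E_1,\ldots,S_{b_1},E_{b_1}\}$, a partition of $J_\beta$. Partition $\mathcal C$: under the assumptions, the points $T_\beta^i1$ and $T_\beta^i(\frac{b_1}{\beta-1}-1)$, $0\le i\le n-2$, are all different and lie in equality regions. Cutting the intervals of $\mathcal E$ at these points gives a partition $\mathcal C=\{C_0,C_1,\ldots,C_L\}$ of $J_\beta$ into intervals (listed in increasing order) refining $\mathcal E$, where each point $T_\beta^i1$ belongs to the interval of which it is the left endpoint, and each point $T_\beta^i(\frac{b_1}{\beta-1}-1)$ belongs to the interval of which it is the right endpoint. Then $C_0=[0,\frac{b_1}{\beta-1}-1]$, $C_L=[1,\frac{b_1}{\beta-1}]$; each $E_i$ is a disjoint union $\bigcup_{j\in M_i}C_j$ with $M_0,\ldots,M_{b_1}$ disjoint subsets of $\{0,\ldots,L\}$; and each $S_i$ equals exactly one $C_j$, whose index $j$ is denoted $s_i$. Thus $\{0,\ldots,L\}\setminus\bigcup_kM_k=\{s_1,\ldots,s_{b_1}\}$. Let $A=(a_{i,j})_{0\le i,j\le L}$ be the $0$-$1$ matrix with, for $i\in\bigcup_kM_k$: $a_{i,j}=1$ if $\lambda(C_j\cap T_\beta(C_i))=\lambda(C_j)$ and $a_{i,j}=0$ if $C_i\cap T_\beta^{-1}C_j=\varnothing$; and for $i\in\{s_1,\ldots,s_{b_1}\}$: $a_{i,j}=1$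 if $j\in\{0,L\}$, $a_{i,j}=0$ otherwise. Let $Y=\{y\in\{0,\ldots,L\}^{\mathbb N}:a_{y_i,y_{i+1}}=1\text{ for all }i\}$, with left shift $\sigma_Y$, and $Y'=\{y\in Y:y_i\in\{s_1,\ldots,s_{b_1}\}\text{ for infinitely many }i\}$. The map $\psi:Y'\to\Omega\times J_\beta$, $\psi(y)=(\omega,x)$, is defined as follows: $x=\sum_{j\ge1}e_j\beta^{-j}$ with $e_j=i$ if $y_j\in M_i$; $e_j=i$ if $y_j=s_i$ and $y_{j+1}=0$; $e_j=i-1$ if $y_j=s_i$ and $y_{j+1}=L$. If $n_1<n_2<\cdots$ are the indices $m$ with $y_m\in\{s_1,\ldots,s_{b_1}\}$, then $\omega_j=1$ if $y_{n_j+1}=0$ and $\omega_j=0$ if $y_{n_j+1}=L$. $Q_{\beta,p}$ is the Markov measure on $Y$ with transition matrix $P=(p_{i,j})$, where $p_{i,j}=\lambda(C_i\cap T_\beta^{-1}C_j)/\lambda(C_i)$ for $i\in\bigcup_kM_k$, and for $i\in\{s_1,\ldots,s_{b_1}\}$: $p_{i,0}=p$, $p_{i,L}=1-p$, $p_{i,j}=0$ for $j\ne0,L$; its initial distribution is the stationary distribution $\pi$ of the (irreducible) matrix $P$. It is concentrated on $Y'$, and $Q_{\beta,p}\circ\psi^{-1}$ denotes its image measure on $\Omega\times J_\beta$. *)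

theory Defs
  imports "HOL-Probability.Probability" "HOL-Library.Infinite_Set"
begin

section \<open>The greedy map and greedy expansions\<close>

definition b1 :: "real \<Rightarrow> nat" where
  "b1 \<beta> = nat \<lfloor>\<beta>\<rfloor>"

definition top_pt :: "real \<Rightarrow> real" where
  "top_pt \<beta> = real (b1 \<beta>) / (\<beta> - 1)"

definition J_int :: "real \<Rightarrow> real set" where
  "J_int \<beta> = {0..top_pt \<beta>}"

definition lam :: "real \<Rightarrow> real measure" where
  "lam \<beta> = uniform_measure lborel (J_int \<beta>)"

definition greedy_interval :: "real \<Rightarrow> nat \<Rightarrow> real set" where
  "greedy_interval \<beta> d =
     (if d < b1 \<beta> then {real d / \<beta> ..< (real d + 1) / \<beta>}
      else {real (b1 \<beta>) / \<beta> .. top_pt \<beta>})"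

text \<open>The greedy intervals with index at most \<open>b1 \<beta>\<close> partition \<open>J_int \<beta>\<close>; the following functions
  are only meaningful for arguments in \<open>J_int \<beta>\<close>.\<close>

definition lead_digit :: "real \<Rightarrow> real \<Rightarrow> nat" where
  "lead_digit \<beta> x = (THE d. d \<le> b1 \<beta> \<and> x \<in> greedy_interval \<beta> d)"

definition greedy_map :: "real \<Rightarrow> real \<Rightarrow> real" where
  "greedy_map \<beta> x = \<beta> * x - real (lead_digit \<beta> x)"

definition greedy_digit :: "real \<Rightarrow> nat \<Rightarrow> real \<Rightarrow> nat" where
  "greedy_digit \<beta> i x = lead_digit \<beta> ((greedy_map \<beta> ^^ (i - 1)) x)"

text \<open>Digits are indexed from \<open>1\<close>, and the omitted trailing digits of a finite expansion are zero.\<close>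

definition finite_greedy_expansion :: "real \<Rightarrow> real \<Rightarrow> nat \<Rightarrow> (nat \<Rightarrow> nat) \<Rightarrow> bool" where
  "finite_greedy_expansion \<beta> x n b \<longleftrightarrow>
     x = (\<Sum>i=1..n. real (b i) / \<beta> ^ i) \<and>
     (\<forall>i\<in>{1..n}. greedy_digit \<beta> i x = b i) \<and>
     (\<forall>i>n. greedy_digit \<beta> i x = 0)"

section \<open>Switch regions, equality regions and the refined partition\<close>

definition switch_region :: "real \<Rightarrow> nat \<Rightarrow> real set" where
  "switch_region \<beta> k =
     {real k / \<beta> .. real (b1 \<beta>) / (\<beta> * (\<beta> - 1)) + (real k - 1) / \<beta>}"

definition equality_region :: "real \<Rightarrow> nat \<Rightarrow> real set" where
  "equality_region \<beta> k =
     (if k = 0 then {0 ..< 1 / \<beta>}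
      else if k < b1 \<beta> then
        {real (b1 \<beta>) / (\<beta> * (\<beta> - 1)) + (real k - 1) / \<beta> <..< (real k + 1) / \<beta>}
      else {real (b1 \<beta>) / (\<beta> * (\<beta> - 1)) + (real (b1 \<beta>) - 1) / \<beta> <.. top_pt \<beta>})"

definition regions :: "real \<Rightarrow> real set set" where
  "regions \<beta> = equality_region \<beta> ` {0..b1 \<beta>} \<union> switch_region \<beta> ` {1..b1 \<beta>}"

text \<open>Two points lie in the same piece iff they lie in the same region and no cut point separates
  them.  The cut points in the orbit of \<open>1\<close> belong to the piece on their right, those in the orbit
  of \<open>top_pt \<beta> - 1\<close> to the piece on their left.\<close>

definition same_piece :: "real \<Rightarrow> nat \<Rightarrow> (real \<times> real) set" where
  "same_piece \<beta> n = {(x, y). x \<in> J_int \<beta> \<and> y \<in> J_int \<beta> \<and>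
     (\<forall>R\<in>regions \<beta>. x \<in> R \<longleftrightarrow> y \<in> R) \<and>
     (\<forall>i\<in>{0..n-2}. (greedy_map \<beta> ^^ i) 1 \<le> x \<longleftrightarrow> (greedy_map \<beta> ^^ i) 1 \<le> y) \<and>
     (\<forall>i\<in>{0..n-2}. x \<le> (greedy_map \<beta> ^^ i) (top_pt \<beta> - 1) \<longleftrightarrow>
        y \<le> (greedy_map \<beta> ^^ i) (top_pt \<beta> - 1))}"

definition pieces :: "real \<Rightarrow> nat \<Rightarrow> real set set" where
  "pieces \<beta> n = J_int \<beta> // same_piece \<beta> n"

definition last_index :: "real \<Rightarrow> nat \<Rightarrow> nat" where
  "last_index \<beta> n = card (pieces \<beta> n) - 1"

text \<open>Listing the pieces in increasing order: the \<open>j\<close>-th one has exactly \<open>j\<close> pieces to its left.\<close>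

definition piece :: "real \<Rightarrow> nat \<Rightarrow> nat \<Rightarrow> real set" where
  "piece \<beta> n j = (THE D. D \<in> pieces \<beta> n \<and>
     card {D' \<in> pieces \<beta> n. \<forall>x\<in>D'. \<forall>y\<in>D. x < y} = j)"

definition eq_index_set :: "real \<Rightarrow> nat \<Rightarrow> nat \<Rightarrow> nat set" where
  "eq_index_set \<beta> n k = {j \<in> {0..last_index \<beta> n}. piece \<beta> n j \<subseteq> equality_region \<beta> k}"

definition switch_index :: "real \<Rightarrow> nat \<Rightarrow> nat \<Rightarrow> nat" where
  "switch_index \<beta> n k = (THE j. j \<in> {0..last_index \<beta> n} \<and> piece \<beta> n j = switch_region \<beta> k)"

definition eq_indices :: "real \<Rightarrow> nat \<Rightarrow> nat set" where
  "eq_indices \<beta> n = (\<Union>k\<in>{0..b1 \<beta>}. eq_index_set \<beta> n k)"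

definition switch_indices :: "real \<Rightarrow> nat \<Rightarrow> nat set" where
  "switch_indices \<beta> n = switch_index \<beta> n ` {1..b1 \<beta>}"

section \<open>The topological Markov chain\<close>

definition greedy_preimage :: "real \<Rightarrow> real set \<Rightarrow> real set" where
  "greedy_preimage \<beta> B = {x \<in> J_int \<beta>. greedy_map \<beta> x \<in> B}"

text \<open>For \<open>i\<close> in \<open>eq_indices \<beta> n\<close> the image of the \<open>i\<close>-th piece is a union of pieces, each of
  positive measure, so the negation of the measure condition below is the same as
  \<open>piece \<beta> n i \<inter> greedy_preimage \<beta> (piece \<beta> n j) = {}\<close>.\<close>

definition adjacency :: "real \<Rightarrow> nat \<Rightarrow> nat \<Rightarrow> nat \<Rightarrow> nat" where
  "adjacency \<beta> n i j =
     (if i \<in> eq_indices \<beta> n then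
        (if measure (lam \<beta>) (piece \<beta> n j \<inter> greedy_map \<beta> ` piece \<beta> n i) = measure (lam \<beta>) (piece \<beta> n j)
         then 1 else 0)
      else (if j = 0 \<or> j = last_index \<beta> n then 1 else 0))"

text \<open>Sequences are indexed from \<open>0\<close>: \<open>y i\<close> stands for the \<open>(i + 1)\<close>-st term.\<close>

definition Y_seqs :: "real \<Rightarrow> nat \<Rightarrow> (nat \<Rightarrow> nat) set" where
  "Y_seqs \<beta> n = {y. (\<forall>i. y i \<in> {0..last_index \<beta> n}) \<and> (\<forall>i. adjacency \<beta> n (y i) (y (Suc i)) = 1)}"

definition Y_inf :: "real \<Rightarrow> nat \<Rightarrow> (nat \<Rightarrow> nat) set" where
  "Y_inf \<beta> n = {y \<in> Y_seqs \<beta> n. infinite {i. y i \<in> switch_indices \<beta> n}}"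

section \<open>The coding map\<close>

definition expansion_digit :: "real \<Rightarrow> nat \<Rightarrow> (nat \<Rightarrow> nat) \<Rightarrow> nat \<Rightarrow> nat" where
  "expansion_digit \<beta> n y j =
     (if y j \<in> eq_indices \<beta> n then (THE k. k \<in> {0..b1 \<beta>} \<and> y j \<in> eq_index_set \<beta> n k)
      else (let k = (THE k. k \<in> {1..b1 \<beta>} \<and> y j = switch_index \<beta> n k)
            in if y (Suc j) = 0 then k else k - 1))"

text \<open>The space \<open>{0,1}\<^sup>\<nat>\<close> is represented by \<open>nat \<Rightarrow> bool\<close>, with \<open>True\<close> for \<open>1\<close>.
  \<open>enumerate S\<close> lists an infinite set \<open>S\<close> of naturals increasingly, starting with index \<open>0\<close>.\<close>

definition psi :: "real \<Rightarrow> nat \<Rightarrow> (nat \<Rightarrow> nat) \<Rightarrow> (nat \<Rightarrow> bool) \<times> real" where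
  "psi \<beta> n y =
     ((\<lambda>j. y (Suc (enumerate {i. y i \<in> switch_indices \<beta> n} j)) = 0),
      (\<Sum>j. real (expansion_digit \<beta> n y j) / \<beta> ^ Suc j))"

section \<open>The measures\<close>

definition bernoulli_measure :: "real \<Rightarrow> (nat \<Rightarrow> bool) measure" where
  "bernoulli_measure p = (\<Pi>\<^sub>M i\<in>UNIV. measure_pmf (bernoulli_pmf p))"

definition trans_prob :: "real \<Rightarrow> nat \<Rightarrow> real \<Rightarrow> nat \<Rightarrow> nat \<Rightarrow> real" where
  "trans_prob \<beta> n p i j =
     (if i \<in> eq_indices \<beta> n then
        measure (lam \<beta>) (piece \<beta> n i \<inter> greedy_preimage \<beta> (piece \<beta> n j)) / measure (lam \<beta>) (piece \<beta> n i)
      else if j = 0 then p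
      else if j = last_index \<beta> n then 1 - p
      else 0)"

definition stationary :: "real \<Rightarrow> nat \<Rightarrow> real \<Rightarrow> nat pmf" where
  "stationary \<beta> n p = (THE q. set_pmf q \<subseteq> {0..last_index \<beta> n} \<and>
     (\<forall>j\<in>{0..last_index \<beta> n}. (\<Sum>i=0..last_index \<beta> n. pmf q i * trans_prob \<beta> n p i j) = pmf q j))"

definition Y_space :: "real \<Rightarrow> nat \<Rightarrow> (nat \<Rightarrow> nat) measure" where
  "Y_space \<beta> n = restrict_space (\<Pi>\<^sub>M i\<in>UNIV. count_space {0..last_index \<beta> n}) (Y_seqs \<beta> n)"

text \<open>The Markov measure is the unique probability measure with the prescribed values on cylinders.\<close>

definition markov_Q :: "real \<Rightarrow> nat \<Rightarrow> real \<Rightarrow> (nat \<Rightarrow> nat) measure" where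
  "markov_Q \<beta> n p = (THE N. prob_space N \<and> sets N = sets (Y_space \<beta> n) \<and>
     (\<forall>w m. (\<forall>i. w i \<in> {0..last_index \<beta> n}) \<longrightarrow>
        measure N {y \<in> Y_seqs \<beta> n. \<forall>i\<le>m. y i = w i} =
          pmf (stationary \<beta> n p) (w 0) * (\<Prod>i<m. trans_prob \<beta> n p (w i) (w (Suc i)))))"

text \<open>The map \<open>psi\<close> is only defined on \<open>Y_inf\<close>, a set of full measure for \<open>markov_Q\<close>.\<close>

definition Q_psi :: "real \<Rightarrow> nat \<Rightarrow> real \<Rightarrow> ((nat \<Rightarrow> bool) \<times> real) measure" where
  "Q_psi \<beta> n p =
     distr (restrict_space (markov_Q \<beta> n p) (Y_inf \<beta> n))
       ((\<Pi>\<^sub>M i\<in>UNIV. count_space UNIV) \<Otimes>\<^sub>M restrict_space borel (J_int \<beta>)) (psi \<beta> n)"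

end

theory Submission
  imports Defs
begin

text \<open>Let \<open>K\<close> be the random map on \<open>\<Omega> \<times> J\<close> that applies the greedy map off the switch regions, and on a
  switch region spends the first coin of \<open>\<omega>\<close> to choose between the greedy and the lazy branch.  Every
  piece of the partition is mapped by each branch affinely onto a union of pieces.  Hence, if
  \<open>\<omega>\<close> has law \<open>m\<^sub>p\<close> and \<open>x\<close> is independent of it and uniform on a piece, then the
  sequence of pieces visited by \<open>K\<close> from \<open>(\<omega>, x)\<close> is the Markov chain with matrix \<open>P\<close>: after one step
  the coins still have law \<open>m\<^sub>p\<close> and the point is uniform on the new piece, independently of the coins.
  So \<open>Q\<close> is the law of the code under \<open>m\<^sub>p \<otimes> \<mu>\<close>, where \<open>\<mu>\<close> mixes the uniform laws on the pieces
  with the stationary weights.  Since \<open>\<psi>\<close> recovers \<open>(\<omega>, x)\<close> from its code whenever the orbit visits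
  the switch regions infinitely often, which is almost sure because an expanding map cannot keep
  an interval away from them, \<open>Q \<circ> \<psi>\<^sup>-\<^sup>1 = m\<^sub>p \<otimes> \<mu>\<close>.\<close>

section \<open>Finite stochastic matrices\<close>

text \<open>The hypotheses on the expansion act through one inequality. The second digit of 1 is
  positive, so the first image \<beta> - \<open>b1 \<beta>\<close> of 1 is at least 1/\<beta>;
  excluding equality gives u - 1 < 1/\<beta>, where u is the right end point of J. Hence the two
  images [0, u - 1] and [1, u] of a switch region are single pieces. Also, the greedy image of a
  switch point has digit 0, which the orbit of 1 avoids until it vanishes; so the orbit points used
  as cuts lie in equality regions. This orbit runs into b_n/\<beta>, the left end of a switch
  region, so the finite set of left ends is closed under the greedy map up to the value 0: the
  partition is Markov. The reflection of x to u - x exchanges left and right ends, so that only left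
  ends need a separate treatment. Two objects are definite descriptions and must be shown to denote.
  For \<open>stationary\<close> this holds because every set of states closed under possible
  transitions contains 0, by the same expansion argument that yields recurrence. For
  \<open>markov_Q\<close> the law of the code is itself a witness, and cylinders give
  uniqueness.\<close>

lemma finite_common_convergent_subseq:
  fixes v :: "nat \<Rightarrow> 'i \<Rightarrow> real"
  assumes "finite S" "\<And>N i. i \<in> S \<Longrightarrow> v N i \<in> {0..1}"
  shows "\<exists>r. strict_mono (r :: nat \<Rightarrow> nat) \<and> (\<forall>i\<in>S. convergent (\<lambda>N. v (r N) i))"
  using assms
proof (induction S rule: finite_induct)
  case empty
  show ?case by (intro exI[of _ id]) (auto simp: strict_mono_def)
next
  case (insert x S)
  then obtain r where r: "strict_mono (r :: nat \<Rightarrow> nat)" "\<forall>i\<in>S. convergent (\<lambda>N. v (r N) i)"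
    by auto
  have "\<forall>N. v (r N) x \<in> {0..1}" using insert.prems by auto
  hence "\<exists>l s. strict_mono (s :: nat \<Rightarrow> nat) \<and> ((\<lambda>N. v (r N) x) \<circ> s) \<longlonglongrightarrow> l"
    using compact_imp_seq_compact[of "{0..1::real}"]
    unfolding seq_compact_def by (auto dest!: spec[of _ "\<lambda>N. v (r N) x"])
  then obtain l s where s: "strict_mono (s :: nat \<Rightarrow> nat)" "((\<lambda>N. v (r N) x) \<circ> s) \<longlonglongrightarrow> l" by blast
  have "convergent (\<lambda>N. v ((r \<circ> s) N) i)" if "i \<in> insert x S" for i
  proof (cases "i = x")
    case True
    then show ?thesis using s(2) by (auto simp: convergent_def comp_def)
  next
    case False
    hence "i \<in> S" using that by simp
    hence "convergent (\<lambda>N. v (r N) i)" using r(2) by simp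
    then obtain l where "(\<lambda>N. v (r N) i) \<longlonglongrightarrow> l" unfolding convergent_def by (elim exE)
    from LIMSEQ_subseq_LIMSEQ[OF this s(1)] show ?thesis by (auto simp: convergent_def comp_def)
  qed
  moreover have "strict_mono (r \<circ> s)" using r(1) s(1) by (rule strict_mono_o)
  ultimately show ?case by blast
qed

locale stochastic_matrix =
  fixes S :: "'s set" and P :: "'s \<Rightarrow> 's \<Rightarrow> real"
  assumes finite_S: "finite S"
    and nonneg: "i \<in> S \<Longrightarrow> j \<in> S \<Longrightarrow> 0 \<le> P i j"
    and row_sum: "i \<in> S \<Longrightarrow> (\<Sum>j\<in>S. P i j) = 1"
begin

text \<open>Sets that the chain cannot leave. A state common to all of them plays the part of
  irreducibility in the uniqueness proof.\<close>

definition closed_set :: "'s set \<Rightarrow> bool" where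
  "closed_set D \<longleftrightarrow> D \<noteq> {} \<and> D \<subseteq> S \<and> (\<forall>i\<in>D. \<forall>j\<in>S. 0 < P i j \<longrightarrow> j \<in> D)"

definition invariant :: "('s \<Rightarrow> real) \<Rightarrow> bool" where
  "invariant q \<longleftrightarrow> (\<forall>j\<in>S. (\<Sum>i\<in>S. q i * P i j) = q j)"

lemma sum_mult_row: "(\<Sum>j\<in>S. \<Sum>i\<in>S. q i * P i j) = (\<Sum>i\<in>S. q i)"
proof -
  have "(\<Sum>j\<in>S. \<Sum>i\<in>S. q i * P i j) = (\<Sum>i\<in>S. \<Sum>j\<in>S. q i * P i j)"
    by (rule sum.swap)
  also have "\<dots> = (\<Sum>i\<in>S. q i)"
    by (intro sum.cong refl) (simp add: row_sum flip: sum_distrib_left)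
  finally show ?thesis .
qed

text \<open>Invariance carries positive mass along every possible transition, and nonnegativity
  excludes cancellation on arrival.\<close>

lemma closed_support:
  assumes "invariant q" "\<And>i. i \<in> S \<Longrightarrow> 0 \<le> q i" "i0 \<in> S" "q i0 > 0"
  shows "closed_set {i\<in>S. q i > 0}"
  unfolding closed_set_def
proof (intro conjI ballI impI)
  fix i j assume i: "i \<in> {i \<in> S. 0 < q i}" and j: "j \<in> S" "0 < P i j"
  have "0 < q i * P i j" using i j by auto
  also have "\<dots> \<le> (\<Sum>i\<in>S. q i * P i j)"
    using i j assms(2) nonneg finite_S by (intro member_le_sum) auto
  also have "\<dots> = q j" using assms(1) j by (auto simp: invariant_def)
  finally show "j \<in> {i\<in>S. q i > 0}" using j by auto
qed (use assms in auto)

text \<open>By the triangle inequality no entry decreases when P is applied to the absolute values.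
  Since P preserves the total mass, no entry can increase strictly either.\<close>

lemma invariant_abs:
  assumes "invariant q"
  shows "invariant (\<lambda>i. \<bar>q i\<bar>)"
proof -
  let ?d = "\<lambda>j. (\<Sum>i\<in>S. \<bar>q i\<bar> * P i j) - \<bar>q j\<bar>"
  have ge: "?d j \<ge> 0" if "j \<in> S" for j
  proof -
    have "\<bar>q j\<bar> = \<bar>\<Sum>i\<in>S. q i * P i j\<bar>" using assms that by (simp add: invariant_def)
    also have "\<dots> \<le> (\<Sum>i\<in>S. \<bar>q i * P i j\<bar>)" by (rule sum_abs)
    also have "\<dots> = (\<Sum>i\<in>S. \<bar>q i\<bar> * P i j)"
      using nonneg that by (intro sum.cong) (auto simp: abs_mult)
    finally show ?thesis by simp
  qed
  have "(\<Sum>j\<in>S. ?d j) = 0" by (simp add: sum_subtractf sum_mult_row)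
  hence "\<forall>j\<in>S. ?d j = 0" using ge finite_S by (subst (asm) sum_nonneg_eq_0_iff) auto
  thus ?thesis by (auto simp: invariant_def)
qed

text \<open>Were the difference of two invariant vectors nonzero, its positive and negative parts would be
  invariant with disjoint closed supports, both containing \<open>s0\<close>.\<close>
lemma invariant_unique:
  assumes meet: "\<And>D. closed_set D \<Longrightarrow> s0 \<in> D"
    and q: "invariant q" "(\<Sum>i\<in>S. q i) = 1" and r: "invariant r" "(\<Sum>i\<in>S. r i) = 1"
    and i: "i \<in> S"
  shows "q i = r i"
proof -
  define d where "d i = q i - r i" for i
  have d: "invariant d" using q(1) r(1)
    by (auto simp: invariant_def d_def left_diff_distrib sum_subtractf)
  have ad: "invariant (\<lambda>i. \<bar>d i\<bar>)" by (rule invariant_abs[OF d])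
  have pos: "invariant (\<lambda>i. \<bar>d i\<bar> + d i)" and neg: "invariant (\<lambda>i. \<bar>d i\<bar> - d i)"
    using d ad by (auto simp: invariant_def distrib_right left_diff_distrib sum_subtractf sum.distrib)
  have "(\<Sum>i\<in>S. d i) = 0" using q(2) r(2) by (simp add: d_def sum_subtractf)
  have "\<not> (\<exists>i\<in>S. d i > 0) \<or> \<not> (\<exists>i\<in>S. d i < 0)"
  proof (rule ccontr)
    assume "\<not> ?thesis"
    then obtain i j where ij: "i \<in> S" "d i > 0" "j \<in> S" "d j < 0" by auto
    have "s0 \<in> {i\<in>S. \<bar>d i\<bar> + d i > 0}"
      by (intro meet closed_support[OF pos _ ij(1)]) (use ij in auto)
    moreover have "s0 \<in> {i\<in>S. \<bar>d i\<bar> - d i > 0}"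
      by (intro meet closed_support[OF neg _ ij(3)]) (use ij in auto)
    ultimately show False by auto
  qed
  \<comment> \<open>A vector of constant sign with sum 0 vanishes.\<close>
  hence "\<forall>i\<in>S. d i = 0"
  proof
    assume "\<not> (\<exists>i\<in>S. d i > 0)"
    hence "\<forall>i\<in>S. - d i = 0" using \<open>(\<Sum>i\<in>S. d i) = 0\<close> finite_S
      by (subst sum_nonneg_eq_0_iff[symmetric]) (auto simp: sum_negf not_less)
    thus ?thesis by auto
  next
    assume "\<not> (\<exists>i\<in>S. d i < 0)"
    thus ?thesis using \<open>(\<Sum>i\<in>S. d i) = 0\<close> finite_S
      by (subst sum_nonneg_eq_0_iff[symmetric]) (auto simp: not_less)
  qed
  thus ?thesis using i by (auto simp: d_def)
qed

text \<open>Krylov-Bogoliubov: \<open>u t\<close> is the law after t steps from \<open>s0\<close>,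
  \<open>v N\<close> the average of the first N + 1 of these laws, and any subsequential limit of
  the averages is invariant.\<close>

lemma invariant_exists:
  assumes "s0 \<in> S"
  shows "\<exists>q. invariant q \<and> (\<forall>i\<in>S. 0 \<le> q i) \<and> (\<Sum>i\<in>S. q i) = 1"
proof -
  define u where "u = rec_nat (\<lambda>i. if i = s0 then 1 else 0 :: real) (\<lambda>_ q j. \<Sum>i\<in>S. q i * P i j)"
  have u0: "u 0 = (\<lambda>i. if i = s0 then 1 else 0)" and uS: "u (Suc t) j = (\<Sum>i\<in>S. u t i * P i j)" for t j
    by (auto simp: u_def)
  have u_nn: "0 \<le> u t i" if "i \<in> S" for t i
    using that by (induction t arbitrary: i) (auto simp: u0 uS nonneg intro!: sum_nonneg)
  have u_sum: "(\<Sum>i\<in>S. u t i) = 1" for t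
    by (induction t) (auto simp: u0 uS sum_mult_row assms finite_S)
  have u_le: "u t i \<le> 1" if "i \<in> S" for t i
    using member_le_sum[of i S "u t"] u_sum u_nn that finite_S by auto
  define v where "v N i = (\<Sum>t<Suc N. u t i) / real (Suc N)" for N i
  have v_nn: "0 \<le> v N i" if "i \<in> S" for N i
    using u_nn that unfolding v_def by (intro divide_nonneg_pos sum_nonneg) auto
  have v_sum: "(\<Sum>i\<in>S. v N i) = 1" for N
  proof -
    have "(\<Sum>i\<in>S. v N i) = (\<Sum>i\<in>S. \<Sum>t<Suc N. u t i) / real (Suc N)"
      by (simp add: v_def sum_divide_distrib)
    also have "(\<Sum>i\<in>S. \<Sum>t<Suc N. u t i) = (\<Sum>t<Suc N. \<Sum>i\<in>S. u t i)" by (rule sum.swap)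
    also have "\<dots> = real (Suc N)" by (simp add: u_sum del: sum.lessThan_Suc)
    finally show ?thesis by (simp del: of_nat_Suc)
  qed
  have v_le: "v N i \<le> 1" if "i \<in> S" for N i
    using member_le_sum[of i S "v N"] v_sum v_nn that finite_S by auto
  obtain r where r: "strict_mono (r :: nat \<Rightarrow> nat)" "\<forall>i\<in>S. convergent (\<lambda>N. v (r N) i)"
    using finite_common_convergent_subseq[OF finite_S, of v] v_nn v_le by auto
  define q where "q i = lim (\<lambda>N. v (r N) i)" for i
  have q: "(\<lambda>N. v (r N) i) \<longlonglongrightarrow> q i" if "i \<in> S" for i
    using r(2) that by (auto simp: q_def convergent_LIMSEQ_iff)
  have q_nn: "\<forall>i\<in>S. 0 \<le> q i"
  proof
    fix i assume "i \<in> S"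
    thus "0 \<le> q i" by (intro LIMSEQ_le_const[OF q]) (auto simp: v_nn)
  qed
  have q_sum: "(\<Sum>i\<in>S. q i) = 1"
  proof -
    have "(\<lambda>N. \<Sum>i\<in>S. v (r N) i) \<longlonglongrightarrow> (\<Sum>i\<in>S. q i)" by (intro tendsto_sum q)
    thus ?thesis using LIMSEQ_unique[OF _ tendsto_const] by (simp add: v_sum)
  qed
  have "invariant q" unfolding invariant_def
  proof
    fix j assume j: "j \<in> S"
    have l1: "(\<lambda>N. (\<Sum>i\<in>S. v (r N) i * P i j) - v (r N) j) \<longlonglongrightarrow> (\<Sum>i\<in>S. q i * P i j) - q j"
      using j by (intro tendsto_diff tendsto_sum tendsto_mult q tendsto_const) auto
    \<comment> \<open>Applying P shifts the averaged laws by one step, so all but the two extreme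
      terms cancel; the defect is of order 1/N.\<close>
    have eq: "(\<Sum>i\<in>S. v N i * P i j) - v N j = (u (Suc N) j - u 0 j) / real (Suc N)" for N
    proof -
      have "(\<Sum>i\<in>S. v N i * P i j) = (\<Sum>i\<in>S. \<Sum>t<Suc N. u t i * P i j) / real (Suc N)"
        by (simp add: v_def sum_divide_distrib sum_distrib_right del: sum.lessThan_Suc)
      also have "(\<Sum>i\<in>S. \<Sum>t<Suc N. u t i * P i j) = (\<Sum>t<Suc N. u (Suc t) j)"
        by (subst sum.swap) (simp add: uS)
      finally have "(\<Sum>i\<in>S. v N i * P i j) - v N j = (\<Sum>t<Suc N. u (Suc t) j - u t j) / real (Suc N)"
        by (simp add: v_def sum_subtractf diff_divide_distrib del: sum.lessThan_Suc)
      thus ?thesis by (simp only: sum_lessThan_telescope[of "\<lambda>t. u t j"])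
    qed
    have l2: "(\<lambda>N. (u (Suc N) j - u 0 j) / real (Suc N)) \<longlonglongrightarrow> 0"
    proof (rule Lim_null_comparison)
      show "\<forall>\<^sub>F N in sequentially. norm ((u (Suc N) j - u 0 j) / real (Suc N)) \<le> 1 / real (Suc N)"
      proof (intro always_eventually allI)
        fix N
        have "\<bar>u (Suc N) j - u 0 j\<bar> \<le> 1"
          using u_nn[OF j, of "Suc N"] u_nn[OF j, of 0] u_le[OF j, of "Suc N"] u_le[OF j, of 0] by linarith
        thus "norm ((u (Suc N) j - u 0 j) / real (Suc N)) \<le> 1 / real (Suc N)"
          by (simp add: divide_right_mono)
      qed
      show "(\<lambda>N. 1 / real (Suc N)) \<longlonglongrightarrow> 0" by (rule LIMSEQ_Suc[OF lim_1_over_n])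
    qed
    have "(\<lambda>N. (\<Sum>i\<in>S. v (r N) i * P i j) - v (r N) j) \<longlonglongrightarrow> 0"
      unfolding eq using LIMSEQ_subseq_LIMSEQ[OF l2 r(1)] by (simp add: comp_def)
    from LIMSEQ_unique[OF l1 this] show "(\<Sum>i\<in>S. q i * P i j) = q j" by simp
  qed
  with q_nn q_sum show ?thesis by blast
qed

text \<open>Shaped to match the definite description in \<open>stationary\<close>.\<close>

lemma ex1_stationary_pmf:
  assumes meet: "\<And>D. closed_set D \<Longrightarrow> s0 \<in> D" and "s0 \<in> S"
  shows "\<exists>!q. set_pmf q \<subseteq> S \<and> (\<forall>j\<in>S. (\<Sum>i\<in>S. pmf q i * P i j) = pmf q j)"
proof (rule ex_ex1I)
  from invariant_exists[OF \<open>s0 \<in> S\<close>] obtain q where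
    q: "invariant q" "\<forall>i\<in>S. 0 \<le> q i" "(\<Sum>i\<in>S. q i) = 1" by auto
  \<comment> \<open>\<open>embed_pmf\<close> needs nonnegativity and total mass 1 on the whole type,
    whereas q is controlled on S only.\<close>
  define q' where "q' i = (if i \<in> S then q i else 0)" for i
  have nn: "0 \<le> q' i" for i using q by (auto simp: q'_def)
  have "(\<integral>\<^sup>+ i. ennreal (q' i) \<partial>count_space UNIV) = (\<integral>\<^sup>+ i. ennreal (q' i) * indicator S i \<partial>count_space UNIV)"
    by (intro nn_integral_cong) (auto simp: q'_def)
  also have "\<dots> = (\<integral>\<^sup>+ i. ennreal (q' i) \<partial>count_space S)"
    by (subst nn_integral_count_space_indicator) auto
  also have "\<dots> = ennreal (\<Sum>i\<in>S. q' i)"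
    using finite_S nn by (simp add: nn_integral_count_space_finite sum_ennreal)
  also have "(\<Sum>i\<in>S. q' i) = 1" using q(3) by (simp add: q'_def)
  finally have int: "(\<integral>\<^sup>+ i. ennreal (q' i) \<partial>count_space UNIV) = 1" by simp
  have pm: "pmf (embed_pmf q') i = q' i" for i
    by (rule pmf_embed_pmf[OF nn int])
  have "set_pmf (embed_pmf q') \<subseteq> S"
    by (auto simp: set_pmf_iff pm q'_def split: if_splits)
  moreover have "\<forall>j\<in>S. (\<Sum>i\<in>S. pmf (embed_pmf q') i * P i j) = pmf (embed_pmf q') j"
    using q(1) by (simp add: pm q'_def invariant_def)
  ultimately show "\<exists>q. set_pmf q \<subseteq> S \<and> (\<forall>j\<in>S. (\<Sum>i\<in>S. pmf q i * P i j) = pmf q j)" by blast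
next
  fix q r :: "'s pmf"
  assume q: "set_pmf q \<subseteq> S \<and> (\<forall>j\<in>S. (\<Sum>i\<in>S. pmf q i * P i j) = pmf q j)"
    and r: "set_pmf r \<subseteq> S \<and> (\<forall>j\<in>S. (\<Sum>i\<in>S. pmf r i * P i j) = pmf r j)"
  have "pmf q i = pmf r i" if "i \<in> S" for i
    by (rule invariant_unique[OF meet _ _ _ _ that])
      (use q r finite_S in \<open>auto simp: invariant_def sum_pmf_eq_1\<close>)
  moreover have "pmf q i = pmf r i" if "i \<notin> S" for i
    using q r that by (metis set_pmf_iff subsetD)
  ultimately show "q = r" by (intro pmf_eqI) blast
qed

text \<open>Maximum principle: the set where \<open>h\<close> attains its maximum would be closed.\<close>
lemma harmonic_eq_0:
  assumes meet: "\<And>D. closed_set D \<Longrightarrow> D \<inter> Z \<noteq> {}"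
    and nn: "\<And>i. i \<in> S \<Longrightarrow> 0 \<le> h i"
    and zero: "\<And>i. i \<in> S \<inter> Z \<Longrightarrow> h i = (0::real)"
    and harm: "\<And>i. i \<in> S - Z \<Longrightarrow> h i = (\<Sum>j\<in>S. P i j * h j)"
    and i: "i \<in> S"
  shows "h i = 0"
proof (rule ccontr)
  assume "h i \<noteq> 0"
  hence hi: "h i > 0" using nn i by force
  define M where "M = Max (h ` S)"
  have le: "h j \<le> M" if "j \<in> S" for j using finite_S that by (auto simp: M_def)
  have M0: "M > 0" using le[OF i] hi by simp
  have "M \<in> h ` S" unfolding M_def using finite_S i by (intro Max_in) auto
  hence "closed_set {j\<in>S. h j = M}" unfolding closed_set_def
  proof (intro conjI ballI impI)
    fix i j assume i: "i \<in> {j\<in>S. h j = M}" and j: "j \<in> S" "0 < P i j"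
    have "i \<notin> Z" using zero[of i] i M0 by auto
    hence "(\<Sum>k\<in>S. P i k * h k) = M" using harm[of i] i by auto
    moreover have "(\<Sum>k\<in>S. P i k * M) = M" using row_sum[of i] i by (simp flip: sum_distrib_right)
    ultimately have "(\<Sum>k\<in>S. P i k * (M - h k)) = 0" by (simp add: right_diff_distrib sum_subtractf)
    hence "\<forall>k\<in>S. P i k * (M - h k) = 0" using finite_S nonneg le i
      by (subst (asm) sum_nonneg_eq_0_iff) auto
    thus "j \<in> {j\<in>S. h j = M}" using j by force
  qed auto
  from meet[OF this] zero M0 show False by auto
qed

end

text \<open>Justifies listing the pieces by the number of pieces to their left: the rank is strictly
  monotone, hence injective, and it stays below the cardinality.\<close>

lemma bij_betw_rank:
  fixes lt :: "'a \<Rightarrow> 'a \<Rightarrow> bool"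
  assumes fin: "finite X" and irr: "\<And>x. x \<in> X \<Longrightarrow> \<not> lt x x"
    and tr: "\<And>x y z. x \<in> X \<Longrightarrow> y \<in> X \<Longrightarrow> z \<in> X \<Longrightarrow> lt x y \<Longrightarrow> lt y z \<Longrightarrow> lt x z"
    and tot: "\<And>x y. x \<in> X \<Longrightarrow> y \<in> X \<Longrightarrow> x \<noteq> y \<Longrightarrow> lt x y \<or> lt y x"
  shows "bij_betw (\<lambda>x. card {y\<in>X. lt y x}) X {..<card X}"
proof -
  let ?r = "\<lambda>x. card {y\<in>X. lt y x}"
  have less: "?r x < ?r y" if "x \<in> X" "y \<in> X" "lt x y" for x y
  proof (rule psubset_card_mono)
    show "{z \<in> X. lt z x} \<subset> {z \<in> X. lt z y}"
      using that irr[OF that(1)] tr[OF _ that(1,2) _ that(3)] by blast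
  qed (use fin in simp)
  have inj: "inj_on ?r X"
  proof (rule inj_onI, rule ccontr)
    fix x y assume "x \<in> X" "y \<in> X" "?r x = ?r y" "x \<noteq> y"
    thus False using less[of x y] less[of y x] tot[of x y] by auto
  qed
  have "?r ` X \<subseteq> {..<card X}"
  proof (rule image_subsetI)
    fix x assume "x \<in> X"
    hence "{y \<in> X. lt y x} \<subset> X" using irr by blast
    thus "?r x \<in> {..<card X}" using fin by (auto intro: psubset_card_mono)
  qed
  moreover have "card (?r ` X) = card {..<card X}" using inj by (simp add: card_image)
  ultimately have "?r ` X = {..<card X}" by (intro card_subset_eq) auto
  with inj show ?thesis by (simp add: bij_betw_def)
qed

text \<open>Turns the recursively defined enumeration into a finite count. This shows which coin is
  spent at a given switch time, and that the event of a given switch time depends on finitely many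
  coordinates.\<close>

lemma enumerate_eq_iff:
  fixes S :: "nat set"
  assumes "infinite S"
  shows "enumerate S j = m \<longleftrightarrow> m \<in> S \<and> card {i\<in>S. i < m} = j"
proof -
  have c: "card {i\<in>S. i < enumerate S j} = j" for j
  proof -
    have "{i\<in>S. i < enumerate S j} = enumerate S ` {..<j}"
    proof safe
      fix i assume "i \<in> S" "i < enumerate S j"
      then obtain k where "i = enumerate S k" using enumerate_Ex[OF assms \<open>i \<in> S\<close>] by metis
      with \<open>i < enumerate S j\<close> show "i \<in> enumerate S ` {..<j}" using assms by auto
    qed (use assms enumerate_in_set in \<open>auto simp: enumerate_mono\<close>)
    moreover have "inj_on (enumerate S) {..<j}"
      using strict_mono_enumerate[OF assms] by (auto simp: inj_on_def strict_mono_eq)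
    ultimately show ?thesis by (simp add: card_image)
  qed
  show ?thesis
  proof
    assume "enumerate S j = m"
    thus "m \<in> S \<and> card {i\<in>S. i < m} = j" using c assms by (auto simp: enumerate_in_set)
  next
    assume m: "m \<in> S \<and> card {i\<in>S. i < m} = j"
    then obtain k where "m = enumerate S k" using enumerate_Ex assms by metis
    with m c show "enumerate S j = m" by auto
  qed
qed

section \<open>The random map and its code\<close>

text \<open>Every branch of the random map has the form c + \<beta> * x; all factors 1/\<beta> below
  come from here.\<close>

lemma emeasure_lborel_affine_vimage:
  fixes c \<beta> :: real
  assumes "X \<in> sets borel" "\<beta> > 0"
  shows "emeasure lborel ((\<lambda>x. c + \<beta> * x) -` X) = ennreal (1 / \<beta>) * emeasure lborel X"
proof -
  have [measurable]: "X \<in> sets borel" by fact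
  have eq: "indicator X (c + \<beta> * x) = (indicator ((\<lambda>x. c + \<beta> * x) -` X) x :: ennreal)" for x
    by (auto simp: indicator_def)
  have m: "(\<lambda>x. c + \<beta> * x) -` X \<in> sets lborel"
    using measurable_sets[of "\<lambda>x. c + \<beta> * x" borel borel X] by simp
  have "emeasure lborel X = (\<integral>\<^sup>+x. indicator X x \<partial>lborel)" by simp
  also have "\<dots> = ennreal \<bar>\<beta>\<bar> * (\<integral>\<^sup>+x. indicator X (c + \<beta> * x) \<partial>lborel)"
    using assms(2) by (intro nn_integral_real_affine) auto
  also have "(\<integral>\<^sup>+x. indicator X (c + \<beta> * x) \<partial>lborel) = emeasure lborel ((\<lambda>x. c + \<beta> * x) -` X)"
    unfolding eq using m by simp
  finally have *: "emeasure lborel X = ennreal \<bar>\<beta>\<bar> * emeasure lborel ((\<lambda>x. c + \<beta> * x) -` X)" .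
  have "ennreal (1 / \<beta>) * (ennreal \<bar>\<beta>\<bar> * e) = e" for e
    using assms(2) by (simp add: mult.assoc[symmetric] ennreal_mult[symmetric])
  thus ?thesis unfolding * by simp
qed

section \<open>Geometry of the greedy map\<close>

locale finite_greedy =
  fixes \<beta> :: real and n :: nat and b :: "nat \<Rightarrow> nat"
  assumes beta_gt_1: "\<beta> > 1" and beta_nonint: "\<beta> \<notin> \<int>"
    and n_ge_2: "n \<ge> 2"
    and expansion: "finite_greedy_expansion \<beta> 1 n b"
    and digits_pos: "\<forall>i\<in>{1..n}. b i \<ge> 1"
    and beta_sq: "\<beta>\<^sup>2 \<noteq> real (b 1) * \<beta> + 1"
begin

abbreviation "B \<equiv> b1 \<beta>"
abbreviation "u \<equiv> top_pt \<beta>"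
abbreviation "J \<equiv> J_int \<beta>"
abbreviation "T \<equiv> greedy_map \<beta>"
abbreviation "ld \<equiv> lead_digit \<beta>"

definition t :: "nat \<Rightarrow> real" where "t i = (T ^^ i) 1"

text \<open>The point \<open>x\<close> lies in the switch region with index \<open>ld x\<close>.\<close>
definition sw :: "real \<Rightarrow> bool" where
  "sw x \<longleftrightarrow> 1 \<le> ld x \<and> \<beta> * x \<le> u + real (ld x) - 1"

section \<open>Greedy digits and the orbit of 1\<close>

lemma beta_pos [simp]: "\<beta> > 0" "\<beta> \<noteq> 0" "\<beta> \<ge> 0" using beta_gt_1 by auto

lemma B_less: "real B < \<beta>" and less_B: "\<beta> < real B + 1" and B_ge_1: "B \<ge> 1"
proof -
  have "real B = real_of_int \<lfloor>\<beta>\<rfloor>" using beta_gt_1 by (simp add: b1_def)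
  moreover have "real_of_int \<lfloor>\<beta>\<rfloor> \<noteq> \<beta>" using beta_nonint by (metis Ints_of_int)
  ultimately show "real B < \<beta>" "\<beta> < real B + 1" by linarith+
  show "B \<ge> 1" using beta_gt_1 unfolding b1_def by linarith
qed

text \<open>The top point is the fixed point of the last branch. The reflection identities rest on
  this equation.\<close>

lemma beta_u: "\<beta> * u = u + real B"
  using beta_gt_1 by (simp add: top_pt_def field_simps)

lemma u_gt_1: "1 < u"
  using beta_gt_1 less_B by (simp add: top_pt_def field_simps)

lemma in_J: "x \<in> J \<longleftrightarrow> 0 \<le> x \<and> x \<le> u"
  by (simp add: J_int_def)

lemma reflect_J: "x \<in> J \<Longrightarrow> u - x \<in> J"
  by (simp add: in_J)

lemma in_greedy_interval:
  assumes "d \<le> B"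
  shows "x \<in> greedy_interval \<beta> d \<longleftrightarrow>
    real d \<le> \<beta> * x \<and> (d < B \<longrightarrow> \<beta> * x < real d + 1) \<and> (d = B \<longrightarrow> x \<le> u)"
  using assms by (auto simp: greedy_interval_def field_simps)

lemma ld_eqI:
  assumes "d \<le> B" "real d \<le> \<beta> * x" "d < B \<Longrightarrow> \<beta> * x < real d + 1" "x \<le> u"
  shows "ld x = d"
  unfolding lead_digit_def
proof (rule the_equality)
  show "d \<le> B \<and> x \<in> greedy_interval \<beta> d" using assms in_greedy_interval by auto
  fix d' assume d': "d' \<le> B \<and> x \<in> greedy_interval \<beta> d'"
  hence *: "real d' \<le> \<beta> * x" "d' < B \<longrightarrow> \<beta> * x < real d' + 1" using in_greedy_interval by auto
  show "d' = d"
  proof (rule linorder_cases[of d' d])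
    assume "d' < d"
    hence "real d' + 1 \<le> real d" by linarith
    moreover have "\<beta> * x < real d' + 1" using * \<open>d' < d\<close> assms(1) by linarith
    ultimately show ?thesis using assms(2) by linarith
  next
    assume "d < d'"
    hence "real d + 1 \<le> real d'" by linarith
    moreover have "\<beta> * x < real d + 1" using assms(3) \<open>d < d'\<close> d' by linarith
    ultimately show ?thesis using * by linarith
  qed auto
qed

text \<open>A closed form replacing the definite description; it yields both the digit bounds and
  the measurability of \<open>T\<close>. The cap at B reflects that the last branch is longer than
  1/\<beta>.\<close>

lemma ld_min: assumes "x \<in> J" shows "ld x = min B (nat \<lfloor>\<beta> * x\<rfloor>)"
proof (rule ld_eqI)
  have nn: "0 \<le> \<beta> * x" using assms by (simp add: in_J)
  show "real (min B (nat \<lfloor>\<beta> * x\<rfloor>)) \<le> \<beta> * x" using nn by linarith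
  show "\<beta> * x < real (min B (nat \<lfloor>\<beta> * x\<rfloor>)) + 1" if "min B (nat \<lfloor>\<beta> * x\<rfloor>) < B"
    using that nn by linarith
qed (use assms in \<open>auto simp: in_J\<close>)

lemma ld_le: "x \<in> J \<Longrightarrow> ld x \<le> B"
  and ld_lower: "x \<in> J \<Longrightarrow> real (ld x) \<le> \<beta> * x"
  and ld_upper: "x \<in> J \<Longrightarrow> ld x < B \<Longrightarrow> \<beta> * x < real (ld x) + 1"
proof -
  assume x: "x \<in> J"
  hence nn: "0 \<le> \<beta> * x" by (simp add: in_J)
  show "ld x \<le> B" using ld_min[OF x] by simp
  show "real (ld x) \<le> \<beta> * x" using nn unfolding ld_min[OF x] by linarith
  show "\<beta> * x < real (ld x) + 1" if "ld x < B" using nn that unfolding ld_min[OF x] by linarith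
qed

lemma T_eq: "T x = \<beta> * x - real (ld x)"
  by (simp add: greedy_map_def)

lemma beta_mult_le_u: "x \<in> J \<Longrightarrow> \<beta> * x \<le> u + real B"
  unfolding beta_u[symmetric] by (simp add: in_J)

lemma T_in_J: assumes "x \<in> J" shows "T x \<in> J"
proof (cases "ld x < B")
  case True
  thus ?thesis using ld_lower[OF assms] ld_upper[OF assms] u_gt_1 by (simp add: in_J T_eq)
next
  case False
  hence "ld x = B" using ld_le[OF assms] by simp
  thus ?thesis using ld_lower[OF assms] beta_mult_le_u[OF assms] by (simp add: in_J T_eq)
qed

lemma t_0: "t 0 = 1" and t_Suc: "t (Suc i) = T (t i)"
  by (simp_all add: t_def)

lemma one_in_J: "1 \<in> J" using u_gt_1 by (simp add: in_J)

lemma t_in_J: "t i \<in> J"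
  by (induction i) (auto simp: t_0 t_Suc one_in_J T_in_J)

text \<open>Digits are counted from 1 and orbit points from 0, hence the shift.\<close>

lemma ld_t: "i < n \<Longrightarrow> ld (t i) = b (Suc i)"
proof -
  assume "i < n"
  hence "greedy_digit \<beta> (Suc i) 1 = b (Suc i)" using expansion
    by (auto simp: finite_greedy_expansion_def)
  thus ?thesis by (simp add: greedy_digit_def t_def)
qed

text \<open>Lets the hypothesis \<open>beta_sq\<close>, stated with the first digit, speak about the
  integer part of \<beta>.\<close>

lemma b_1: "b 1 = B"
proof -
  have "ld 1 = B" using B_less u_gt_1 by (intro ld_eqI) auto
  thus ?thesis using ld_t[of 0] n_ge_2 by (simp add: t_0)
qed

text \<open>The unit interval is invariant: lower branches have images below 1, and on the last
  branch the image of a point of [0, 1] is at most \<beta> - B < 1.\<close>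

lemma t_le_1: "t i \<le> 1"
proof (induction i)
  case (Suc i)
  have "T (t i) \<le> 1"
  proof (cases "ld (t i) < B")
    case True
    thus ?thesis using ld_upper[OF t_in_J True] by (simp add: T_eq)
  next
    case False
    hence "ld (t i) = B" using ld_le[OF t_in_J, of i] by simp
    moreover have "\<beta> * t i \<le> \<beta>" using Suc by simp
    ultimately show ?thesis using less_B unfolding T_eq by linarith
  qed
  thus ?case by (simp add: t_Suc)
qed (simp add: t_0)

lemma t_expansion:
  "k \<le> n \<Longrightarrow> t k = \<beta> ^ k * (1 - (\<Sum>i=1..k. real (b i) / \<beta> ^ i))"
proof (induction k)
  case (Suc k)
  hence "t (Suc k) = \<beta> * (\<beta> ^ k * (1 - (\<Sum>i=1..k. real (b i) / \<beta> ^ i))) - real (b (Suc k))"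
    using ld_t[of k] by (simp add: t_Suc T_eq)
  also have "\<dots> = \<beta> ^ Suc k * (1 - (\<Sum>i=1..Suc k. real (b i) / \<beta> ^ i))"
    by (simp add: right_diff_distrib distrib_left)
  finally show ?case .
qed (simp add: t_0)

text \<open>The remainder after n digits is zero. This finiteness makes the set of cuts closed under
  \<open>T\<close>.\<close>

lemma t_n: "t n = 0"
proof -
  have "(\<Sum>i=1..n. real (b i) / \<beta> ^ i) = 1"
    using expansion by (simp add: finite_greedy_expansion_def)
  thus ?thesis using t_expansion[of n] by simp
qed

lemma t_ge: "i < n \<Longrightarrow> 1 / \<beta> \<le> t i" and ld_t_ge_1: "i < n \<Longrightarrow> 1 \<le> ld (t i)"
proof -
  assume i: "i < n"
  show 1: "1 \<le> ld (t i)" using digits_pos i by (auto simp: ld_t)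
  have "1 \<le> \<beta> * t i" using ld_lower[OF t_in_J, of i] 1 by linarith
  thus "1 / \<beta> \<le> t i" by (simp add: field_simps)
qed

text \<open>Positivity of the second digit gives \<open>t 1\<close> = \<beta> - B at least
  1/\<beta>, which is the weak inequality; \<open>beta_sq\<close> removes the equality.\<close>

lemma beta_sq_gt: "real B * \<beta> + 1 < \<beta>\<^sup>2"
proof -
  have "1 / \<beta> \<le> \<beta> - real B" using t_ge[of 1] n_ge_2 ld_t[of 0] b_1
    by (simp add: t_Suc t_0 T_eq)
  hence "1 \<le> (\<beta> - real B) * \<beta>" by (simp add: divide_le_eq)
  hence "real B * \<beta> + 1 \<le> \<beta>\<^sup>2" by (simp add: power2_eq_square algebra_simps)
  thus ?thesis using beta_sq b_1 by simp
qed

text \<open>This is \<open>beta_sq_gt\<close> after clearing the denominator \<beta> - 1 of u. It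
  places the greedy image [0, u - 1] of a switch region strictly to the left of 1/\<beta>, hence of
  all left cuts.\<close>

lemma u_less: "\<beta> * (u - 1) < 1"
proof -
  have "(\<beta> - 1) * (\<beta> * (u - 1)) = \<beta> * (real B - \<beta> + 1)"
    using beta_u by (simp add: algebra_simps)
  also have "\<dots> < (\<beta> - 1) * 1"
    using beta_sq_gt by (simp add: algebra_simps power2_eq_square)
  finally show ?thesis using beta_gt_1 by (simp only: mult_less_cancel_left_pos)
qed

text \<open>Keeps the two images [0, u - 1] and [1, u] of a switch region disjoint, so that the next
  symbol reveals the coin.\<close>

lemma u_less_2: "u < 2"
proof -
  have "u - 1 \<le> \<beta> * (u - 1)" using u_gt_1 beta_gt_1 by (simp add: mult_le_cancel_right1)
  thus ?thesis using u_less by simp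
qed

lemma t_last: "t (n - 1) = real (b n) / \<beta>" "1 \<le> b n" "b n \<le> B"
proof -
  have n: "Suc (n - 1) = n" using n_ge_2 by simp
  have ld: "ld (t (n - 1)) = b n" using ld_t[of "n - 1"] n by auto
  have "\<beta> * t (n - 1) - real (b n) = 0" using t_Suc[of "n - 1"] n t_n ld by (simp add: T_eq)
  thus "t (n - 1) = real (b n) / \<beta>" by (simp add: eq_divide_eq mult.commute)
  show "1 \<le> b n" using digits_pos n_ge_2 by auto
  show "b n \<le> B" using ld ld_le[OF t_in_J] by metis
qed

text \<open>The image of a switch point is at most u - 1 < 1/\<beta>, so its digit is 0, but the
  next orbit point still has a positive digit. The bound is sharp: \<open>t (n - 1)\<close> is the
  left end of a switch region.\<close>

lemma t_not_sw: assumes "i \<le> n - 2" shows "\<not> sw (t i)"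
proof
  assume "sw (t i)"
  hence "t (Suc i) \<le> u - 1" by (simp add: sw_def t_Suc T_eq)
  hence "\<beta> * t (Suc i) \<le> \<beta> * (u - 1)" by (subst mult_le_cancel_left_pos) auto
  moreover have "Suc i < n" using assms n_ge_2 by linarith
  hence "1 \<le> \<beta> * t (Suc i)" using t_ge[of "Suc i"] by (simp add: field_simps)
  ultimately show False using u_less by linarith
qed

subsection \<open>Reflection\<close>

text \<open>Reflection exchanges the switch regions k and B + 1 - k. There it turns the greedy
  branch into the lazy one, so no conjugacy of \<open>T\<close> with itself is claimed.\<close>

lemma reflect_sw:
  assumes "x \<in> J" "sw x"
  shows "ld (u - x) = B + 1 - ld x" "sw (u - x)"
proof -
  let ?d = "B + 1 - ld x"
  have l: "1 \<le> ld x" "ld x \<le> B" using assms ld_le by (auto simp: sw_def)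
  have d: "real ?d = real B + 1 - real (ld x)" using l by (simp add: of_nat_diff)
  have b: "\<beta> * (u - x) = u + real B - \<beta> * x" by (simp add: right_diff_distrib beta_u)
  show ld: "ld (u - x) = ?d"
  proof (rule ld_eqI)
    show "real ?d \<le> \<beta> * (u - x)" using assms unfolding d b sw_def by linarith
    show "\<beta> * (u - x) < real ?d + 1"
      using ld_lower[OF assms(1)] u_less_2 unfolding d b by linarith
  qed (use l assms in \<open>auto simp: in_J\<close>)
  show "sw (u - x)" unfolding sw_def ld b d
    using l ld_lower[OF assms(1)] by auto
qed

text \<open>On equality regions greedy and lazy digits coincide, so reflection sends digit k to B -
  k and commutes with \<open>T\<close>.\<close>

lemma reflect_not_sw:
  assumes "x \<in> J" "\<not> sw x"
  shows "ld (u - x) = B - ld x" "\<not> sw (u - x)" "T (u - x) = u - T x"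
proof -
  let ?d = "B - ld x"
  have l: "ld x \<le> B" using assms ld_le by auto
  have d: "real ?d = real B - real (ld x)" using l by (simp add: of_nat_diff)
  have b: "\<beta> * (u - x) = u + real B - \<beta> * x" by (simp add: right_diff_distrib beta_u)
  show ld: "ld (u - x) = ?d"
  proof (rule ld_eqI)
    show "real ?d \<le> \<beta> * (u - x)" 
      using ld_upper[OF assms(1)] beta_mult_le_u[OF assms(1)] l u_gt_1 unfolding d b
      by (cases "ld x = B") auto
    show "\<beta> * (u - x) < real ?d + 1" if "?d < B"
    proof -
      have "1 \<le> ld x" using that by linarith
      hence "u + real (ld x) - 1 < \<beta> * x" using assms by (auto simp: sw_def)
      thus ?thesis unfolding d b by linarith
    qed
  qed (use l assms in \<open>auto simp: in_J\<close>)
  show "T (u - x) = u - T x" unfolding T_eq ld b d by simp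
  show "\<not> sw (u - x)"
  proof
    assume s: "sw (u - x)"
    hence "ld x < B" using ld l by (auto simp: sw_def)
    thus False using s ld_upper[OF assms(1)] unfolding sw_def ld b d by linarith
  qed
qed

lemma reflect_sw_iff: "x \<in> J \<Longrightarrow> sw (u - x) \<longleftrightarrow> sw x"
  using reflect_sw reflect_not_sw by blast

text \<open>Identifies the second family of cut points in \<open>same_piece\<close> with the
  reflected orbit of 1. Each step needs the current orbit point outside the switch regions, which
  holds up to n - 2.\<close>

lemma orbit_reflect: "i \<le> n - 1 \<Longrightarrow> (T ^^ i) (u - 1) = u - t i"
proof (induction i)
  case (Suc i)
  hence "T (u - t i) = u - T (t i)" using t_not_sw by (intro reflect_not_sw t_in_J) auto
  thus ?case using Suc by (simp add: t_Suc)
qed (simp add: t_0)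

subsection \<open>Cut points\<close>

text \<open>Left end points of pieces.  By the symmetry \<open>x \<mapsto> u - x\<close> the right end points are the reflected
  cuts \<open>u - a\<close>, so that the partition is determined by this single set.\<close>
definition cuts :: "real set" where
  "cuts = t ` {0..n-2} \<union> (\<lambda>k. real k / \<beta>) ` {1..B}"

text \<open>The relation \<open>same_piece\<close> with regions and orbits replaced by the set
  \<open>cuts\<close>: the second comparison, with u - x, handles the right ends u - a. On J the two
  agree by \<open>same_piece_eq\<close>.\<close>

definition eqv :: "real \<Rightarrow> real \<Rightarrow> bool" where
  "eqv x y \<longleftrightarrow> (\<forall>a\<in>cuts. (a \<le> x \<longleftrightarrow> a \<le> y) \<and> (a \<le> u - x \<longleftrightarrow> a \<le> u - y))"

lemma eqv_refl: "eqv x x" and eqv_sym: "eqv x y \<Longrightarrow> eqv y x"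
  and eqv_trans: "eqv x y \<Longrightarrow> eqv y z \<Longrightarrow> eqv x z"
  by (auto simp: eqv_def)

lemma eqv_reflect: "eqv x y \<Longrightarrow> eqv (u - x) (u - y)"
  by (auto simp: eqv_def)

lemma eqv_convex: "eqv x y \<Longrightarrow> eqv x z \<Longrightarrow> y \<le> w \<Longrightarrow> w \<le> z \<Longrightarrow> eqv x w"
  unfolding eqv_def by (smt (verit))

lemma finite_cuts: "finite cuts" by (simp add: cuts_def)

text \<open>An orbit cut is moved by \<open>T\<close> to another cut, whereas k/\<beta> is a branch
  boundary with image 0. The orbit closes up because the image of its last cut
  \<open>t (n - 2)\<close> is b_n/\<beta>, a cut of the second kind.\<close>

lemma cut_cases:
  assumes "a \<in> cuts"
  obtains "a \<in> J" "\<not> sw a" "1 \<le> ld a" "T a \<in> cuts"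
    | k where "a = real k / \<beta>" "1 \<le> k" "k \<le> B"
proof -
  consider i where "i \<le> n - 2" "a = t i" | k where "a = real k / \<beta>" "1 \<le> k" "k \<le> B"
    using assms by (auto simp: cuts_def)
  thus ?thesis
  proof cases
    case (1 i)
    have "T a \<in> cuts"
    proof (cases "i = n - 2")
      case True
      hence "Suc i = n - 1" using n_ge_2 by simp
      hence "T a = real (b n) / \<beta>" using t_last 1 t_Suc[of i] by simp
      thus ?thesis using t_last by (auto simp: cuts_def)
    next
      case False
      hence "Suc i \<in> {0..n-2}" "T a = t (Suc i)" using 1 t_Suc[of i] by auto
      thus ?thesis unfolding cuts_def by blast
    qed
    thus ?thesis using that(1) 1 t_in_J t_not_sw ld_t_ge_1[of i] n_ge_2 by auto
  qed (use that(2) in auto)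
qed

lemma one_in_cuts: "1 \<in> cuts"
  unfolding cuts_def by (rule UnI1, rule image_eqI[of _ _ 0]) (auto simp: t_0)

lemma cut_bounds:
  assumes "a \<in> cuts"
  shows "1 / \<beta> \<le> a" "a \<le> 1"
proof -
  consider i where "i \<le> n - 2" "a = t i" | k where "a = real k / \<beta>" "1 \<le> k" "k \<le> B"
    using assms by (auto simp: cuts_def)
  hence "1 / \<beta> \<le> a \<and> a \<le> 1"
  proof cases
    case (1 i)
    thus ?thesis using t_ge[of i] t_le_1[of i] n_ge_2 by auto
  next
    case (2 k)
    hence "\<beta> * a = real k" by simp
    hence "\<beta> * (1 / \<beta>) \<le> \<beta> * a" "\<beta> * a \<le> \<beta> * 1" using 2 B_less by auto
    thus ?thesis by (simp only: mult_le_cancel_left_pos beta_pos)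
  qed
  thus "1 / \<beta> \<le> a" "a \<le> 1" by auto
qed

lemma le_iff_ld:
  assumes "x \<in> J" "k \<le> B" shows "real k / \<beta> \<le> x \<longleftrightarrow> k \<le> ld x"
proof -
  have "real k / \<beta> \<le> x \<longleftrightarrow> real k \<le> \<beta> * x" by (simp add: field_simps)
  also have "\<dots> \<longleftrightarrow> k \<le> ld x"
  proof
    assume "real k \<le> \<beta> * x"
    thus "k \<le> ld x" using ld_upper[OF assms(1)] assms(2)
      by (cases "ld x < B") auto
  next
    assume "k \<le> ld x"
    thus "real k \<le> \<beta> * x" using ld_lower[OF assms(1)] by linarith
  qed
  finally show ?thesis .
qed

text \<open>The reflected cut u - k/\<beta> is the right end of the switch region with index B + 1 -
  k, which is why \<open>sw\<close> decides the borderline digit.\<close>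

lemma le_reflect_iff_ld:
  assumes "x \<in> J" "1 \<le> k" "k \<le> B"
  shows "real k / \<beta> \<le> u - x \<longleftrightarrow> ld x + k < B + 1 \<or> (ld x + k = B + 1 \<and> sw x)"
proof -
  have "real k / \<beta> \<le> u - x \<longleftrightarrow> k \<le> ld (u - x)"
    using assms by (intro le_iff_ld reflect_J) auto
  also have "\<dots> \<longleftrightarrow> ld x + k < B + 1 \<or> (ld x + k = B + 1 \<and> sw x)"
    using reflect_sw[OF assms(1)] reflect_not_sw[OF assms(1)] ld_le[OF assms(1)] assms(2)
    by (cases "sw x") auto
  finally show ?thesis .
qed

lemma eqv_imp_ld:
  assumes "x \<in> J" "y \<in> J" "eqv x y"
  shows "ld x = ld y" "sw x = sw y"
proof -
  have *: "k \<le> ld x \<longleftrightarrow> k \<le> ld y" if "1 \<le> k" "k \<le> B" for k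
  proof -
    have "real k / \<beta> \<in> cuts" using that by (auto simp: cuts_def)
    thus ?thesis using assms le_iff_ld that unfolding eqv_def by blast
  qed
  show ld: "ld x = ld y"
    using *[of "ld x"] *[of "ld y"] ld_le[OF assms(1)] ld_le[OF assms(2)] by linarith
  show "sw x = sw y"
  proof (cases "ld x = 0")
    case True thus ?thesis using ld by (simp add: sw_def)
  next
    case False
    \<comment> \<open>Chosen so that u - k/\<beta> is the right end of the switch region with index
      \<open>ld x\<close>, the border between \<open>sw\<close> and its negation for this
      digit.\<close>
    define k where "k = B + 1 - ld x"
    have k: "1 \<le> k" "k \<le> B" using False ld_le[OF assms(1)] by (auto simp: k_def)
    have "real k / \<beta> \<in> cuts" using k by (auto simp: cuts_def)
    hence "real k / \<beta> \<le> u - x \<longleftrightarrow> real k / \<beta> \<le> u - y" using assms unfolding eqv_def by blast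
    thus ?thesis using le_reflect_iff_ld[OF assms(1) k] le_reflect_iff_ld[OF assms(2) k] ld
        ld_le[OF assms(1)] by (auto simp: k_def)
  qed
qed

text \<open>Equality region k lies to the right of switch region k, so an orbit cut is on one side
  of a whole switch region and the digits tell which.\<close>

lemma sw_mult_less:
  assumes "a \<in> J" "\<not> sw a" "1 \<le> ld a" "x \<in> J" "sw x"
  shows "a \<le> x \<longleftrightarrow> ld a < ld x"
proof -
  have lx: "1 \<le> ld x" "\<beta> * x \<le> u + real (ld x) - 1" "ld x \<le> B" "real (ld x) \<le> \<beta> * x"
    using assms ld_lower ld_le by (auto simp: sw_def)
  have la: "u + real (ld a) - 1 < \<beta> * a" "real (ld a) \<le> \<beta> * a"
    using assms ld_lower by (auto simp: sw_def)
  have "a \<le> x \<longleftrightarrow> \<beta> * a \<le> \<beta> * x" by simp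
  also have "\<dots> \<longleftrightarrow> ld a < ld x"
  proof
    assume le: "\<beta> * a \<le> \<beta> * x"
    show "ld a < ld x"
    proof (rule ccontr)
      assume "\<not> ld a < ld x"
      hence "real (ld x) \<le> real (ld a)" by simp
      thus False using la lx le by linarith
    qed
  next
    assume l: "ld a < ld x"
    hence "\<beta> * a < real (ld a) + 1" using ld_upper[OF assms(1)] lx by auto
    also have "\<dots> \<le> real (ld x)" using l by linarith
    finally show "\<beta> * a \<le> \<beta> * x" using lx by linarith
  qed
  finally show ?thesis .
qed

text \<open>No cut falls inside a switch region, so each of them remains a single piece.\<close>

lemma eqv_sw_iff:
  assumes "x \<in> J" "y \<in> J" "sw x"
  shows "eqv x y \<longleftrightarrow> sw y \<and> ld x = ld y"
proof
  assume "eqv x y"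
  thus "sw y \<and> ld x = ld y" using eqv_imp_ld assms by auto
next
  assume y: "sw y \<and> ld x = ld y"
  show "eqv x y" unfolding eqv_def
  proof
    fix a assume "a \<in> cuts"
    thus "(a \<le> x) = (a \<le> y) \<and> (a \<le> u - x) = (a \<le> u - y)"
    proof (cases rule: cut_cases)
      case 1
      thus ?thesis using y assms reflect_sw[OF assms(1)] reflect_sw[OF assms(2)] reflect_J
        by (simp add: sw_mult_less)
    next
      case (2 k)
      thus ?thesis using y assms by (simp add: le_iff_ld le_reflect_iff_ld)
    qed
  qed
qed

text \<open>All left cuts lie in [1/\<beta>, 1]. So none is below u - 1 < 1/\<beta>, and u - 1 is
  the smallest right cut because 1 is the largest left cut.\<close>

lemma eqv_0_iff: assumes "x \<in> J" shows "eqv 0 x \<longleftrightarrow> x \<le> u - 1"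
proof
  assume "eqv 0 x"
  thus "x \<le> u - 1" using one_in_cuts u_gt_1 by (auto simp: eqv_def)
next
  assume x: "x \<le> u - 1"
  show "eqv 0 x" unfolding eqv_def
  proof
    fix a assume "a \<in> cuts"
    note a = cut_bounds[OF this]
    have "0 < 1 / \<beta>" by simp
    moreover have "u - 1 < 1 / \<beta>" using u_less by (simp add: field_simps)
    ultimately show "(a \<le> 0) = (a \<le> x) \<and> (a \<le> u - 0) = (a \<le> u - x)" using a x u_gt_1 by auto
  qed
qed

lemma eqv_u_iff: assumes "x \<in> J" shows "eqv u x \<longleftrightarrow> 1 \<le> x"
proof -
  have "eqv u x \<longleftrightarrow> eqv 0 (u - x)" using eqv_reflect[of u x] eqv_reflect[of 0 "u - x"] by auto
  thus ?thesis using eqv_0_iff[OF reflect_J[OF assms]] by simp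
qed

lemma switch_left_end:
  assumes "1 \<le> k" "k \<le> B"
  shows "sw (real k / \<beta>)" "real k / \<beta> \<in> J" "ld (real k / \<beta>) = k"
proof -
  have *: "real k / \<beta> < 1" using assms B_less by (simp add: field_simps)
  have le: "real k / \<beta> \<le> u" using u_gt_1 * by linarith
  have "0 \<le> real k / \<beta>" by simp
  with le show J: "real k / \<beta> \<in> J" unfolding in_J by blast
  show ld: "ld (real k / \<beta>) = k" using assms * le by (intro ld_eqI) auto
  show "sw (real k / \<beta>)" using assms u_gt_1 ld by (simp add: sw_def)
qed

text \<open>No left cut is also a right cut, so no piece degenerates to a point.\<close>
lemma cuts_sum_ne:
  assumes "a \<in> cuts" "a' \<in> cuts" shows "a + a' \<noteq> u"
proof -
  have mixed: "a + real k / \<beta> \<noteq> u" if "a \<in> J" "\<not> sw a" "1 \<le> k" "k \<le> B" for a k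
  proof
    assume "a + real k / \<beta> = u"
    hence "a = u - real k / \<beta>" by simp
    thus False using reflect_sw_iff[OF switch_left_end(2)[OF that(3,4)]] switch_left_end(1)[OF that(3,4)] that(2) by simp
  qed
  \<comment> \<open>Equality would make u the integer k + k' - B, strictly between 1 and 2.\<close>
  have kk: "real k / \<beta> + real k' / \<beta> \<noteq> u" for k k'
  proof
    assume "real k / \<beta> + real k' / \<beta> = u"
    hence "real k + real k' = \<beta> * u" by (simp add: field_simps)
    hence "real_of_int (int k + int k' - int B) = u" by (simp add: beta_u)
    hence "1 < int k + int k' - int B" "int k + int k' - int B < 2"
      using u_gt_1 u_less_2 by (metis of_int_1_less_iff, metis of_int_less_numeral_iff)
    thus False by linarith
  qed
  \<comment> \<open>The relation survives \<open>T\<close> by the reflection symmetry, so it can be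
    pushed forward until the larger index is n - 1. There \<open>t i\<close> = b_n/\<beta>, and the
    previous two cases apply.\<close>
  have tt: "t i + t j \<noteq> u" if "d = n - 1 - i" "j \<le> i" "i \<le> n - 1" for d i j
    using that
  proof (induction d arbitrary: i j)
    case 0
    hence i: "i = n - 1" by simp
    show ?case
    proof (cases "j \<le> n - 2")
      case True
      thus ?thesis using mixed[OF t_in_J t_not_sw, of j "b n"] t_last i by (simp add: add.commute)
    next
      case False
      hence "j = n - 1" using 0 by simp
      thus ?thesis using kk[of "b n" "b n"] i t_last(1) by metis
    qed
  next
    case (Suc d)
    hence i: "i \<le> n - 2" "j \<le> n - 2" by auto
    show ?case
    proof
      assume "t i + t j = u"
      hence "t j = u - t i" by simp
      hence "T (t j) = u - T (t i)" using reflect_not_sw(3)[OF t_in_J t_not_sw[OF i(1)]] by simp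
      hence "t (Suc i) + t (Suc j) = u" by (simp add: t_Suc)
      thus False using Suc.IH[of "Suc i" "Suc j"] Suc.prems by auto
    qed
  qed
  have tt': "t i + t j \<noteq> u" if "i \<le> n - 2" "j \<le> n - 2" for i j
    using tt[of _ i j] tt[of _ j i] that by (cases "j \<le> i") (auto simp: add.commute)
  consider (tt) i j where "a = t i" "a' = t j" "i \<le> n - 2" "j \<le> n - 2"
    | (tk) i k where "a = t i" "a' = real k / \<beta>" "i \<le> n - 2" "1 \<le> k" "k \<le> B"
    | (kt) i k where "a' = t i" "a = real k / \<beta>" "i \<le> n - 2" "1 \<le> k" "k \<le> B"
    | (kk) k k' where "a = real k / \<beta>" "a' = real k' / \<beta>"
    using assms unfolding cuts_def by fastforce
  thus ?thesis
  proof cases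
    case tt thus ?thesis using tt' by auto
  next
    case tk thus ?thesis using mixed[OF t_in_J t_not_sw] by auto
  next
    case kt thus ?thesis using mixed[OF t_in_J t_not_sw] by (auto simp: add.commute)
  next
    case kk thus ?thesis using \<open>\<And>k k'. real k / \<beta> + real k' / \<beta> \<noteq> u\<close> by auto
  qed
qed

text \<open>Gives the pieces positive length. \<open>Lo\<close> collects the end points that bound
  the piece of x from the left, \<open>Hi\<close> those from the right.\<close>

lemma eqv_contains_interval:
  assumes x: "x \<in> J"
  shows "\<exists>l h. l < h \<and> {l<..<h} \<subseteq> {y\<in>J. eqv x y}"
proof -
  define Lo where "Lo = {0} \<union> {a\<in>cuts. a \<le> x} \<union> (\<lambda>a. u - a) ` {a\<in>cuts. \<not> a \<le> u - x}"
  define Hi where "Hi = {u} \<union> {a\<in>cuts. \<not> a \<le> x} \<union> (\<lambda>a. u - a) ` {a\<in>cuts. a \<le> u - x}"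
  have fin: "finite Lo" "finite Hi" and ne: "Lo \<noteq> {}" "Hi \<noteq> {}"
    using finite_cuts by (auto simp: Lo_def Hi_def)
  have cb: "0 < a" "a < u" if "a \<in> cuts" for a
  proof -
    have "0 < 1 / \<beta>" by simp
    thus "0 < a" "a < u" using cut_bounds[OF that] u_gt_1 by linarith+
  qed
  have less: "l < h" if "l \<in> Lo" "h \<in> Hi" for l h
  proof -
    \<comment> \<open>The critical pair: x may equal both a closed left end and a closed right end
      unless these differ.\<close>
    have "a < u - a'" if "a \<in> cuts" "a' \<in> cuts" "a \<le> x" "a' \<le> u - x" for a a'
      using cuts_sum_ne[OF that(1,2)] that(3,4) by linarith
    thus ?thesis using that x u_gt_1 unfolding Lo_def Hi_def in_J
      by (auto dest: cb simp: not_le)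
  qed
  have "{Max Lo<..<Min Hi} \<subseteq> {y\<in>J. eqv x y}"
  proof
    fix y assume "y \<in> {Max Lo<..<Min Hi}"
    hence lo: "\<And>l. l \<in> Lo \<Longrightarrow> l < y" and hi: "\<And>h. h \<in> Hi \<Longrightarrow> y < h"
      using fin ne by auto
    have "y \<in> J" using lo[of 0] hi[of u] by (auto simp: in_J Lo_def Hi_def)
    moreover have "eqv x y" unfolding eqv_def
    proof
      fix a assume a: "a \<in> cuts"
      have "a \<le> y" if "a \<le> x" using lo[of a] a that by (auto simp: Lo_def)
      moreover have "\<not> a \<le> y" if "\<not> a \<le> x" using hi[of a] a that by (auto simp: Hi_def)
      moreover have "a \<le> u - y" if "a \<le> u - x" using hi[of "u - a"] a that by (auto simp: Hi_def)
      moreover have "\<not> a \<le> u - y" if "\<not> a \<le> u - x" using lo[of "u - a"] a that by (auto simp: Lo_def)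
      ultimately show "(a \<le> x) = (a \<le> y) \<and> (a \<le> u - x) = (a \<le> u - y)" by auto
    qed
    ultimately show "y \<in> {y\<in>J. eqv x y}" by simp
  qed
  moreover have "Max Lo < Min Hi" using less Max_in[OF fin(1) ne(1)] Min_in[OF fin(2) ne(2)] by auto
  ultimately show ?thesis by blast
qed

subsection \<open>The Markov property of the partition\<close>

text \<open>The preimage of y in the branch of x lies on the same side of each left cut as x. For a
  cut in that branch apply \<open>T\<close>, since its image is a cut or 0; for a cut in another
  branch the digits decide.\<close>

lemma T_inverse_le_iff:
  assumes "x \<in> J" "\<not> sw x" "y \<in> J" "eqv (T x) y" "a \<in> cuts"
  shows "a \<le> x \<longleftrightarrow> a \<le> (y + real (ld x)) / \<beta>"
proof -
  let ?k = "ld x"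
  let ?x' = "(y + real ?k) / \<beta>"
  have bx': "\<beta> * ?x' = y + real ?k" by simp
  have bx: "\<beta> * x = T x + real ?k" by (simp add: T_eq)
  have y0: "0 \<le> y" using assms by (simp add: in_J)
  \<comment> \<open>As 1 is a cut, y stays below it together with \<open>T x\<close>; so the
    preimage does not leave a short branch.\<close>
  have y1: "y < 1" if "?k < B"
  proof -
    have "T x < 1" using ld_upper[OF assms(1) that] by (simp add: T_eq)
    hence "\<not> 1 \<le> T x" by simp
    thus ?thesis using assms(4) one_in_cuts unfolding eqv_def by auto
  qed
  have kB: "?k \<le> B" using ld_le[OF assms(1)] .
  have Tx: "0 \<le> T x" "?k < B \<Longrightarrow> T x < 1" 
    using T_in_J[OF assms(1)] ld_upper[OF assms(1)] by (auto simp: in_J T_eq)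
  have mul: "a \<le> z \<longleftrightarrow> \<beta> * a \<le> \<beta> * z" for z by simp
  show ?thesis using assms(5)
  proof (cases rule: cut_cases)
    case 1
    have ba: "\<beta> * a = T a + real (ld a)" by (simp add: T_eq)
    have la: "ld a \<le> B" "0 \<le> T a" "ld a < B \<Longrightarrow> T a < 1" 
      using ld_le[OF 1(1)] T_in_J[OF 1(1)] ld_upper[OF 1(1)] by (auto simp: in_J T_eq)
    show ?thesis
    proof (rule linorder_cases[of "ld a" ?k])
      assume "ld a = ?k"
      thus ?thesis unfolding mul bx bx' ba using 1(4) assms(4) by (auto simp: eqv_def)
    next
      assume "ld a < ?k"
      hence "real (ld a) + 1 \<le> real ?k" "T a < 1" using kB la by linarith+
      thus ?thesis unfolding mul bx bx' ba using Tx y0 by linarith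
    next
      assume "?k < ld a"
      hence "real ?k + 1 \<le> real (ld a)" "?k < B" using la by linarith+
      thus ?thesis unfolding mul bx bx' ba using Tx y1 la by linarith
    qed
  next
    case (2 j)
    hence ba: "\<beta> * a = real j" by simp
    show ?thesis
    proof (cases "j \<le> ?k")
      case True
      hence "real j \<le> real ?k" by simp
      thus ?thesis unfolding mul bx bx' ba using Tx y0 by linarith
    next
      case False
      hence "real ?k + 1 \<le> real j" "?k < B" using 2 by linarith+
      thus ?thesis unfolding mul bx bx' ba using Tx y1 by linarith
    qed
  qed
qed

text \<open>The Markov property: the image of a piece in an equality region contains every piece
  that it meets. Right ends follow by applying the preceding lemma to the reflected points.\<close>

lemma T_inverse:
  assumes "x \<in> J" "\<not> sw x" "y \<in> J" "eqv (T x) y"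
  defines "x' \<equiv> (y + real (ld x)) / \<beta>"
  shows "x' \<in> J" "eqv x x'" "T x' = y"
proof -
  have kB: "ld x \<le> B" using ld_le[OF assms(1)] .
  have "y + real (ld x) \<le> \<beta> * u" using kB assms(3) by (simp add: beta_u in_J)
  thus J: "x' \<in> J" using assms(3) by (simp add: in_J x'_def field_simps)
  have r: "(u - y + real (ld (u - x))) / \<beta> = u - x'"
  proof -
    have *: "u - y + real (ld (u - x)) = \<beta> * u - (y + real (ld x))"
      using kB by (simp add: reflect_not_sw[OF assms(1,2)] beta_u of_nat_diff)
    show ?thesis unfolding * by (simp add: x'_def diff_divide_distrib)
  qed
  have "eqv (T (u - x)) (u - y)" using eqv_reflect[OF assms(4)] reflect_not_sw[OF assms(1,2)] by simp
  hence "a \<le> u - x \<longleftrightarrow> a \<le> u - x'" if "a \<in> cuts" for a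
    using T_inverse_le_iff[of "u - x" "u - y" a] reflect_J[OF assms(1)] reflect_J[OF assms(3)]
      reflect_not_sw[OF assms(1,2)] that r by simp
  thus E: "eqv x x'" using T_inverse_le_iff[OF assms(1-4)] by (auto simp: eqv_def x'_def)
  show "T x' = y" using eqv_imp_ld(1)[OF assms(1) J E] by (simp add: T_eq x'_def)
qed

text \<open>Expansion by \<open>\<beta>\<close>: an interval avoiding the switch regions stays inside one branch of \<open>T\<close>,
  so its images would grow without bound.\<close>
lemma no_invariant_interval:
  assumes V: "V \<subseteq> J" "\<And>x. x \<in> V \<Longrightarrow> \<not> sw x" "\<And>x. x \<in> V \<Longrightarrow> T x \<in> V"
    and xy: "x < y" "{x..y} \<subseteq> V"
  shows False
proof -
  have step: "T y - T x = \<beta> * (y - x) \<and> {T x..T y} \<subseteq> V" if xy: "x < y" "{x..y} \<subseteq> V" for x y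
  proof -
    have ld: "ld z = ld x" if z: "z \<in> {x..y}" for z
    proof (rule ccontr)
      assume ne: "ld z \<noteq> ld x"
      have "z \<in> V" "x \<in> V" using z xy by auto
      hence zJ: "z \<in> J" "x \<in> J" using V(1) by blast+
      have "ld x \<le> ld z"
        using le_iff_ld[OF zJ(1) ld_le[OF zJ(2)]] le_iff_ld[OF zJ(2) ld_le[OF zJ(2)]] z by auto
      hence lt: "ld x < ld z" using ne by simp
      \<comment> \<open>A change of digit would make the interval cross a branch boundary, which is
        the left end of a switch region.\<close>
      define w where "w = real (ld z) / \<beta>"
      have "w \<le> z" using ld_lower[OF zJ(1)] by (simp add: w_def field_simps)
      moreover have "x \<le> w"
      proof -
        have "\<beta> * x < real (ld x) + 1" using ld_upper[OF zJ(2)] lt ld_le[OF zJ(1)] by simp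
        thus ?thesis using lt by (simp add: w_def field_simps)
      qed
      ultimately have wV: "w \<in> V" using xy z by auto
      hence wJ: "w \<in> J" using V by blast
      have "ld w = ld z" by (rule ld_eqI) (use ld_le[OF zJ(1)] wJ in \<open>auto simp: w_def in_J\<close>)
      hence "sw w" using lt u_gt_1 by (simp add: sw_def w_def)
      thus False using V(2)[OF wV] by simp
    qed
    have "{T x..T y} \<subseteq> V"
    proof
      fix z assume z: "z \<in> {T x..T y}"
      define w where "w = (z + real (ld x)) / \<beta>"
      have bw: "\<beta> * w = z + real (ld x)" by (simp add: w_def)
      have "\<beta> * x \<le> \<beta> * w" "\<beta> * w \<le> \<beta> * y" using z ld[of y] xy unfolding bw by (auto simp: T_eq)
      hence w: "w \<in> {x..y}" by simp
      hence "T w = z" using ld[OF w] bw by (simp add: T_eq)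
      thus "z \<in> V" using V(3)[of w] w xy by auto
    qed
    moreover have "T y - T x = \<beta> * (y - x)" using ld[of y] xy by (simp add: T_eq right_diff_distrib)
    ultimately show ?thesis by simp
  qed
  have "\<exists>x' y'. y' - x' = \<beta> ^ m * (y - x) \<and> {x'..y'} \<subseteq> V" for m
  proof (induction m)
    case 0 thus ?case using xy by auto
  next
    case (Suc m)
    then obtain x' y' where *: "y' - x' = \<beta> ^ m * (y - x)" "{x'..y'} \<subseteq> V" by auto
    have "0 < \<beta> ^ m * (y - x)" using xy by simp
    hence "x' < y'" using * by linarith
    from step[OF this *(2)] show ?case using * by (intro exI[of _ "T x'"] exI[of _ "T y'"]) simp
  qed
  note ex = this
  obtain m where m: "u / (y - x) < \<beta> ^ m" using real_arch_pow[OF beta_gt_1] by blast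
  from ex[of m] obtain x' y' where *: "y' - x' = \<beta> ^ m * (y - x)" "{x'..y'} \<subseteq> V" by blast
  have gt: "u < y' - x'" using m xy unfolding * by (simp add: field_simps)
  hence "x' \<in> V" "y' \<in> V" using * u_gt_1 by auto
  hence "x' \<in> J" "y' \<in> J" using V by blast+
  thus False using gt by (auto simp: in_J)
qed

subsection \<open>The pieces and their indices\<close>

definition cls :: "real \<Rightarrow> real set" where "cls x = {y\<in>J. eqv x y}"

text \<open>The position of the piece containing x, inverse to \<open>piece\<close>. Working with a
  function on points avoids the definite description in \<open>piece\<close>.\<close>

definition idx :: "real \<Rightarrow> nat" where
  "idx x = card {D \<in> pieces \<beta> n. \<forall>y\<in>D. \<forall>z\<in>cls x. y < z}"

abbreviation "L \<equiv> last_index \<beta> n"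

lemma in_equality_region:
  assumes "k \<le> B"
  shows "x \<in> equality_region \<beta> k \<longleftrightarrow> x \<in> J \<and> \<not> sw x \<and> ld x = k"
proof -
  have Bb: "real B / (\<beta> * (\<beta> - 1)) = u / \<beta>" by (simp add: top_pt_def)
  have *: "x \<in> equality_region \<beta> k \<longleftrightarrow>
      x \<in> J \<and> (0 < k \<longrightarrow> u + real k - 1 < \<beta> * x) \<and> (k < B \<longrightarrow> \<beta> * x < real k + 1)"
  proof -
    have lin: "u / \<beta> + (r - 1) / \<beta> < x \<longleftrightarrow> u + r - 1 < \<beta> * x" for r
      by (simp add: field_simps)
    have "x \<le> u" if "\<beta> * x < real k + 1" "k < B"
    proof -
      have "real k + 1 \<le> real B" using that by linarith
      hence "\<beta> * x \<le> \<beta> * 1" using that B_less by linarith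
      hence "x \<le> 1" by (simp only: mult_le_cancel_left_pos beta_pos)
      thus ?thesis using u_gt_1 by simp
    qed
    moreover have "0 \<le> x" if "u + real k - 1 < \<beta> * x"
    proof -
      have "\<beta> * 0 \<le> \<beta> * x" using that u_gt_1 by linarith
      thus ?thesis by (simp only: mult_le_cancel_left_pos beta_pos)
    qed
    moreover have "x < (real k + 1) / \<beta> \<longleftrightarrow> \<beta> * x < real k + 1" by (simp add: field_simps)
    ultimately show ?thesis
      using assms B_ge_1 unfolding equality_region_def Bb in_J by (auto simp: lin)
  qed
  show ?thesis
  proof
    assume "x \<in> equality_region \<beta> k"
    hence x: "x \<in> J" "0 < k \<Longrightarrow> u + real k - 1 < \<beta> * x" "k < B \<Longrightarrow> \<beta> * x < real k + 1"
      using * by auto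
    have "ld x = k"
    proof (rule ld_eqI)
      show "real k \<le> \<beta> * x" using x u_gt_1 by (cases "k = 0") (auto simp: in_J)
    qed (use x assms in \<open>auto simp: in_J\<close>)
    thus "x \<in> J \<and> \<not> sw x \<and> ld x = k" using x by (auto simp: sw_def)
  next
    assume x: "x \<in> J \<and> \<not> sw x \<and> ld x = k"
    thus "x \<in> equality_region \<beta> k" unfolding * using ld_upper[of x] by (auto simp: sw_def)
  qed
qed

lemma in_switch_region:
  assumes "1 \<le> k" "k \<le> B"
  shows "x \<in> switch_region \<beta> k \<longleftrightarrow> x \<in> J \<and> sw x \<and> ld x = k"
proof -
  have Bb: "real B / (\<beta> * (\<beta> - 1)) = u / \<beta>" by (simp add: top_pt_def)
  have *: "x \<in> switch_region \<beta> k \<longleftrightarrow> real k \<le> \<beta> * x \<and> \<beta> * x \<le> u + real k - 1"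
    unfolding switch_region_def Bb by (auto simp: field_simps)
  show ?thesis
  proof
    assume "x \<in> switch_region \<beta> k"
    hence x: "real k \<le> \<beta> * x" "\<beta> * x \<le> u + real k - 1" using * by auto
    have "\<beta> * 0 \<le> \<beta> * x" "\<beta> * x \<le> \<beta> * u" using x assms by (auto simp: beta_u)
    hence J: "x \<in> J" unfolding in_J by (simp only: mult_le_cancel_left_pos beta_pos)
    hence "ld x = k" using x assms u_less_2 by (intro ld_eqI) (auto simp: in_J)
    thus "x \<in> J \<and> sw x \<and> ld x = k" using x J assms by (auto simp: sw_def)
  next
    assume "x \<in> J \<and> sw x \<and> ld x = k"
    thus "x \<in> switch_region \<beta> k" unfolding * using ld_lower[of x] by (auto simp: sw_def)
  qed
qed

lemma same_regions_iff:
  assumes "x \<in> J" "y \<in> J"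
  shows "(\<forall>R\<in>regions \<beta>. x \<in> R \<longleftrightarrow> y \<in> R) \<longleftrightarrow> ld x = ld y \<and> sw x = sw y"
proof
  assume R: "\<forall>R\<in>regions \<beta>. x \<in> R \<longleftrightarrow> y \<in> R"
  have lx: "ld x \<le> B" using ld_le assms by auto
  show "ld x = ld y \<and> sw x = sw y"
  proof (cases "sw x")
    case True
    hence 1: "1 \<le> ld x" by (simp add: sw_def)
    hence "switch_region \<beta> (ld x) \<in> regions \<beta>" using lx by (auto simp: regions_def)
    hence "y \<in> switch_region \<beta> (ld x)" using R in_switch_region[OF 1 lx] assms True by blast
    thus ?thesis using in_switch_region[OF 1 lx] True by auto
  next
    case False
    have "equality_region \<beta> (ld x) \<in> regions \<beta>" using lx by (auto simp: regions_def)
    hence "y \<in> equality_region \<beta> (ld x)" using R in_equality_region[OF lx] assms False by blast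
    thus ?thesis using in_equality_region[OF lx] False by auto
  qed
next
  assume "ld x = ld y \<and> sw x = sw y"
  thus "\<forall>R\<in>regions \<beta>. x \<in> R \<longleftrightarrow> y \<in> R"
    using assms by (auto simp: regions_def in_equality_region in_switch_region)
qed

text \<open>Region membership amounts to the digit and \<open>sw\<close>, that is, to comparisons
  with k/\<beta> and its reflection; the orbit of u - 1 is the reflected orbit of 1.\<close>

lemma same_piece_eq: "same_piece \<beta> n = {(x, y). x \<in> J \<and> y \<in> J \<and> eqv x y}"
proof -
  have "((\<forall>R\<in>regions \<beta>. x \<in> R \<longleftrightarrow> y \<in> R) \<and>
     (\<forall>i\<in>{0..n-2}. (T ^^ i) 1 \<le> x \<longleftrightarrow> (T ^^ i) 1 \<le> y) \<and>
     (\<forall>i\<in>{0..n-2}. x \<le> (T ^^ i) (u - 1) \<longleftrightarrow> y \<le> (T ^^ i) (u - 1))) \<longleftrightarrow> eqv x y" (is "?l \<longleftrightarrow> _")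
    if J: "x \<in> J" "y \<in> J" for x y
  proof -
    have 1: "(T ^^ i) 1 = t i" for i by (simp add: t_def)
    have 2: "z \<le> (T ^^ i) (u - 1) \<longleftrightarrow> t i \<le> u - z" if "i \<in> {0..n-2}" for i z
      using orbit_reflect[of i] that n_ge_2 by auto
    have l: "?l \<longleftrightarrow> (ld x = ld y \<and> sw x = sw y) \<and>
      (\<forall>i\<in>{0..n-2}. (t i \<le> x \<longleftrightarrow> t i \<le> y) \<and> (t i \<le> u - x \<longleftrightarrow> t i \<le> u - y))"
      unfolding same_regions_iff[OF J] by (simp add: 1 2 ball_conj_distrib)
    show ?thesis
    proof
      assume "eqv x y"
      thus ?l unfolding l using eqv_imp_ld[OF J] by (auto simp: eqv_def cuts_def)
    next
      assume ?l
      hence a: "ld x = ld y" "sw x = sw y"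
          "\<forall>i\<in>{0..n-2}. (t i \<le> x \<longleftrightarrow> t i \<le> y) \<and> (t i \<le> u - x \<longleftrightarrow> t i \<le> u - y)"
        unfolding l by blast+
      show "eqv x y" unfolding eqv_def cuts_def ball_Un
      proof (intro conjI ballI)
        fix c assume "c \<in> t ` {0..n-2}"
        thus "(c \<le> x) = (c \<le> y)" "(c \<le> u - x) = (c \<le> u - y)" using a by blast+
      next
        fix c assume "c \<in> (\<lambda>k. real k / \<beta>) ` {1..B}"
        then obtain k where "c = real k / \<beta>" "1 \<le> k" "k \<le> B" by auto
        thus "(c \<le> x) = (c \<le> y)" "(c \<le> u - x) = (c \<le> u - y)"
          using a J by (simp_all add: le_iff_ld le_reflect_iff_ld)
      qed
    qed
  qed
  thus ?thesis unfolding same_piece_def by blast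
qed

lemma pieces_eq: "pieces \<beta> n = cls ` J"
proof -
  have "same_piece \<beta> n `` {x} = cls x" if "x \<in> J" for x
    unfolding same_piece_eq cls_def using that by simp
  thus ?thesis unfolding pieces_def quotient_def by (simp add: UNION_singleton_eq_range)
qed

lemma cls_eq_iff: "x \<in> J \<Longrightarrow> y \<in> J \<Longrightarrow> cls x = cls y \<longleftrightarrow> eqv x y"
proof
  assume "x \<in> J" "y \<in> J" "cls x = cls y"
  moreover from \<open>y \<in> J\<close> have "y \<in> cls y" by (simp add: cls_def eqv_refl)
  ultimately have "y \<in> cls x" by simp
  thus "eqv x y" by (simp add: cls_def)
next
  assume e: "eqv x y"
  have "eqv x z \<longleftrightarrow> eqv y z" for z
    using eqv_trans[OF e, of z] eqv_trans[OF eqv_sym[OF e], of z] by blast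
  thus "cls x = cls y" by (simp add: cls_def)
qed

text \<open>A piece is determined by two subsets of the finite set \<open>cuts\<close>: the cuts not
  above x and those not above u - x.\<close>

lemma finite_pieces: "finite (pieces \<beta> n)"
proof -
  let ?g = "\<lambda>x. ({a\<in>cuts. a \<le> x}, {a\<in>cuts. a \<le> u - x})"
  have cls: "cls x = {y\<in>J. ?g y = ?g x}" for x
    unfolding cls_def eqv_def by blast
  have "?g ` J \<subseteq> Pow cuts \<times> Pow cuts" by auto
  hence "finite (?g ` J)" by (rule finite_subset) (simp add: finite_cuts)
  moreover have "cls ` J = (\<lambda>p. {y\<in>J. ?g y = p}) ` (?g ` J)"
    unfolding image_image using cls by (rule image_cong[OF refl])
  ultimately show ?thesis unfolding pieces_eq by simp
qed

lemma cls_less: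
  assumes "x \<in> J" "y \<in> J" "\<not> eqv x y" "x < y" "x' \<in> cls x" "y' \<in> cls y"
  shows "x' < y'"
proof (rule ccontr)
  assume n: "\<not> x' < y'"
  have e: "eqv x x'" "eqv y y'" "eqv x x" "eqv y y" using assms eqv_refl by (auto simp: cls_def)
  show False
  proof (cases "y' \<le> x")
    case True
    thus False using eqv_convex[OF e(2,4) True] assms eqv_sym by auto
  next
    case False
    hence "eqv x y'" using eqv_convex[OF e(3,1), of y'] n by auto
    thus False using e(2) assms(3) eqv_trans eqv_sym by blast
  qed
qed

lemma self_in_cls: "x \<in> J \<Longrightarrow> x \<in> cls x"
  by (simp add: cls_def eqv_refl)

lemma bij_rank:
  "bij_betw (\<lambda>D. card {D' \<in> pieces \<beta> n. \<forall>y\<in>D'. \<forall>z\<in>D. y < z}) (pieces \<beta> n) {..<card (pieces \<beta> n)}"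
proof (rule bij_betw_rank[OF finite_pieces])
  fix D assume "D \<in> pieces \<beta> n"
  thus "\<not> (\<forall>y\<in>D. \<forall>z\<in>D. y < z)" using self_in_cls unfolding pieces_eq by blast
next
  fix D1 D2 D3 assume "D2 \<in> pieces \<beta> n" "\<forall>y\<in>D1. \<forall>z\<in>D2. y < z" "\<forall>y\<in>D2. \<forall>z\<in>D3. y < z"
  moreover from this(1) obtain w where "w \<in> D2" using self_in_cls unfolding pieces_eq by blast
  ultimately show "\<forall>y\<in>D1. \<forall>z\<in>D3. y < z" using less_trans by blast
next
  fix D1 D2 assume D: "D1 \<in> pieces \<beta> n" "D2 \<in> pieces \<beta> n" "D1 \<noteq> D2"
  then obtain x y where xy: "x \<in> J" "y \<in> J" "D1 = cls x" "D2 = cls y" unfolding pieces_eq by auto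
  hence ne: "\<not> eqv x y" "\<not> eqv y x" using D cls_eq_iff eqv_sym by auto
  hence "x \<noteq> y" using eqv_refl by auto
  thus "(\<forall>y\<in>D1. \<forall>z\<in>D2. y < z) \<or> (\<forall>y\<in>D2. \<forall>z\<in>D1. y < z)"
    using cls_less[OF xy(1,2) ne(1)] cls_less[OF xy(2,1) ne(2)] xy by (meson linorder_neqE)
qed

lemma card_pieces: "card (pieces \<beta> n) = Suc L"
proof -
  have "pieces \<beta> n \<noteq> {}" using one_in_J by (auto simp: pieces_eq)
  hence "card (pieces \<beta> n) > 0" using finite_pieces by (simp add: card_gt_0_iff)
  thus ?thesis by (simp add: last_index_def)
qed

lemma piece_idx: assumes "x \<in> J" shows "piece \<beta> n (idx x) = cls x"
  unfolding piece_def
proof (rule the_equality)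
  show "cls x \<in> pieces \<beta> n \<and> card {D' \<in> pieces \<beta> n. \<forall>xa\<in>D'. \<forall>y\<in>cls x. xa < y} = idx x"
    using imageI[OF assms, of cls] unfolding pieces_eq idx_def by (rule conjI) (rule refl)
  fix D assume D: "D \<in> pieces \<beta> n \<and> card {D' \<in> pieces \<beta> n. \<forall>xa\<in>D'. \<forall>y\<in>D. xa < y} = idx x"
  have "cls x \<in> pieces \<beta> n" using assms by (simp add: pieces_eq)
  with D show "D = cls x"
    unfolding idx_def by (intro inj_onD[OF bij_betw_imp_inj_on[OF bij_rank]]) blast+
qed

lemma idx_le: assumes "x \<in> J" shows "idx x \<le> L"
proof -
  have "cls x \<in> pieces \<beta> n" using assms by (simp add: pieces_eq)
  hence "idx x < card (pieces \<beta> n)"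
    using bij_betwE[OF bij_rank] unfolding idx_def by blast
  thus ?thesis by (simp add: card_pieces)
qed

lemma idx_surj: assumes "j \<le> L" obtains x where "x \<in> J" "idx x = j"
proof -
  have "j \<in> {..<card (pieces \<beta> n)}" using assms card_pieces by simp
  hence "j \<in> (\<lambda>D. card {D' \<in> pieces \<beta> n. \<forall>y\<in>D'. \<forall>z\<in>D. y < z}) ` pieces \<beta> n"
    using bij_rank unfolding bij_betw_def by simp
  then obtain x where "x \<in> J" "idx x = j" unfolding pieces_eq idx_def by blast
  thus thesis by (rule that)
qed

lemma idx_eq_iff: assumes "x \<in> J" "y \<in> J" shows "idx x = idx y \<longleftrightarrow> eqv x y"
proof -
  have "idx x = idx y \<longleftrightarrow> cls x = cls y"
  proof
    assume "idx x = idx y"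
    thus "cls x = cls y" using piece_idx[OF assms(1)] piece_idx[OF assms(2)] by simp
  qed (simp add: idx_def)
  thus ?thesis using cls_eq_iff assms by simp
qed

lemma in_piece: assumes "j \<le> L" shows "x \<in> piece \<beta> n j \<longleftrightarrow> x \<in> J \<and> idx x = j"
proof -
  from assms obtain y where "y \<in> J" "idx y = j" by (rule idx_surj)
  have "piece \<beta> n j = cls y" using piece_idx[OF \<open>y \<in> J\<close>] \<open>idx y = j\<close> by simp
  moreover have "eqv y x \<longleftrightarrow> idx x = j" if "x \<in> J"
    using idx_eq_iff[OF \<open>y \<in> J\<close> that] \<open>idx y = j\<close> by auto
  ultimately show ?thesis unfolding cls_def by blast
qed

lemma zero_in_J: "0 \<in> J" and u_in_J: "u \<in> J" using u_gt_1 by (auto simp: in_J)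

lemma idx_0: "idx 0 = 0"
proof -
  have "\<not> (\<forall>y\<in>D. \<forall>z\<in>cls 0. y < z)" if "D \<in> pieces \<beta> n" for D
  proof -
    obtain y where "y \<in> J" "D = cls y" using \<open>D \<in> pieces \<beta> n\<close> by (auto simp: pieces_eq)
    hence "y \<in> D" "0 \<le> y" using self_in_cls by (auto simp: in_J)
    thus ?thesis using self_in_cls[OF zero_in_J] by force
  qed
  hence e: "{D \<in> pieces \<beta> n. \<forall>y\<in>D. \<forall>z\<in>cls 0. y < z} = {}" by blast
  show ?thesis unfolding idx_def e by simp
qed

lemma idx_u: "idx u = L"
proof -
  have "{D \<in> pieces \<beta> n. \<forall>y\<in>D. \<forall>z\<in>cls u. y < z} = pieces \<beta> n - {cls u}"
  proof (intro equalityI subsetI)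
    fix D assume "D \<in> {D \<in> pieces \<beta> n. \<forall>y\<in>D. \<forall>z\<in>cls u. y < z}"
    thus "D \<in> pieces \<beta> n - {cls u}" using self_in_cls[OF u_in_J] less_irrefl[of u] by blast
  next
    fix D assume D: "D \<in> pieces \<beta> n - {cls u}"
    then obtain x where x: "x \<in> J" "D = cls x" unfolding pieces_eq by auto
    have ne: "\<not> eqv x u" using D x cls_eq_iff[OF _ u_in_J] by auto
    moreover have "x \<noteq> u" using ne eqv_refl by metis
    hence "x < u" using x by (simp add: in_J)
    ultimately have "\<forall>y\<in>D. \<forall>z\<in>cls u. y < z" using cls_less[OF x(1) u_in_J] x by blast
    thus "D \<in> {D \<in> pieces \<beta> n. \<forall>y\<in>D. \<forall>z\<in>cls u. y < z}" using D by blast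
  qed
  moreover have "cls u \<in> pieces \<beta> n" using u_in_J by (simp add: pieces_eq)
  ultimately show ?thesis using finite_pieces card_pieces unfolding idx_def by simp
qed

lemma idx_eq_0_iff: "x \<in> J \<Longrightarrow> idx x = 0 \<longleftrightarrow> x \<le> u - 1"
  using idx_eq_iff[OF zero_in_J, of x] eqv_0_iff[of x] idx_0 by auto

lemma idx_eq_L_iff: "x \<in> J \<Longrightarrow> idx x = L \<longleftrightarrow> 1 \<le> x"
  using idx_eq_iff[OF u_in_J, of x] eqv_u_iff[of x] idx_u by auto

lemma L_ne_0: "L \<noteq> 0"
  using idx_eq_0_iff[OF u_in_J] idx_u by auto

lemma idx_in_eq_index_set:
  assumes "x \<in> J" "k \<le> B"
  shows "idx x \<in> eq_index_set \<beta> n k \<longleftrightarrow> \<not> sw x \<and> ld x = k"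
proof -
  have "cls x \<subseteq> equality_region \<beta> k \<longleftrightarrow> x \<in> equality_region \<beta> k"
  proof
    assume x: "x \<in> equality_region \<beta> k"
    show "cls x \<subseteq> equality_region \<beta> k"
    proof
      fix y assume "y \<in> cls x"
      hence "y \<in> J" "eqv x y" by (auto simp: cls_def)
      thus "y \<in> equality_region \<beta> k"
        using x eqv_imp_ld[OF assms(1), of y] in_equality_region[OF assms(2)] by simp
    qed
  qed (use self_in_cls[OF assms(1)] in blast)
  thus ?thesis using in_equality_region[OF assms(2), of x] piece_idx[OF assms(1)] idx_le[OF assms(1)] assms(1)
    by (simp add: eq_index_set_def)
qed

lemma idx_in_eq_indices: "x \<in> J \<Longrightarrow> idx x \<in> eq_indices \<beta> n \<longleftrightarrow> \<not> sw x"
  using idx_in_eq_index_set ld_le by (auto simp: eq_indices_def)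

lemma piece_eq_switch_region:
  assumes "1 \<le> k" "k \<le> B" "x \<in> J"
  shows "piece \<beta> n (idx x) = switch_region \<beta> k \<longleftrightarrow> sw x \<and> ld x = k"
proof
  assume "piece \<beta> n (idx x) = switch_region \<beta> k"
  thus "sw x \<and> ld x = k"
    using self_in_cls[OF assms(3)] piece_idx[OF assms(3)] in_switch_region[OF assms(1,2), of x] by simp
next
  assume x: "sw x \<and> ld x = k"
  have "y \<in> cls x \<longleftrightarrow> y \<in> switch_region \<beta> k" for y
    using eqv_sw_iff[OF assms(3), of y] x unfolding cls_def in_switch_region[OF assms(1,2)] by auto
  thus "piece \<beta> n (idx x) = switch_region \<beta> k" unfolding piece_idx[OF assms(3)] by blast
qed

lemma idx_eq_switch_index:
  assumes "1 \<le> k" "k \<le> B" "x \<in> J"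
  shows "idx x = switch_index \<beta> n k \<longleftrightarrow> sw x \<and> ld x = k"
proof -
  note s = switch_left_end[OF assms(1,2)]
  have "switch_index \<beta> n k = idx (real k / \<beta>)" unfolding switch_index_def
  proof (rule the_equality)
    show "idx (real k / \<beta>) \<in> {0..L} \<and> piece \<beta> n (idx (real k / \<beta>)) = switch_region \<beta> k"
      using piece_eq_switch_region[OF assms(1,2) s(2)] s(1,3) idx_le[OF s(2)] by simp
    fix j assume j: "j \<in> {0..L} \<and> piece \<beta> n j = switch_region \<beta> k"
    hence "j \<le> L" by simp
    then obtain y where y: "y \<in> J" "idx y = j" by (rule idx_surj)
    hence sy: "sw y \<and> ld y = k" using piece_eq_switch_region[OF assms(1,2) y(1)] j by simp
    hence "eqv y (real k / \<beta>)" using s(1,3) eqv_sw_iff[OF y(1) s(2)] by simp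
    thus "j = idx (real k / \<beta>)" using y(2) idx_eq_iff[OF y(1) s(2)] by simp
  qed
  hence "idx x = switch_index \<beta> n k \<longleftrightarrow> eqv (real k / \<beta>) x"
    using idx_eq_iff[OF s(2) assms(3)] by auto
  thus ?thesis using s(1,3) eqv_sw_iff[OF s(2) assms(3) s(1)] by auto
qed

lemma idx_in_switch_indices:
  assumes "x \<in> J"
  shows "idx x \<in> switch_indices \<beta> n \<longleftrightarrow> sw x"
proof
  assume "idx x \<in> switch_indices \<beta> n"
  then obtain k where k: "1 \<le> k" "k \<le> B" "idx x = switch_index \<beta> n k"
    by (auto simp: switch_indices_def)
  thus "sw x" using idx_eq_switch_index[OF k(1,2) assms] by simp
next
  assume "sw x"
  hence k: "1 \<le> ld x" "ld x \<le> B" using ld_le[OF assms] by (auto simp: sw_def)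
  hence "idx x = switch_index \<beta> n (ld x)" using idx_eq_switch_index[OF k assms] \<open>sw x\<close> by simp
  thus "idx x \<in> switch_indices \<beta> n" using k by (auto simp: switch_indices_def)
qed

lemma expansion_digit_idx:
  assumes "x \<in> J" "y j = idx x"
  shows "expansion_digit \<beta> n y j = (if \<not> sw x \<or> y (Suc j) = 0 then ld x else ld x - 1)"
proof (cases "sw x")
  case False
  have "(THE k. k \<in> {0..B} \<and> y j \<in> eq_index_set \<beta> n k) = ld x"
    unfolding assms(2) using False ld_le[OF assms(1)]
    by (intro the_equality) (auto simp: idx_in_eq_index_set[OF assms(1)])
  thus ?thesis using False assms by (simp add: expansion_digit_def idx_in_eq_indices)
next
  case True
  hence "(THE k. k \<in> {1..B} \<and> y j = switch_index \<beta> n k) = ld x"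
    unfolding assms(2) using ld_le[OF assms(1)]
    by (intro the_equality) (auto simp: idx_eq_switch_index[OF _ _ assms(1)] sw_def)
  thus ?thesis using True assms by (simp add: expansion_digit_def idx_in_eq_indices Let_def)
qed

end

section \<open>The random map and its reference measures\<close>

locale random_greedy = finite_greedy +
  fixes p :: real
  assumes p_gt_0: "0 < p" and p_less_1: "p < 1"
begin

abbreviation "JM \<equiv> restrict_space lborel J"
abbreviation "bern \<equiv> bernoulli_measure p"
abbreviation "rho \<equiv> bern \<Otimes>\<^sub>M JM"
abbreviation "P \<equiv> trans_prob \<beta> n p"

definition len :: "nat \<Rightarrow> real" where "len j = measure lborel (piece \<beta> n j)"

definition shift :: "(nat \<Rightarrow> bool) \<Rightarrow> nat \<Rightarrow> bool" where "shift \<omega> i = \<omega> (Suc i)"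

text \<open>\<open>T x + 1\<close> is the lazy image, with digit \<open>ld x - 1\<close>. A coin
  True selects the greedy image, in agreement with \<open>psi\<close>, which reads True when the
  next symbol is 0.\<close>

definition step :: "(nat \<Rightarrow> bool) \<times> real \<Rightarrow> (nat \<Rightarrow> bool) \<times> real" where
  "step z = (if sw (snd z)
     then (shift (fst z), if fst z 0 then T (snd z) else T (snd z) + 1)
     else (fst z, T (snd z)))"

lemma J_borel [measurable]: "J \<in> sets borel"
  by (simp add: J_int_def)

lemma space_JM [simp]: "space JM = J" by (simp add: space_restrict_space)

lemma sets_JM_iff: "X \<in> sets JM \<longleftrightarrow> X \<in> sets borel \<and> X \<subseteq> J"
  by (subst sets_restrict_space_iff) auto

lemma emeasure_JM: "X \<in> sets JM \<Longrightarrow> emeasure JM X = emeasure lborel X"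
  by (subst emeasure_restrict_space) (auto simp: sets_JM_iff)

lemma finite_measure_JM: "finite_measure JM"
proof
  show "emeasure JM (space JM) \<noteq> \<infinity>"
    by (subst emeasure_JM) (simp_all add: sets_JM_iff, simp add: J_int_def emeasure_lborel_Icc_eq)
qed

sublocale JM: finite_measure JM by (rule finite_measure_JM)

lemma prob_space_bern: "prob_space bern"
  unfolding bernoulli_measure_def by (intro prob_space_PiM measure_pmf.prob_space_axioms)

sublocale bern: prob_space bern by (rule prob_space_bern)

lemma space_bern [simp]: "space bern = UNIV"
  by (simp add: bernoulli_measure_def space_PiM)

lemma space_rho: "space rho = UNIV \<times> J"
  by (simp add: space_pair_measure)

lemma sets_bern: "sets bern = sets (\<Pi>\<^sub>M i\<in>UNIV. count_space UNIV)"
  unfolding bernoulli_measure_def by (intro sets_PiM_cong) auto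

lemma coord_bern [measurable]: "(\<lambda>\<omega>. \<omega> i) \<in> bern \<rightarrow>\<^sub>M count_space UNIV"
  unfolding measurable_cong_sets[OF sets_bern refl] by (rule measurable_component_singleton) simp

lemma shift_bern [measurable]: "shift \<in> bern \<rightarrow>\<^sub>M bern"
  unfolding measurable_cong_sets[OF refl sets_bern] shift_def
proof (rule measurable_PiM_single')
  fix i :: nat
  show "(\<lambda>\<omega>. (\<lambda>i. \<omega> (Suc i)) i) \<in> bern \<rightarrow>\<^sub>M count_space UNIV" by measurable
qed auto

section \<open>Measurability and lengths of the pieces, measurability of the random map\<close>

lemma piece_sets: assumes "j \<le> L" shows "piece \<beta> n j \<in> sets borel" "piece \<beta> n j \<subseteq> J"
proof -
  have "is_interval (piece \<beta> n j)" unfolding is_interval_1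
  proof (intro ballI allI impI)
    fix a b x assume *: "a \<in> piece \<beta> n j" "b \<in> piece \<beta> n j" "a \<le> x \<and> x \<le> b"
    hence ab: "a \<in> J" "b \<in> J" "idx a = j" "idx b = j" using in_piece[OF assms] by auto
    hence x: "x \<in> J" using * by (auto simp: in_J)
    have "eqv a b" using ab idx_eq_iff[OF ab(1,2)] by simp
    hence "eqv a x" using eqv_convex[of a a b x] eqv_refl * by auto
    thus "x \<in> piece \<beta> n j" using idx_eq_iff[OF ab(1) x] ab(3) x in_piece[OF assms] by auto
  qed
  thus "piece \<beta> n j \<in> sets borel" by (rule real_interval_borel_measurable)
  show "piece \<beta> n j \<subseteq> J" using in_piece[OF assms] by blast
qed

lemma emeasure_piece: "j \<le> L \<Longrightarrow> emeasure lborel (piece \<beta> n j) = ennreal (len j)"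
proof -
  assume "j \<le> L"
  hence "emeasure lborel (piece \<beta> n j) \<le> emeasure lborel J"
    using piece_sets by (intro emeasure_mono) auto
  also have "\<dots> < \<infinity>" by (simp add: J_int_def u_gt_1 emeasure_lborel_Icc_eq)
  finally show ?thesis unfolding len_def by (subst emeasure_eq_ennreal_measure) auto
qed

lemma len_pos: assumes "j \<le> L" shows "len j > 0"
proof -
  obtain x where x: "x \<in> J" "idx x = j" using assms by (rule idx_surj)
  obtain l h where lh: "l < h" "{l<..<h} \<subseteq> {y\<in>J. eqv x y}"
    using eqv_contains_interval[OF x(1)] by auto
  moreover have "{y\<in>J. eqv x y} \<subseteq> piece \<beta> n j"
  proof
    fix y assume "y \<in> {y\<in>J. eqv x y}"
    thus "y \<in> piece \<beta> n j" using idx_eq_iff[OF x(1), of y] in_piece[OF assms, of y] x(2) by simp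
  qed
  ultimately have "{l<..<h} \<subseteq> piece \<beta> n j" by blast
  hence "emeasure lborel {l<..<h} \<le> emeasure lborel (piece \<beta> n j)"
    using piece_sets[OF assms] by (intro emeasure_mono) auto
  hence "ennreal (h - l) \<le> ennreal (len j)" using lh emeasure_piece[OF assms] by simp
  moreover have "len j \<ge> 0" by (simp add: len_def)
  ultimately show ?thesis using lh by simp
qed

text \<open>The factor 1/u cancels in the transition probabilities, which permits unnormalised
  Lebesgue measure from here on.\<close>

lemma measure_lam: assumes "X \<in> sets borel" "X \<subseteq> J" shows "measure (lam \<beta>) X = measure lborel X / u"
proof -
  have u: "emeasure lborel J = ennreal u" using u_gt_1 by (simp add: J_int_def emeasure_lborel_Icc_eq)
  hence "measure (lam \<beta>) X = measure lborel (J \<inter> X) / measure lborel J"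
    unfolding lam_def using u_gt_1 assms by (intro measure_uniform_measure) auto
  also have "measure lborel J = u" using u u_gt_1 by (simp add: measure_def)
  finally show ?thesis using assms by (simp add: Int_absorb1)
qed

lemma idx_measurable: "idx \<in> JM \<rightarrow>\<^sub>M count_space {0..L}"
proof (rule measurable_count_space_eq2[THEN iffD2], simp, intro conjI ballI)
  show "idx \<in> space JM \<rightarrow> {0..L}" using idx_le by auto
  fix j assume "j \<in> {0..L}"
  hence j: "j \<le> L" by simp
  have "idx -` {j} \<inter> space JM = piece \<beta> n j" using in_piece[OF j] by auto
  thus "idx -` {j} \<inter> space JM \<in> sets JM" using piece_sets[OF j] by (simp add: sets_JM_iff)
qed

lemma pred_idx [measurable]: "Measurable.pred JM (\<lambda>x. idx x = j)"
proof -
  have "idx \<in> JM \<rightarrow>\<^sub>M count_space UNIV"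
    using idx_measurable by (rule measurable_compose) simp
  thus ?thesis by measurable
qed

lemma pred_sw [measurable]: "Measurable.pred JM sw"
proof -
  have "Measurable.pred JM (\<lambda>x. idx x \<in> switch_indices \<beta> n)"
  proof -
    have "Measurable.pred JM (\<lambda>x. \<exists>k\<in>{1..B}. idx x = switch_index \<beta> n k)"
      by measurable
    thus ?thesis by (simp add: switch_indices_def image_iff)
  qed
  thus ?thesis by (rule measurable_cong[THEN iffD1, rotated]) (simp add: idx_in_switch_indices)
qed

lemma T_measurable [measurable]: "T \<in> JM \<rightarrow>\<^sub>M borel"
proof -
  have 1: "(\<lambda>x. \<beta> * x - real (min B (nat \<lfloor>\<beta> * x\<rfloor>))) \<in> borel_measurable borel"
    by measurable
  have "(\<lambda>x. \<beta> * x - real (min B (nat \<lfloor>\<beta> * x\<rfloor>))) \<in> JM \<rightarrow>\<^sub>M borel"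
    by (intro measurable_restrict_space1) (use 1 in simp)
  thus ?thesis by (rule measurable_cong[THEN iffD1, rotated]) (simp add: T_eq ld_min)
qed

text \<open>Leaves room for the lazy image \<open>T x + 1\<close> inside J.\<close>

lemma T_sw: assumes "x \<in> J" "sw x" shows "0 \<le> T x" "T x \<le> u - 1"
  using assms T_in_J[OF assms(1)] by (auto simp: sw_def T_eq in_J)

lemma step_in_J: "snd z \<in> J \<Longrightarrow> snd (step z) \<in> J"
  using T_in_J[of "snd z"] T_sw[of "snd z"] by (auto simp: step_def in_J)

lemma step_measurable [measurable]: "step \<in> rho \<rightarrow>\<^sub>M rho"
proof -
  have [measurable]: "Measurable.pred rho (\<lambda>z. sw (snd z))" by measurable
  have 1: "(\<lambda>z. fst (step z)) \<in> rho \<rightarrow>\<^sub>M bern"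
  proof -
    have eq: "(\<lambda>z. fst (step z)) = (\<lambda>z. if sw (snd z) then shift (fst z) else fst z)"
      by (auto simp: step_def)
    show ?thesis unfolding eq by measurable
  qed
  have 2: "(\<lambda>z. snd (step z)) \<in> rho \<rightarrow>\<^sub>M JM"
  proof (rule measurable_restrict_space2)
    show "(\<lambda>z. snd (step z)) \<in> space rho \<rightarrow> J" using step_in_J by (auto simp: space_rho)
    have eq: "(\<lambda>z. snd (step z)) =
        (\<lambda>z. if sw (snd z) then (if fst z 0 then T (snd z) else T (snd z) + 1) else T (snd z))"
      by (auto simp: step_def)
    have [measurable]: "(\<lambda>z. T (snd z)) \<in> borel_measurable rho" by measurable
    have "(\<lambda>z. if sw (snd z) then (if fst z 0 then T (snd z) else T (snd z) + 1) else T (snd z))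
      \<in> borel_measurable rho" by measurable
    thus "(\<lambda>z. snd (step z)) \<in> rho \<rightarrow>\<^sub>M lborel" unfolding eq by simp
  qed
  show ?thesis using measurable_Pair[OF 1 2] by simp
qed

lemma emeasure_rho:
  assumes "X \<in> sets rho"
  shows "emeasure rho X = (\<integral>\<^sup>+\<omega>. emeasure lborel (Pair \<omega> -` X) \<partial>bern)"
  using assms by (simp add: JM.emeasure_pair_measure_alt emeasure_JM sets_Pair1)

text \<open>The first coin is independent of the remaining ones, which again have the Bernoulli law:
  \<open>bern\<close> is the image of one coin times \<open>bern\<close> under prepending.\<close>

lemma nn_integral_bern_shift:
  assumes g: "g \<in> borel_measurable bern"
  shows "(\<integral>\<^sup>+\<omega>. (if \<omega> 0 = s then g (shift \<omega>) else 0) \<partial>bern) =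
    ennreal (if s then p else 1 - p) * (\<integral>\<^sup>+\<omega>. g \<omega> \<partial>bern)"
proof -
  let ?M = "measure_pmf (bernoulli_pmf p)"
  interpret M: prob_space ?M by (rule measure_pmf.prob_space_axioms)
  interpret sequence_space ?M by unfold_locales
  have b: "bern = (\<Pi>\<^sub>M i\<in>UNIV. ?M)" by (simp add: bernoulli_measure_def)
  have g' [measurable]: "g \<in> borel_measurable bern" by fact
  have h: "(\<lambda>\<omega>. if \<omega> 0 = s then g (shift \<omega>) else 0) \<in> borel_measurable bern" by measurable
  have cn: "(\<lambda>(s, \<omega>). case_nat s \<omega>) \<in> (?M \<Otimes>\<^sub>M bern) \<rightarrow>\<^sub>M bern" unfolding b by measurable
  have "(\<integral>\<^sup>+\<omega>. (if \<omega> 0 = s then g (shift \<omega>) else 0) \<partial>bern) =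
     (\<integral>\<^sup>+\<omega>. (if \<omega> 0 = s then g (shift \<omega>) else 0) \<partial>distr (?M \<Otimes>\<^sub>M bern) bern (\<lambda>(s, \<omega>). case_nat s \<omega>))"
    unfolding b PiM_iter ..
  also have "\<dots> = (\<integral>\<^sup>+z. (if fst z = s then g (snd z) else 0) \<partial>(?M \<Otimes>\<^sub>M bern))"
    using cn h by (subst nn_integral_distr)
      (auto intro!: nn_integral_cong simp: shift_def[abs_def] split_beta)
  also have "\<dots> = (\<integral>\<^sup>+s'. (\<integral>\<^sup>+\<omega>. (if s' = s then g \<omega> else 0) \<partial>bern) \<partial>?M)"
    by (subst bern.nn_integral_fst[symmetric]) (simp_all only: fst_conv snd_conv, measurable)
  also have "\<dots> = (\<integral>\<^sup>+s'. (\<integral>\<^sup>+\<omega>. g \<omega> \<partial>bern) * indicator {s} s' \<partial>?M)"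
    by (intro nn_integral_cong) (simp add: indicator_def)
  also have "\<dots> = (\<integral>\<^sup>+\<omega>. g \<omega> \<partial>bern) * emeasure ?M {s}"
    by (subst nn_integral_cmult_indicator) auto
  also have "emeasure ?M {s} = ennreal (if s then p else 1 - p)"
    using p_gt_0 p_less_1 by (simp add: emeasure_pmf_single)
  finally show ?thesis by (simp add: mult.commute)
qed

lemma T_measurable_JM: "T \<in> JM \<rightarrow>\<^sub>M JM"
proof (rule measurable_restrict_space2)
  show "T \<in> space JM \<rightarrow> J" using T_in_J by (intro funcsetI) simp
  show "T \<in> JM \<rightarrow>\<^sub>M lborel" using T_measurable by simp
qed

lemma in_switch_piece:
  assumes "x \<in> J" "sw x"
  shows "z \<in> piece \<beta> n (idx x) \<longleftrightarrow> real (ld x) \<le> \<beta> * z \<and> \<beta> * z \<le> u + real (ld x) - 1"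
proof -
  have k: "1 \<le> ld x" "ld x \<le> B" using assms ld_le by (auto simp: sw_def)
  have "piece \<beta> n (idx x) = switch_region \<beta> (ld x)"
    using piece_eq_switch_region[OF k assms(1)] assms by simp
  moreover have Bb: "real B / (\<beta> * (\<beta> - 1)) = u / \<beta>" by (simp add: top_pt_def)
  moreover have "switch_region \<beta> (ld x) = {z. real (ld x) \<le> \<beta> * z \<and> \<beta> * z \<le> u + real (ld x) - 1}"
    unfolding switch_region_def Bb by (auto simp: field_simps)
  ultimately show ?thesis by simp
qed

lemma in_piece_0: "z \<in> piece \<beta> n 0 \<longleftrightarrow> 0 \<le> z \<and> z \<le> u - 1"
proof -
  have "z \<in> piece \<beta> n 0 \<longleftrightarrow> z \<in> J \<and> idx z = 0" by (rule in_piece) simp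
  also have "\<dots> \<longleftrightarrow> z \<in> J \<and> z \<le> u - 1" using idx_eq_0_iff by blast
  also have "\<dots> \<longleftrightarrow> 0 \<le> z \<and> z \<le> u - 1" by (auto simp: in_J)
  finally show ?thesis .
qed

lemma in_piece_L: "z \<in> piece \<beta> n L \<longleftrightarrow> 1 \<le> z \<and> z \<le> u"
proof -
  have "z \<in> piece \<beta> n L \<longleftrightarrow> z \<in> J \<and> idx z = L" by (rule in_piece) simp
  also have "\<dots> \<longleftrightarrow> z \<in> J \<and> 1 \<le> z" using idx_eq_L_iff by blast
  also have "\<dots> \<longleftrightarrow> 1 \<le> z \<and> z \<le> u" by (auto simp: in_J)
  finally show ?thesis .
qed

text \<open>The greedy branch stretches a switch piece exactly onto the first piece, the lazy branch
  onto the last one. So both rows of coin outcomes carry uniform laws to uniform laws.\<close>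

lemma switch_piece_vimage:
  assumes "x \<in> J" "sw x"
  shows "piece \<beta> n (idx x) = (\<lambda>z. - real (ld x) + \<beta> * z) -` piece \<beta> n 0"
    and "piece \<beta> n (idx x) = (\<lambda>z. 1 - real (ld x) + \<beta> * z) -` piece \<beta> n L"
proof -
  show "piece \<beta> n (idx x) = (\<lambda>z. - real (ld x) + \<beta> * z) -` piece \<beta> n 0"
    by (rule set_eqI) (simp only: in_switch_piece[OF assms] vimage_eq in_piece_0, linarith)
  show "piece \<beta> n (idx x) = (\<lambda>z. 1 - real (ld x) + \<beta> * z) -` piece \<beta> n L"
    by (rule set_eqI) (simp only: in_switch_piece[OF assms] vimage_eq in_piece_L, linarith)
qed

lemma len_vimage:
  assumes "i \<le> L" "j \<le> L" "piece \<beta> n i = (\<lambda>z. c + \<beta> * z) -` piece \<beta> n j"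
  shows "len i = len j / \<beta>"
proof -
  have "ennreal (len i) = ennreal (1 / \<beta>) * ennreal (len j)"
    unfolding emeasure_piece[OF assms(1), symmetric] emeasure_piece[OF assms(2), symmetric] assms(3)
    by (rule emeasure_lborel_affine_vimage[OF piece_sets(1)[OF assms(2)] beta_pos(1)])
  also have "\<dots> = ennreal (len j / \<beta>)" by (simp add: len_def flip: ennreal_mult)
  finally show ?thesis by (simp add: len_def)
qed

lemma idx_snd_sets: "{z \<in> space rho. idx (snd z) = i} \<in> sets rho"
  using measurable_compose[OF measurable_snd pred_idx] by (rule predE)

lemma trans_set_sets:
  assumes "X \<in> sets rho"
  shows "{z \<in> space rho. idx (snd z) = i \<and> step z \<in> X} \<in> sets rho"
proof -
  have "{z \<in> space rho. idx (snd z) = i \<and> step z \<in> X} =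
      {z \<in> space rho. idx (snd z) = i} \<inter> (step -` X \<inter> space rho)" by blast
  thus ?thesis using idx_snd_sets measurable_sets[OF step_measurable assms] by simp
qed

subsection \<open>One step of the random map\<close>

definition entering :: "nat \<Rightarrow> nat \<Rightarrow> real set" where
  "entering i j = {z\<in>J. idx z = i \<and> idx (T z) = j}"

lemma entering_sets: "entering i j \<in> sets borel"
proof -
  have "{z\<in>space JM. idx z = i} \<inter> {z\<in>space JM. idx (T z) = j} \<in> sets JM"
    using predE[OF pred_idx] predE[OF measurable_compose[OF T_measurable_JM pred_idx]]
    by (rule sets.Int)
  moreover have "{z\<in>space JM. idx z = i} \<inter> {z\<in>space JM. idx (T z) = j} = entering i j"
    by (auto simp: entering_def)
  ultimately show ?thesis by (simp add: sets_JM_iff)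
qed

lemma P_eq_entering:
  assumes "x \<in> J" "\<not> sw x" "idx x = i" "j \<le> L"
  shows "P i j = measure lborel (entering i j) / len i"
proof -
  have i: "i \<le> L" using idx_le assms by auto
  have "piece \<beta> n i \<inter> greedy_preimage \<beta> (piece \<beta> n j) = entering i j"
    using in_piece[OF i] in_piece[OF assms(4)] T_in_J by (auto simp: greedy_preimage_def entering_def)
  moreover have "entering i j \<subseteq> J" by (auto simp: entering_def)
  ultimately show ?thesis
    using idx_in_eq_indices[OF assms(1)] assms piece_sets[OF i] entering_sets[of i j] u_gt_1
    by (simp add: trans_prob_def measure_lam len_def)
qed

text \<open>A single point passing from piece i to piece j forces the whole inverse image of piece j
  under that branch to lie in piece i, by \<open>T_inverse\<close>.\<close>

lemma entering_vimage:
  assumes "x \<in> J" "\<not> sw x" "idx x = i" "j \<le> L" "entering i j \<noteq> {}"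
  shows "entering i j = (\<lambda>z. - real (ld x) + \<beta> * z) -` piece \<beta> n j"
proof -
  obtain z0 where z0: "z0 \<in> J" "idx z0 = i" "idx (T z0) = j" using assms by (auto simp: entering_def)
  have e0: "eqv x z0" using idx_eq_iff[OF assms(1) z0(1)] z0 assms by simp
  have z0': "\<not> sw z0" "ld z0 = ld x" using eqv_imp_ld[OF assms(1) z0(1) e0] assms by auto
  show ?thesis
  proof (intro equalityI subsetI)
    fix z assume z: "z \<in> entering i j"
    hence "eqv x z" using idx_eq_iff[OF assms(1), of z] assms by (auto simp: entering_def)
    hence "ld z = ld x" using eqv_imp_ld(1)[OF assms(1), of z] z by (auto simp: entering_def)
    hence "- real (ld x) + \<beta> * z = T z" by (simp add: T_eq)
    thus "z \<in> (\<lambda>z. - real (ld x) + \<beta> * z) -` piece \<beta> n j"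
      using z in_piece[OF assms(4)] T_in_J by (auto simp: entering_def)
  next
    fix z assume "z \<in> (\<lambda>z. - real (ld x) + \<beta> * z) -` piece \<beta> n j"
    hence y: "- real (ld x) + \<beta> * z \<in> J" "idx (- real (ld x) + \<beta> * z) = j"
      using in_piece[OF assms(4)] by auto
    have "eqv (T z0) (- real (ld x) + \<beta> * z)"
      using idx_eq_iff[OF T_in_J[OF z0(1)] y(1)] y z0 by simp
    note inv = T_inverse[OF z0(1) z0'(1) y(1) this]
    have e: "(- real (ld x) + \<beta> * z + real (ld z0)) / \<beta> = z" using z0' by simp
    have "z \<in> J" "eqv z0 z" "T z = - real (ld x) + \<beta> * z" using inv unfolding e by auto
    thus "z \<in> entering i j" using idx_eq_iff[OF z0(1), of z] z0 y by (simp add: entering_def)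
  qed
qed

text \<open>The Markov property in numbers: the ratio needed in the one-step computation is the
  contraction factor of the inverse branch, or 0 if the transition is impossible.\<close>

lemma P_eq_index:
  assumes "x \<in> J" "\<not> sw x" "idx x = i" "j \<le> L"
  shows "len i * P i j / len j = (if entering i j = {} then 0 else 1 / \<beta>)"
proof (cases "entering i j = {}")
  case True
  thus ?thesis using P_eq_entering[OF assms] by simp
next
  case False
  have "emeasure lborel (entering i j) = ennreal (1 / \<beta>) * ennreal (len j)"
    unfolding entering_vimage[OF assms False] emeasure_piece[OF assms(4), symmetric]
    by (rule emeasure_lborel_affine_vimage) (use piece_sets assms in auto)
  hence "emeasure lborel (entering i j) = ennreal (len j / \<beta>)"
    by (simp add: len_def flip: ennreal_mult)
  hence "measure lborel (entering i j) = len j / \<beta>" by (simp add: measure_def len_def)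
  thus ?thesis using False P_eq_entering[OF assms] len_pos[OF assms(4)] len_pos[of i] idx_le assms
    by auto
qed

lemma P_switch_index:
  assumes "x \<in> J" "sw x" "idx x = i"
  shows "P i j = (if j = 0 then p else if j = L then 1 - p else 0)"
  using idx_in_eq_indices[OF assms(1)] assms by (simp add: trans_prob_def)

text \<open>The uniform law on a cell is carried by \<open>step\<close> to the \<open>P\<close>-mixture of the uniform laws on the cells:
  the factor \<open>len i / len j\<close> accounts for working with the unnormalised measure \<open>rho\<close>.\<close>
lemma emeasure_step_vimage:
  assumes i: "i \<le> L" and j: "j \<le> L" and X: "X \<in> sets rho" "\<And>z. z \<in> X \<Longrightarrow> idx (snd z) = j"
  shows "emeasure rho {z \<in> space rho. idx (snd z) = i \<and> step z \<in> X} =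
    ennreal (len i * P i j / len j) * emeasure rho X"
proof -
  obtain x where x: "x \<in> J" "idx x = i" using i by (rule idx_surj)
  let ?k = "real (ld x)"
  let ?Z = "{z \<in> space rho. idx (snd z) = i \<and> step z \<in> X}"
  define g where "g \<omega> = emeasure lborel (Pair \<omega> -` X)" for \<omega>
  have XJ: "snd z \<in> J" if "z \<in> X" for z using sets.sets_into_space[OF X(1)] that by (auto simp: space_rho)
  have Xp: "snd z \<in> piece \<beta> n j" if "z \<in> X" for z using in_piece[OF j] XJ X(2) that by auto
  have sec: "Pair \<omega> -` X \<in> sets borel" for \<omega> using sets_Pair1[OF X(1)] by (simp add: sets_JM_iff)
  have gJ: "g \<omega> = emeasure JM (Pair \<omega> -` X)" for \<omega>
    unfolding g_def using sets_Pair1[OF X(1)] by (simp add: emeasure_JM)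
  have g [measurable]: "g \<in> borel_measurable bern"
    unfolding gJ by (rule JM.measurable_emeasure_Pair[OF X(1)])
  have rhoX: "emeasure rho X = (\<integral>\<^sup>+\<omega>. g \<omega> \<partial>bern)" unfolding g_def by (rule emeasure_rho[OF X(1)])
  have Z: "?Z \<in> sets rho" using X(1) by (rule trans_set_sets)
  have aff: "emeasure lborel ((\<lambda>z. c + \<beta> * z) -` (Pair \<omega> -` X)) = ennreal (1 / \<beta>) * g \<omega>" for c \<omega>
    unfolding g_def by (rule emeasure_lborel_affine_vimage[OF sec beta_pos(1)])
  show ?thesis
  proof (cases "sw x")
    case False
    note Pi = P_eq_index[OF x(1) False x(2) j]
    have st: "step (\<omega>, z) = (\<omega>, T z) \<and> T z = - ?k + \<beta> * z" if "z \<in> J" "idx z = i" for \<omega> z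
    proof -
      have "eqv x z" using idx_eq_iff[OF x(1) that(1)] that x by simp
      hence "ld z = ld x" "\<not> sw z" using eqv_imp_ld[OF x(1) that(1)] False by auto
      thus ?thesis by (simp add: step_def T_eq)
    qed
    show ?thesis
    proof (cases "entering i j = {}")
      case True
      hence "?Z = {}" using st X(2) by (force simp: space_rho entering_def)
      hence "emeasure rho ?Z = 0" by (simp only: emeasure_empty)
      thus ?thesis unfolding Pi using True by simp
    next
      case ne: False
      note ev = entering_vimage[OF x(1) False x(2) j ne]
      \<comment> \<open>No coin is spent, so the section over each coin sequence is an affine
        preimage of the section of X over the same sequence.\<close>
      have "Pair \<omega> -` ?Z = (\<lambda>z. - ?k + \<beta> * z) -` (Pair \<omega> -` X)" for \<omega>
      proof (intro equalityI subsetI)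
        fix z assume "z \<in> Pair \<omega> -` ?Z"
        thus "z \<in> (\<lambda>z. - ?k + \<beta> * z) -` (Pair \<omega> -` X)" using st by (auto simp: space_rho)
      next
        fix z assume z: "z \<in> (\<lambda>z. - ?k + \<beta> * z) -` (Pair \<omega> -` X)"
        hence "z \<in> entering i j" unfolding ev using Xp by auto
        hence zJ: "z \<in> J" "idx z = i" by (auto simp: entering_def)
        thus "z \<in> Pair \<omega> -` ?Z" using st[OF zJ, of \<omega>] z by (auto simp: space_rho)
      qed
      hence "emeasure rho ?Z = (\<integral>\<^sup>+\<omega>. ennreal (1 / \<beta>) * g \<omega> \<partial>bern)"
        unfolding emeasure_rho[OF Z] by (simp only: aff)
      also have "\<dots> = ennreal (1 / \<beta>) * emeasure rho X"
        unfolding rhoX by (rule nn_integral_cmult[OF g])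
      finally show ?thesis unfolding Pi using ne by simp
    qed
  next
    case True
    note Pi = P_switch_index[OF x(1) True x(2)]
    have st: "sw z \<and> ld z = ld x" if "z \<in> J" "idx z = i" for z
    proof -
      have "eqv x z" using idx_eq_iff[OF x(1) that(1)] that x by simp
      thus ?thesis using eqv_imp_ld[OF x(1) that(1)] True by auto
    qed
    have st1: "step (\<omega>, z) = (shift \<omega>, (if \<omega> 0 then 0 else 1) - ?k + \<beta> * z)" if "z \<in> J" "idx z = i" for \<omega> z
      using st[OF that] by (simp add: step_def T_eq)
    have pi: "piece \<beta> n i = (\<lambda>z. - ?k + \<beta> * z) -` piece \<beta> n 0"
        "piece \<beta> n i = (\<lambda>z. 1 - ?k + \<beta> * z) -` piece \<beta> n L"
      using switch_piece_vimage[OF x(1) True] x by auto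
    have st2: "(if \<omega> 0 then 0 else 1) - ?k + \<beta> * z \<in> piece \<beta> n (if \<omega> 0 then 0 else L)"
      if "z \<in> J" "idx z = i" for \<omega> z
      using that in_piece[OF i] pi by (cases "\<omega> 0") auto
    have branch: "emeasure rho ?Z = ennreal (1 / \<beta> * (if s then p else 1 - p)) * emeasure rho X"
      if js: "j = (if s then 0 else L)" for s
    proof -
      let ?c = "(if s then 0 else 1) - ?k"
      \<comment> \<open>As pieces 0 and L differ, the target piece determines the coin spent; the
        section of X is then taken over the remaining coins.\<close>
      have "Pair \<omega> -` ?Z = (if \<omega> 0 = s then (\<lambda>z. ?c + \<beta> * z) -` (Pair (shift \<omega>) -` X) else {})" for \<omega>
      proof (intro equalityI subsetI)
        fix z assume "z \<in> Pair \<omega> -` ?Z"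
        hence z: "z \<in> J" "idx z = i" "step (\<omega>, z) \<in> X" by (auto simp: space_rho)
        have "idx ((if \<omega> 0 then 0 else 1) - ?k + \<beta> * z) = (if \<omega> 0 then 0 else L)"
          using st2[OF z(1,2), of \<omega>] in_piece[of "if \<omega> 0 then 0 else L"] by auto
        hence "\<omega> 0 = s" using X(2)[OF z(3)] js L_ne_0 unfolding st1[OF z(1,2)] by (auto split: if_splits)
        thus "z \<in> (if \<omega> 0 = s then (\<lambda>z. ?c + \<beta> * z) -` (Pair (shift \<omega>) -` X) else {})"
          using z(3) unfolding st1[OF z(1,2)] by auto
      next
        fix z assume z: "z \<in> (if \<omega> 0 = s then (\<lambda>z. ?c + \<beta> * z) -` (Pair (shift \<omega>) -` X) else {})"
        hence s: "\<omega> 0 = s" "(shift \<omega>, ?c + \<beta> * z) \<in> X" by (auto split: if_splits)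
        have "z \<in> piece \<beta> n i" using Xp[OF s(2)] js pi by (cases s) auto
        hence zJ: "z \<in> J" "idx z = i" using in_piece[OF i] by auto
        show "z \<in> Pair \<omega> -` ?Z" using st1[OF zJ, of \<omega>] s zJ by (auto simp: space_rho)
      qed
      hence sec: "emeasure lborel (Pair \<omega> -` ?Z) =
          ennreal (1 / \<beta>) * (if \<omega> 0 = s then g (shift \<omega>) else 0)" for \<omega>
        by (cases "\<omega> 0 = s") (simp_all only: simp_thms aff if_True if_False emeasure_empty mult_zero_right)
      have m: "(\<lambda>\<omega>. if \<omega> 0 = s then g (shift \<omega>) else 0) \<in> borel_measurable bern"
        by measurable
      have "emeasure rho ?Z = ennreal (1 / \<beta>) * (\<integral>\<^sup>+\<omega>. (if \<omega> 0 = s then g (shift \<omega>) else 0) \<partial>bern)"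
        unfolding emeasure_rho[OF Z] sec by (rule nn_integral_cmult[OF m])
      also have "\<dots> = ennreal (1 / \<beta>) * (ennreal (if s then p else 1 - p) * emeasure rho X)"
        unfolding rhoX nn_integral_bern_shift[OF g] ..
      also have "\<dots> = ennreal (1 / \<beta> * (if s then p else 1 - p)) * emeasure rho X"
        using p_gt_0 p_less_1 by (subst ennreal_mult) (auto simp: mult.assoc)
      finally show ?thesis .
    qed
    \<comment> \<open>Turns \<open>len i / len j\<close> into 1/\<beta> for either end
      piece.\<close>
    have li: "len i = len 0 / \<beta>" "len i = len L / \<beta>"
      using len_vimage[OF i _ pi(1)] len_vimage[OF i _ pi(2)] by auto
    consider "j = 0" | "j = L" "j \<noteq> 0" | "j \<noteq> 0" "j \<noteq> L" by blast
    thus ?thesis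
    proof cases
      case 1
      have "len i * P i j / len j = 1 / \<beta> * p" using li(1) Pi 1 len_pos[of 0] by simp
      moreover have "emeasure rho ?Z = ennreal (1 / \<beta> * p) * emeasure rho X"
        using branch[of True] 1 by simp
      ultimately show ?thesis by simp
    next
      case 2
      have "len i * P i j / len j = 1 / \<beta> * (1 - p)" using li(2) Pi 2 len_pos[of L] by simp
      moreover have "emeasure rho ?Z = ennreal (1 / \<beta> * (1 - p)) * emeasure rho X"
        using branch[of False] 2 by simp
      ultimately show ?thesis by simp
    next
      case 3
      have "?Z = {}"
      proof (rule ccontr)
        assume "?Z \<noteq> {}"
        then obtain \<omega> z where z: "z \<in> J" "idx z = i" "step (\<omega>, z) \<in> X" by (auto simp: space_rho)
        have "idx ((if \<omega> 0 then 0 else 1) - ?k + \<beta> * z) = (if \<omega> 0 then 0 else L)"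
          using st2[OF z(1,2), of \<omega>] in_piece[of "if \<omega> 0 then 0 else L"] by auto
        thus False using X(2)[OF z(3)] 3 unfolding st1[OF z(1,2)] by (auto split: if_splits)
      qed
      hence "emeasure rho ?Z = 0" by (simp only: emeasure_empty)
      thus ?thesis using Pi 3 by simp
    qed
  qed
qed

section \<open>Stochasticity of the transition matrix and its closed sets\<close>

lemma piece_eq_UN_entering:
  assumes "i \<le> L" shows "piece \<beta> n i = (\<Union>j\<in>{0..L}. entering i j)"
proof (intro equalityI subsetI)
  fix z assume "z \<in> piece \<beta> n i"
  hence z: "z \<in> J" "idx z = i" using in_piece[OF assms] by auto
  hence "z \<in> entering i (idx (T z))" by (simp add: entering_def)
  thus "z \<in> (\<Union>j\<in>{0..L}. entering i j)" using idx_le[OF T_in_J[OF z(1)]] by auto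
next
  fix z assume "z \<in> (\<Union>j\<in>{0..L}. entering i j)"
  thus "z \<in> piece \<beta> n i" using in_piece[OF assms] by (auto simp: entering_def)
qed

lemma P_nonneg: assumes "i \<le> L" "j \<le> L" shows "0 \<le> P i j"
proof -
  obtain x where x: "x \<in> J" "idx x = i" using assms(1) by (rule idx_surj)
  show ?thesis
  proof (cases "sw x")
    case True
    thus ?thesis using P_switch_index[OF x(1) True x(2)] p_gt_0 p_less_1 by auto
  next
    case False
    thus ?thesis using P_eq_entering[OF x(1) False x(2) assms(2)] len_pos[OF assms(1)] by simp
  qed
qed

lemma P_row_sum: assumes "i \<le> L" shows "(\<Sum>j\<in>{0..L}. P i j) = 1"
proof -
  obtain x where x: "x \<in> J" "idx x = i" using assms by (rule idx_surj)
  show ?thesis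
  proof (cases "sw x")
    case True
    have "(\<Sum>j\<in>{0..L}. P i j) = (\<Sum>j\<in>{0..L}. (if j = 0 then p else 0) + (if j = L then 1 - p else 0))"
      using P_switch_index[OF x(1) True x(2)] L_ne_0 by (intro sum.cong) auto
    thus ?thesis by (simp add: sum.distrib)
  next
    case False
    have fin: "emeasure lborel (entering i j) \<noteq> \<infinity>" for j
    proof -
      have "emeasure lborel (entering i j) \<le> emeasure lborel J"
        by (intro emeasure_mono) (auto simp: entering_def)
      also have "\<dots> < \<infinity>" by (simp add: J_int_def emeasure_lborel_Icc_eq)
      finally show ?thesis by simp
    qed
    have "(\<Sum>j\<in>{0..L}. measure lborel (entering i j)) = measure lborel (\<Union>j\<in>{0..L}. entering i j)"
    proof (rule measure_finite_Union[symmetric])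
      show "disjoint_family_on (entering i) {0..L}"
        unfolding disjoint_family_on_def entering_def by blast
      show "entering i ` {0..L} \<subseteq> sets lborel" using entering_sets by auto
      show "emeasure lborel (entering i j) \<noteq> \<infinity>" for j by (rule fin)
    qed simp
    also have "\<dots> = len i" by (simp only: len_def piece_eq_UN_entering[OF assms])
    finally have "(\<Sum>j\<in>{0..L}. measure lborel (entering i j)) = len i" .
    moreover have "(\<Sum>j\<in>{0..L}. P i j) = (\<Sum>j\<in>{0..L}. measure lborel (entering i j) / len i)"
      using P_eq_entering[OF x(1) False x(2)] by (intro sum.cong) auto
    ultimately show ?thesis using len_pos[OF assms] by (simp flip: sum_divide_distrib)
  qed
qed

sublocale chain: stochastic_matrix "{0..L}" P
  by unfold_locales (auto simp: P_nonneg P_row_sum)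

text \<open>A transition made by one point has positive probability since it involves an entire
  inverse image. This links closed sets of states to \<open>T\<close>-invariant unions of
  pieces.\<close>

lemma P_idx_T_pos: assumes "x \<in> J" "\<not> sw x" shows "0 < P (idx x) (idx (T x))"
proof -
  have i: "idx x \<le> L" and j: "idx (T x) \<le> L" using idx_le assms T_in_J by auto
  have "x \<in> entering (idx x) (idx (T x))" using assms by (simp add: entering_def)
  hence "len (idx x) * P (idx x) (idx (T x)) / len (idx (T x)) = 1 / \<beta>"
    using P_eq_index[OF assms refl j] by auto
  hence "len (idx x) * P (idx x) (idx (T x)) \<noteq> 0" by auto
  thus ?thesis using P_nonneg[OF i j] by (auto simp: less_le)
qed

text \<open>Otherwise the union of the pieces indexed by D would be \<open>T\<close>-invariant,
  avoid the switch regions and contain an interval, against expansion.\<close>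

lemma closed_set_switch:
  assumes "chain.closed_set D"
  obtains x where "x \<in> J" "sw x" "idx x \<in> D"
proof (rule ccontr)
  assume "\<not> thesis"
  hence no: "\<not> sw x" if "x \<in> J" "idx x \<in> D" for x using that \<open>\<And>x. x \<in> J \<Longrightarrow> sw x \<Longrightarrow> idx x \<in> D \<Longrightarrow> thesis\<close> by blast
  define V where "V = {x\<in>J. idx x \<in> D}"
  have TV: "T x \<in> V" if "x \<in> V" for x
  proof -
    have x: "x \<in> J" "idx x \<in> D" "\<not> sw x" using that no by (auto simp: V_def)
    have "idx (T x) \<in> {0..L}" using idx_le[OF T_in_J[OF x(1)]] by simp
    hence "idx (T x) \<in> D" using assms P_idx_T_pos[OF x(1,3)] x unfolding chain.closed_set_def by blast
    thus ?thesis using T_in_J[OF x(1)] by (simp add: V_def)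
  qed
  have "D \<noteq> {}" "D \<subseteq> {0..L}" using assms by (auto simp: chain.closed_set_def)
  then obtain i where "i \<in> D" "i \<in> {0..L}" by blast
  hence i: "i \<in> D" "i \<le> L" by simp_all
  obtain x where x: "x \<in> J" "idx x = i" using i(2) by (rule idx_surj)
  obtain l h where lh: "l < h" "{l<..<h} \<subseteq> {y\<in>J. eqv x y}"
    using eqv_contains_interval[OF x(1)] by auto
  obtain c where c: "l < c" "c < h" using dense[OF lh(1)] by auto
  obtain d where d: "c < d" "d < h" using dense[OF c(2)] by auto
  have "{c..d} \<subseteq> V"
  proof
    fix y assume "y \<in> {c..d}"
    hence "y \<in> {l<..<h}" using c d by auto
    hence y: "y \<in> J" "eqv x y" using lh(2) by blast+
    thus "y \<in> V" using idx_eq_iff[OF x(1) y(1)] x i by (simp add: V_def)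
  qed
  moreover have "V \<subseteq> J" "\<And>x. x \<in> V \<Longrightarrow> \<not> sw x" using no by (auto simp: V_def)
  ultimately show False using no_invariant_interval[of V c d] TV d by blast
qed

text \<open>A closed set contains a switch state, and from there the chain jumps to 0 with
  probability p > 0.\<close>

lemma closed_set_0: assumes "chain.closed_set D" shows "0 \<in> D"
proof -
  obtain x where x: "x \<in> J" "sw x" "idx x \<in> D" using assms by (rule closed_set_switch)
  have "P (idx x) 0 = p" using P_switch_index[OF x(1,2) refl] by simp
  thus ?thesis using assms x(3) p_gt_0 by (auto simp: chain.closed_set_def)
qed

abbreviation "\<pi> \<equiv> stationary \<beta> n p"

lemma set_stationary: "set_pmf \<pi> \<subseteq> {0..L}"
proof -
  have zero: "0 \<in> {0..L}" unfolding atLeastAtMost_iff by (intro conjI le0)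
  have "\<exists>!q. set_pmf q \<subseteq> {0..L} \<and> (\<forall>j\<in>{0..L}. (\<Sum>i\<in>{0..L}. pmf q i * P i j) = pmf q j)"
    by (rule chain.ex1_stationary_pmf[OF closed_set_0 zero])
  from theI'[OF this, THEN conjunct1] show ?thesis unfolding stationary_def .
qed

lemma sum_stationary: "(\<Sum>i\<in>{0..L}. pmf \<pi> i) = 1"
  by (rule sum_pmf_eq_1) (use set_stationary in auto)

subsection \<open>The coding of the random map\<close>

definition code :: "(nat \<Rightarrow> bool) \<times> real \<Rightarrow> nat \<Rightarrow> nat" where
  "code z i = idx (snd ((step ^^ i) z))"

lemma code_0: "code z 0 = idx (snd z)" and code_Suc: "code z (Suc i) = code (step z) i"
  by (simp_all add: code_def funpow_swap1)

lemma orbit_in_J: "snd z \<in> J \<Longrightarrow> snd ((step ^^ i) z) \<in> J"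
  by (induction i) (auto simp: step_in_J)

lemma code_le: "snd z \<in> J \<Longrightarrow> code z i \<le> L"
  by (simp add: code_def idx_le orbit_in_J)

text \<open>After a switch region the orbit is in the first or last piece; elsewhere
  \<open>T_inverse\<close> shows that the image of the current piece covers the next one, as the
  matrix demands.\<close>

lemma adjacency_step:
  assumes "snd z \<in> J"
  shows "adjacency \<beta> n (idx (snd z)) (idx (snd (step z))) = 1"
proof (cases "sw (snd z)")
  case True
  have "snd (step z) \<le> u - 1 \<or> 1 \<le> snd (step z)"
    using T_sw[OF assms True] True by (simp add: step_def)
  hence "idx (snd (step z)) = 0 \<or> idx (snd (step z)) = L"
    using idx_eq_0_iff[OF step_in_J[OF assms]] idx_eq_L_iff[OF step_in_J[OF assms]] by blast
  thus ?thesis using idx_in_eq_indices[OF assms] True unfolding adjacency_def by simp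
next
  case False
  let ?x = "snd z"
  let ?i = "idx ?x" and ?j = "idx (T ?x)"
  have i: "?i \<le> L" and j: "?j \<le> L" using idx_le[OF assms] idx_le[OF T_in_J[OF assms]] .
  have "piece \<beta> n ?j \<subseteq> T ` piece \<beta> n ?i"
  proof
    fix y assume "y \<in> piece \<beta> n ?j"
    hence y: "y \<in> J" "idx y = ?j" using in_piece[OF j] by auto
    hence "eqv (T ?x) y" using idx_eq_iff[OF T_in_J[OF assms] y(1)] by simp
    note inv = T_inverse[OF assms False y(1) this]
    define x' where "x' = (y + real (ld ?x)) / \<beta>"
    have x': "x' \<in> J" "eqv ?x x'" "T x' = y" using inv by (simp_all add: x'_def)
    hence "x' \<in> piece \<beta> n ?i" using in_piece[OF i, of x'] idx_eq_iff[OF assms x'(1)] by simp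
    thus "y \<in> T ` piece \<beta> n ?i" using x'(3) by blast
  qed
  hence "piece \<beta> n ?j \<inter> T ` piece \<beta> n ?i = piece \<beta> n ?j" by blast
  moreover have "snd (step z) = T ?x" using False by (simp add: step_def)
  ultimately show ?thesis using idx_in_eq_indices[OF assms] False by (simp add: adjacency_def)
qed

lemma code_in_Y: assumes "snd z \<in> J" shows "code z \<in> Y_seqs \<beta> n"
proof -
  have "adjacency \<beta> n (code z i) (code z (Suc i)) = 1" for i
    using adjacency_step[OF orbit_in_J[OF assms, of i]] by (simp add: code_def)
  thus ?thesis using code_le[OF assms] by (simp add: Y_seqs_def)
qed

lemma orbit_measurable: "(step ^^ i) \<in> rho \<rightarrow>\<^sub>M rho"
  by (induction i) (auto intro!: measurable_comp[OF _ step_measurable] simp: id_def)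

lemma code_coord_measurable: "(\<lambda>z. code z i) \<in> rho \<rightarrow>\<^sub>M count_space {0..L}"
  unfolding code_def
  by (rule measurable_compose[OF measurable_compose[OF orbit_measurable measurable_snd] idx_measurable])

lemma code_measurable: "code \<in> rho \<rightarrow>\<^sub>M Y_space \<beta> n"
  unfolding Y_space_def
proof (rule measurable_restrict_space2)
  show "code \<in> space rho \<rightarrow> Y_seqs \<beta> n" using code_in_Y by (auto simp: space_rho)
  show "code \<in> rho \<rightarrow>\<^sub>M (\<Pi>\<^sub>M i\<in>UNIV. count_space {0..L})"
  proof (rule measurable_PiM_single')
    fix i :: nat
    show "(\<lambda>z. code z i) \<in> rho \<rightarrow>\<^sub>M count_space {0..L}" by (rule code_coord_measurable)
  qed (use code_le in \<open>auto simp: space_rho\<close>)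
qed

definition cylinder :: "(nat \<Rightarrow> nat) \<Rightarrow> nat \<Rightarrow> ((nat \<Rightarrow> bool) \<times> real) set" where
  "cylinder w m = {z\<in>space rho. \<forall>i\<le>m. code z i = w i}"

lemma cylinder_sets: "cylinder w m \<in> sets rho"
proof -
  have "{z\<in>space rho. code z i = w i} \<in> sets rho" for i
  proof -
    have "(\<lambda>z. code z i) -` ({w i} \<inter> {0..L}) \<inter> space rho \<in> sets rho"
      by (rule measurable_sets[OF code_coord_measurable]) auto
    also have "(\<lambda>z. code z i) -` ({w i} \<inter> {0..L}) \<inter> space rho = {z\<in>space rho. code z i = w i}"
    proof (intro equalityI subsetI)
      fix z assume "z \<in> {z\<in>space rho. code z i = w i}"
      moreover from this have "code z i \<le> L" using code_le[of z i] by (auto simp: space_rho)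
      ultimately show "z \<in> (\<lambda>z. code z i) -` ({w i} \<inter> {0..L}) \<inter> space rho" by simp
    qed simp
    finally show ?thesis .
  qed
  hence "(\<Inter>i\<in>{..m}. {z\<in>space rho. code z i = w i}) \<in> sets rho" by (intro sets.finite_INT) auto
  also have "(\<Inter>i\<in>{..m}. {z\<in>space rho. code z i = w i}) = cylinder w m"
    by (auto simp: cylinder_def)
  finally show ?thesis .
qed

lemma emeasure_idx_cell:
  assumes "i \<le> L" shows "emeasure rho {z\<in>space rho. idx (snd z) = i} = ennreal (len i)"
proof -
  have "Pair \<omega> -` {z\<in>space rho. idx (snd z) = i} = piece \<beta> n i" for \<omega>
    using in_piece[OF assms] by (auto simp: space_rho)
  thus ?thesis using emeasure_rho[OF idx_snd_sets] emeasure_piece[OF assms]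
    by (simp add: bern.emeasure_space_1[unfolded space_bern])
qed

text \<open>Induction by splitting off the first symbol with \<open>emeasure_step_vimage\<close>;
  the quotients of lengths telescope and leave that of the initial piece.\<close>

lemma emeasure_cylinder:
  assumes "\<forall>i. w i \<le> L"
  shows "emeasure rho (cylinder w m) = ennreal (len (w 0) * (\<Prod>i<m. P (w i) (w (Suc i))))"
  using assms
proof (induction m arbitrary: w)
  case 0
  have "cylinder w 0 = {z\<in>space rho. idx (snd z) = w 0}" by (auto simp: cylinder_def code_0)
  thus ?case using emeasure_idx_cell 0 by simp
next
  case (Suc m)
  let ?w = "\<lambda>i. w (Suc i)"
  have w: "w 0 \<le> L" "w 1 \<le> L" using Suc.prems by auto
  have st: "step z \<in> space rho" if "z \<in> space rho" for z
    using measurable_space[OF step_measurable that] .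
  have "cylinder w (Suc m) = {z \<in> space rho. idx (snd z) = w 0 \<and> step z \<in> cylinder ?w m}"
  proof (intro equalityI subsetI)
    fix z assume z: "z \<in> cylinder w (Suc m)"
    hence "code (step z) i = w (Suc i)" if "i \<le> m" for i
      using that code_Suc[of z i] by (auto simp: cylinder_def)
    thus "z \<in> {z \<in> space rho. idx (snd z) = w 0 \<and> step z \<in> cylinder ?w m}"
      using z st[of z] code_0[of z] by (auto simp: cylinder_def)
  next
    fix z assume z: "z \<in> {z \<in> space rho. idx (snd z) = w 0 \<and> step z \<in> cylinder ?w m}"
    have "code z i = w i" if "i \<le> Suc m" for i
      using that z code_0[of z] code_Suc[of z] by (cases i) (auto simp: cylinder_def)
    thus "z \<in> cylinder w (Suc m)" using z by (auto simp: cylinder_def)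
  qed
  also have "emeasure rho \<dots> = ennreal (len (w 0) * P (w 0) (w 1) / len (w 1)) * emeasure rho (cylinder ?w m)"
  proof (rule emeasure_step_vimage[OF w cylinder_sets])
    fix z assume "z \<in> cylinder ?w m"
    hence "code z 0 = w (Suc 0)" unfolding cylinder_def by blast
    thus "idx (snd z) = w 1" by (simp add: code_0)
  qed
  also have "\<dots> = ennreal (len (w 0) * P (w 0) (w 1) / len (w 1)) *
      ennreal (len (w 1) * (\<Prod>i<m. P (w (Suc i)) (w (Suc (Suc i)))))"
    using Suc.IH[of ?w] Suc.prems by simp
  also have "\<dots> = ennreal (len (w 0) * P (w 0) (w 1) / len (w 1) *
      (len (w 1) * (\<Prod>i<m. P (w (Suc i)) (w (Suc (Suc i))))))"
  proof (rule ennreal_mult[symmetric])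
    show "0 \<le> len (w 0) * P (w 0) (w 1) / len (w 1)"
      using len_pos[OF w(1)] len_pos[OF w(2)] P_nonneg[OF w] by simp
    have "0 \<le> (\<Prod>i<m. P (w (Suc i)) (w (Suc (Suc i))))"
      using Suc.prems by (intro prod_nonneg P_nonneg ballI) blast+
    thus "0 \<le> len (w 1) * (\<Prod>i<m. P (w (Suc i)) (w (Suc (Suc i))))"
      using len_pos[OF w(2)] by simp
  qed
  also have "len (w 0) * P (w 0) (w 1) / len (w 1) * (len (w 1) * (\<Prod>i<m. P (w (Suc i)) (w (Suc (Suc i)))))
     = len (w 0) * (\<Prod>i<Suc m. P (w i) (w (Suc i)))"
    using len_pos[OF w(2)] by (subst prod.lessThan_Suc_shift) simp
  finally show ?case .
qed

section \<open>The product law with stationary weights on the pieces\<close>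

definition mu :: "real measure" where
  "mu = density JM (\<lambda>x. ennreal (pmf \<pi> (idx x) / len (idx x)))"

abbreviation "nu \<equiv> bern \<Otimes>\<^sub>M mu"

abbreviation "cell i \<equiv> {z\<in>space rho. idx (snd z) = i}"

lemma sets_mu: "sets mu = sets JM" and space_mu: "space mu = J"
  by (simp_all add: mu_def)

lemma sets_nu: "sets nu = sets rho"
  by (rule sets_pair_measure_cong[OF refl sets_mu])

lemma emeasure_mu_piece:
  assumes "X \<in> sets JM" "\<And>x. x \<in> X \<Longrightarrow> idx x = i"
  shows "emeasure mu X = ennreal (pmf \<pi> i / len i) * emeasure JM X"
proof -
  have f: "(\<lambda>x. ennreal (pmf \<pi> (idx x) / len (idx x))) \<in> borel_measurable JM"
    by (rule measurable_compose[OF idx_measurable]) simp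
  have "emeasure mu X = (\<integral>\<^sup>+x. ennreal (pmf \<pi> (idx x) / len (idx x)) * indicator X x \<partial>JM)"
    unfolding mu_def by (rule emeasure_density[OF f assms(1)])
  also have "\<dots> = (\<integral>\<^sup>+x. ennreal (pmf \<pi> i / len i) * indicator X x \<partial>JM)"
    by (intro nn_integral_cong) (auto simp: indicator_def assms(2))
  also have "\<dots> = ennreal (pmf \<pi> i / len i) * emeasure JM X"
    by (rule nn_integral_cmult_indicator[OF assms(1)])
  finally show ?thesis .
qed

lemma prob_space_mu: "prob_space mu"
proof
  have J: "J = (\<Union>i\<in>{0..L}. piece \<beta> n i)"
  proof (intro equalityI subsetI)
    fix x assume x: "x \<in> J"
    hence "x \<in> piece \<beta> n (idx x)" using in_piece[OF idx_le[OF x]] by blast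
    moreover have "idx x \<in> {0..L}" using idx_le[OF x] by simp
    ultimately show "x \<in> (\<Union>i\<in>{0..L}. piece \<beta> n i)" by blast
  next
    fix x assume "x \<in> (\<Union>i\<in>{0..L}. piece \<beta> n i)"
    then obtain i where "i \<le> L" "x \<in> piece \<beta> n i" by auto
    thus "x \<in> J" using piece_sets(2) by blast
  qed
  have "emeasure mu (space mu) = emeasure mu (\<Union>i\<in>{0..L}. piece \<beta> n i)"
    using J by (simp add: space_mu)
  also have "\<dots> = (\<Sum>i\<in>{0..L}. emeasure mu (piece \<beta> n i))"
  proof (rule sum_emeasure[symmetric])
    show "piece \<beta> n ` {0..L} \<subseteq> sets mu" using piece_sets by (auto simp: sets_mu sets_JM_iff)
    have "piece \<beta> n i \<inter> piece \<beta> n j = {}" if "i \<le> L" "j \<le> L" "i \<noteq> j" for i j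
      using that by (auto simp: in_piece)
    thus "disjoint_family_on (piece \<beta> n) {0..L}" by (simp add: disjoint_family_on_def)
  qed simp
  also have "\<dots> = (\<Sum>i\<in>{0..L}. ennreal (pmf \<pi> i))"
  proof (rule sum.cong[OF refl])
    fix i assume "i \<in> {0..L}"
    hence i: "i \<le> L" by simp
    have s: "piece \<beta> n i \<in> sets JM" using piece_sets[OF i] by (simp add: sets_JM_iff)
    have "emeasure mu (piece \<beta> n i) = ennreal (pmf \<pi> i / len i) * ennreal (len i)"
      using emeasure_mu_piece[OF s, of i] in_piece[OF i] emeasure_JM[OF s] emeasure_piece[OF i] by simp
    also have "\<dots> = ennreal (pmf \<pi> i)"
      using len_pos[OF i] by (subst ennreal_mult[symmetric]) auto
    finally show "emeasure mu (piece \<beta> n i) = ennreal (pmf \<pi> i)" .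
  qed
  also have "\<dots> = 1" by (simp add: sum_ennreal sum_stationary)
  finally show "emeasure mu (space mu) = 1" .
qed

sublocale mu: prob_space mu by (rule prob_space_mu)

lemma prob_space_nu: "prob_space nu"
proof -
  interpret pair_prob_space bern mu ..
  show ?thesis by unfold_locales
qed

sublocale nu: prob_space nu by (rule prob_space_nu)

text \<open>On each cell \<open>nu\<close> is a constant multiple of \<open>rho\<close>, so all
  computations made with Lebesgue measure transfer.\<close>

lemma emeasure_nu_cell:
  assumes X: "X \<in> sets rho" and i: "\<And>z. z \<in> X \<Longrightarrow> idx (snd z) = i"
  shows "emeasure nu X = ennreal (pmf \<pi> i / len i) * emeasure rho X"
proof -
  have "emeasure nu X = (\<integral>\<^sup>+\<omega>. emeasure mu (Pair \<omega> -` X) \<partial>bern)"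
    using X by (intro mu.emeasure_pair_measure_alt) (simp add: sets_nu)
  also have "\<dots> = (\<integral>\<^sup>+\<omega>. ennreal (pmf \<pi> i / len i) * emeasure JM (Pair \<omega> -` X) \<partial>bern)"
    by (intro nn_integral_cong emeasure_mu_piece sets_Pair1[OF X]) (auto dest: i)
  also have "\<dots> = ennreal (pmf \<pi> i / len i) * (\<integral>\<^sup>+\<omega>. emeasure JM (Pair \<omega> -` X) \<partial>bern)"
    by (rule nn_integral_cmult[OF JM.measurable_emeasure_Pair[OF X]])
  also have "(\<integral>\<^sup>+\<omega>. emeasure JM (Pair \<omega> -` X) \<partial>bern) = emeasure rho X"
    by (rule JM.emeasure_pair_measure_alt[OF X, symmetric])
  finally show ?thesis .
qed

lemma UN_cells:
  assumes "X \<in> sets rho" shows "X = (\<Union>i\<in>{0..L}. X \<inter> cell i)"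
proof -
  have "idx (snd z) \<in> {0..L}" "z \<in> space rho" if "z \<in> X" for z
    using sets.sets_into_space[OF assms] that idx_le[of "snd z"] by (auto simp: space_rho)
  thus ?thesis by blast
qed

lemma null_sets_nu: assumes "X \<in> null_sets rho" shows "X \<in> null_sets nu"
proof -
  have X: "X \<in> sets rho" using assms by blast
  have "X \<inter> cell i \<in> null_sets nu" for i
  proof -
    have s: "X \<inter> cell i \<in> sets rho" using X idx_snd_sets by (rule sets.Int)
    have "X \<inter> cell i \<in> null_sets rho" by (rule null_set_Int2[OF assms idx_snd_sets])
    hence "emeasure rho (X \<inter> cell i) = 0" by blast
    hence "emeasure nu (X \<inter> cell i) = 0" using emeasure_nu_cell[OF s, of i] by simp
    thus ?thesis using s by (simp add: null_sets_def sets_nu)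
  qed
  hence "(\<Union>i\<in>{0..L}. X \<inter> cell i) \<in> null_sets nu" by (intro null_sets.finite_UN) auto
  thus ?thesis using UN_cells[OF X] by simp
qed

subsection \<open>Recurrence of the switch regions\<close>

lemma finite_measure_rho: "finite_measure rho"
proof
  have "Pair \<omega> -` space rho = J" for \<omega> by (auto simp: space_rho)
  hence "emeasure rho (space rho) = emeasure lborel J * emeasure bern (space bern)"
    by (simp add: emeasure_rho[OF sets.top])
  also have "\<dots> \<noteq> \<infinity>" by (simp only: bern.emeasure_space_1 mult_1_right)
      (simp add: J_int_def emeasure_lborel_Icc_eq)
  finally show "emeasure rho (space rho) \<noteq> \<infinity>" .
qed

sublocale rho: finite_measure rho by (rule finite_measure_rho)

text \<open>Extends the one-step formula from sets over one target piece to arbitrary sets, in real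
  numbers as the maximum principle requires.\<close>

lemma measure_step_vimage:
  assumes i: "i \<le> L" and X: "X \<in> sets rho"
  shows "measure rho {z\<in>space rho. idx (snd z) = i \<and> step z \<in> X} =
    (\<Sum>j\<in>{0..L}. len i * P i j / len j * measure rho (X \<inter> cell j))"
proof -
  let ?A = "\<lambda>j. {z\<in>space rho. idx (snd z) = i \<and> step z \<in> X \<inter> cell j}"
  have s: "X \<inter> cell j \<in> sets rho" for j using X idx_snd_sets by (rule sets.Int)
  have "{z\<in>space rho. idx (snd z) = i \<and> step z \<in> X} = (\<Union>j\<in>{0..L}. ?A j)"
  proof (intro equalityI subsetI)
    fix z assume z: "z \<in> {z\<in>space rho. idx (snd z) = i \<and> step z \<in> X}"
    hence "step z \<in> (\<Union>j\<in>{0..L}. X \<inter> cell j)" by (subst UN_cells[OF X, symmetric]) simp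
    thus "z \<in> (\<Union>j\<in>{0..L}. ?A j)" using z by simp
  qed blast
  also have "measure rho \<dots> = (\<Sum>j\<in>{0..L}. measure rho (?A j))"
  proof (rule rho.finite_measure_finite_Union)
    show "finite {0..L}" by (rule finite_atLeastAtMost)
    show "?A ` {0..L} \<subseteq> sets rho" using trans_set_sets[OF s] by (intro image_subsetI)
    show "disjoint_family_on ?A {0..L}" unfolding disjoint_family_on_def
    proof (intro ballI impI)
      fix a b :: nat assume "a \<noteq> b"
      have False if "z \<in> ?A a" "z \<in> ?A b" for z
        using that \<open>a \<noteq> b\<close> by (simp only: mem_Collect_eq Int_iff simp_thms)
      thus "?A a \<inter> ?A b = {}" by (meson disjoint_iff)
    qed
  qed
  also have "\<dots> = (\<Sum>j\<in>{0..L}. len i * P i j / len j * measure rho (X \<inter> cell j))"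
  proof (rule sum.cong[OF refl])
    fix j assume "j \<in> {0..L}"
    hence j: "j \<le> L" by simp
    have nn: "0 \<le> len i * P i j / len j" using len_pos[OF i] len_pos[OF j] P_nonneg[OF i j] by simp
    have "emeasure rho (?A j) = ennreal (len i * P i j / len j) * emeasure rho (X \<inter> cell j)"
      by (rule emeasure_step_vimage[OF i j s]) blast
    hence "measure rho (?A j) = enn2real (ennreal (len i * P i j / len j) * emeasure rho (X \<inter> cell j))"
      unfolding measure_def by (rule arg_cong)
    thus "measure rho (?A j) = len i * P i j / len j * measure rho (X \<inter> cell j)"
      unfolding measure_def enn2real_mult enn2real_ennreal[OF nn] .
  qed
  finally show ?thesis .
qed

lemma null_sets_step:
  assumes "X \<in> null_sets rho" shows "step -` X \<inter> space rho \<in> null_sets rho"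
proof -
  have X: "X \<in> sets rho" using assms by blast
  have s: "step -` X \<inter> space rho \<in> sets rho" by (rule measurable_sets[OF step_measurable X])
  have "(step -` X \<inter> space rho) \<inter> cell i \<in> null_sets rho" if i: "i \<le> L" for i
  proof -
    have "measure rho (X \<inter> cell j) = 0" for j
      using null_set_Int2[OF assms idx_snd_sets, of j] by (simp add: measure_def null_sets_def)
    hence "measure rho {z\<in>space rho. idx (snd z) = i \<and> step z \<in> X} = 0"
      using measure_step_vimage[OF i X] by simp
    moreover have "(step -` X \<inter> space rho) \<inter> cell i = {z\<in>space rho. idx (snd z) = i \<and> step z \<in> X}"
      by blast
    ultimately show ?thesis using trans_set_sets[OF X, of i]
      by (simp add: null_sets_def rho.emeasure_eq_measure)
  qed
  hence "(\<Union>i\<in>{0..L}. (step -` X \<inter> space rho) \<inter> cell i) \<in> null_sets rho"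
    by (intro null_sets.finite_UN) auto
  thus ?thesis using UN_cells[OF s] by simp
qed

lemma sw_orbit_sets: "{z\<in>space rho. sw (snd ((step ^^ i) z))} \<in> sets rho"
  using measurable_compose[OF measurable_compose[OF orbit_measurable measurable_snd] pred_sw]
  by (rule predE)

text \<open>The probability of never switching, as a function of the starting piece, vanishes at
  switch states and is harmonic elsewhere. Every closed set contains a switch state, so the maximum
  principle makes it zero.\<close>

lemma never_switching_null: "{z\<in>space rho. \<forall>i. \<not> sw (snd ((step ^^ i) z))} \<in> null_sets rho"
proof -
  let ?H = "{z\<in>space rho. \<forall>i. \<not> sw (snd ((step ^^ i) z))}"
  have "?H = space rho - (\<Union>i. {z\<in>space rho. sw (snd ((step ^^ i) z))})"
    by (rule set_eqI) (simp only: mem_Collect_eq Diff_iff UN_iff bex_UNIV, metis)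
  moreover have "range (\<lambda>i. {z\<in>space rho. sw (snd ((step ^^ i) z))}) \<subseteq> sets rho"
    using sw_orbit_sets by (rule image_subsetI)
  ultimately have H: "?H \<in> sets rho"
    by (simp only: sets.Diff[OF sets.top sets.countable_UN])
  \<comment> \<open>Conditional probability of never switching from a uniform point of piece i with
    Bernoulli coins.\<close>
  define h where "h i = measure rho (?H \<inter> cell i) / len i" for i
  define Z where "Z = {idx x |x. x \<in> J \<and> sw x}"
  have swZ: "sw (snd z) \<longleftrightarrow> i \<in> Z" if "z \<in> cell i" for z i
  proof
    assume "sw (snd z)" thus "i \<in> Z" using that by (auto simp: Z_def space_rho)
  next
    assume "i \<in> Z"
    then obtain x where x: "x \<in> J" "sw x" "idx x = i" by (auto simp: Z_def)
    have z: "snd z \<in> J" "idx (snd z) = i" using that by (auto simp: space_rho)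
    have "eqv x (snd z)" using idx_eq_iff[OF x(1) z(1)] x z by simp
    thus "sw (snd z)" using eqv_imp_ld(2)[OF x(1) z(1)] x by simp
  qed
  have "h i = 0" if "i \<in> {0..L}" for i
  proof (rule chain.harmonic_eq_0[of Z h, OF _ _ _ _ that])
    fix D assume "chain.closed_set D"
    then obtain x where "x \<in> J" "sw x" "idx x \<in> D" by (rule closed_set_switch)
    thus "D \<inter> Z \<noteq> {}" by (auto simp: Z_def)
  next
    fix i assume "i \<in> {0..L}" thus "0 \<le> h i" by (simp add: h_def len_def)
  next
    fix i assume i: "i \<in> {0..L} \<inter> Z"
    have "?H \<inter> cell i = {}"
    proof (rule ccontr)
      assume "?H \<inter> cell i \<noteq> {}"
      then obtain z where z: "z \<in> cell i" "\<forall>i. \<not> sw (snd ((step ^^ i) z))" by blast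
      show False using swZ[OF z(1)] spec[OF z(2), of 0] i by simp
    qed
    thus "h i = 0" by (simp only: h_def measure_empty div_0)
  next
    fix i assume i: "i \<in> {0..L} - Z"
    hence iL: "i \<le> L" by simp
    have "?H \<inter> cell i = {z\<in>space rho. idx (snd z) = i \<and> step z \<in> ?H}"
    proof (intro equalityI subsetI)
      fix z assume z: "z \<in> ?H \<inter> cell i"
      hence "\<not> sw (snd ((step ^^ k) (step z)))" for k
        using spec[of "\<lambda>i. \<not> sw (snd ((step ^^ i) z))" "Suc k"] by (simp add: funpow_swap1)
      moreover have "step z \<in> space rho" using z measurable_space[OF step_measurable] by blast
      ultimately show "z \<in> {z\<in>space rho. idx (snd z) = i \<and> step z \<in> ?H}" using z by blast
    next
      fix z assume z: "z \<in> {z\<in>space rho. idx (snd z) = i \<and> step z \<in> ?H}"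
      hence zc: "z \<in> cell i" by blast
      have "\<not> sw (snd ((step ^^ k) z))" for k
      proof (cases k)
        case 0 thus ?thesis using swZ[OF zc] i by simp
      next
        case (Suc k') 
        have "\<not> sw (snd ((step ^^ k') (step z)))" using z by blast
        thus ?thesis using Suc by (simp add: funpow_swap1)
      qed
      thus "z \<in> ?H \<inter> cell i" using zc by blast
    qed
    hence "measure rho (?H \<inter> cell i) = (\<Sum>j\<in>{0..L}. len i * P i j / len j * measure rho (?H \<inter> cell j))"
      using measure_step_vimage[OF iL H] by simp
    also have "\<dots> = len i * (\<Sum>j\<in>{0..L}. P i j * h j)"
      by (simp add: sum_distrib_left h_def mult.assoc)
    finally show "h i = (\<Sum>j\<in>{0..L}. P i j * h j)" using len_pos[OF iL] by (simp add: h_def)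
  qed
  note h0 = this
  have "?H \<inter> cell i \<in> null_sets rho" if "i \<in> {0..L}" for i
  proof -
    have "measure rho (?H \<inter> cell i) = 0" using h0[OF that] len_pos[of i] that by (simp add: h_def)
    hence "emeasure rho (?H \<inter> cell i) = 0" by (subst rho.emeasure_eq_measure) (simp only: ennreal_0)
    thus ?thesis using sets.Int[OF H idx_snd_sets] by (rule null_setsI)
  qed
  hence "(\<Union>i\<in>{0..L}. ?H \<inter> cell i) \<in> null_sets rho" by (intro null_sets.finite_UN) auto
  thus ?thesis using UN_cells[OF H] by simp
qed

text \<open>Switching finitely often means that some iterate never switches. Preimages of null sets
  under \<open>step\<close> are null, so a countable union suffices.\<close>

lemma finitely_switching_null:
  "{z\<in>space rho. finite {i. sw (snd ((step ^^ i) z))}} \<in> null_sets nu"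
proof -
  let ?H = "{z\<in>space rho. \<forall>i. \<not> sw (snd ((step ^^ i) z))}"
  have "(step ^^ m) -` ?H \<inter> space rho \<in> null_sets rho" for m
  proof (induction m)
    case 0
    have "(step ^^ 0) -` ?H \<inter> space rho = ?H" by auto
    thus ?case using never_switching_null by simp
  next
    case (Suc m)
    have "(step ^^ Suc m) -` ?H \<inter> space rho = step -` ((step ^^ m) -` ?H \<inter> space rho) \<inter> space rho"
      using measurable_space[OF step_measurable] by (auto simp: funpow_swap1)
    thus ?case using null_sets_step[OF Suc] by simp
  qed
  hence "(\<Union>m. (step ^^ m) -` ?H \<inter> space rho) \<in> null_sets rho" by (rule null_sets_UN)
  hence "(\<Union>m. (step ^^ m) -` ?H \<inter> space rho) \<in> null_sets nu" by (rule null_sets_nu)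
  moreover have "{z\<in>space rho. finite {i. sw (snd ((step ^^ i) z))}} = (\<Union>m. (step ^^ m) -` ?H \<inter> space rho)"
  proof (intro equalityI subsetI)
    fix z assume z: "z \<in> {z\<in>space rho. finite {i. sw (snd ((step ^^ i) z))}}"
    then obtain m where m: "\<And>i. sw (snd ((step ^^ i) z)) \<Longrightarrow> i < m"
      by (auto simp: finite_nat_set_iff_bounded)
    have "\<not> sw (snd ((step ^^ k) ((step ^^ m) z)))" for k
      using m[of "k + m"] by (auto simp: funpow_add)
    moreover have "(step ^^ m) z \<in> space rho" using z measurable_space[OF orbit_measurable] by blast
    ultimately show "z \<in> (\<Union>m. (step ^^ m) -` ?H \<inter> space rho)" using z by blast
  next
    fix z assume "z \<in> (\<Union>m. (step ^^ m) -` ?H \<inter> space rho)"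
    then obtain m where z: "z \<in> space rho" and m: "\<And>k. \<not> sw (snd ((step ^^ k) ((step ^^ m) z)))" by blast
    have "i < m" if "sw (snd ((step ^^ i) z))" for i
    proof (rule ccontr)
      assume "\<not> i < m"
      hence "(step ^^ i) z = (step ^^ (i - m)) ((step ^^ m) z)"
        by (simp flip: funpow_add[unfolded comp_def, THEN fun_cong])
      thus False using m[of "i - m"] that by simp
    qed
    hence "{i. sw (snd ((step ^^ i) z))} \<subseteq> {..<m}" by blast
    thus "z \<in> {z\<in>space rho. finite {i. sw (snd ((step ^^ i) z))}}" using z finite_subset by blast
  qed
  ultimately show ?thesis by simp
qed

subsection \<open>The coding map inverts the code\<close>

lemma switch_times_code:
  assumes "snd z \<in> J" shows "{i. code z i \<in> switch_indices \<beta> n} = {i. sw (snd ((step ^^ i) z))}"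
  using idx_in_switch_indices[OF orbit_in_J[OF assms]] by (simp add: code_def)

lemma step_sw:
  "sw (snd z) \<Longrightarrow> step z = (shift (fst z), if fst z 0 then T (snd z) else T (snd z) + 1)"
  and step_not_sw: "\<not> sw (snd z) \<Longrightarrow> step z = (fst z, T (snd z))"
  by (simp_all add: step_def)

text \<open>Coins are spent exactly at the visits to switch regions.\<close>
lemma fst_orbit:
  "fst ((step ^^ m) z) = (\<lambda>j. fst z (j + card {i. sw (snd ((step ^^ i) z)) \<and> i < m}))"
proof (induction m)
  case (Suc m)
  let ?S = "\<lambda>m. {i. sw (snd ((step ^^ i) z)) \<and> i < m}"
  have fin: "finite (?S m)" by simp
  show ?case
  proof (cases "sw (snd ((step ^^ m) z))")
    case True
    hence "?S (Suc m) = insert m (?S m)" by (auto simp: less_Suc_eq)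
    hence "card (?S (Suc m)) = Suc (card (?S m))" using fin by simp
    moreover have "fst ((step ^^ Suc m) z) = shift (fst ((step ^^ m) z))"
      using True by (simp add: step_sw)
    ultimately show ?thesis unfolding Suc by (simp add: shift_def[abs_def])
  next
    case False
    hence "?S (Suc m) = ?S m" by (auto simp: less_Suc_eq)
    moreover have "fst ((step ^^ Suc m) z) = fst ((step ^^ m) z)"
      using False by (simp add: step_not_sw)
    ultimately show ?thesis unfolding Suc by simp
  qed
qed simp

text \<open>The greedy image is at most u - 1 and the lazy one at least 1 > u - 1, so the next
  symbol shows the outcome of the coin.\<close>

lemma code_Suc_eq_0_iff:
  assumes "snd z \<in> J" "sw (snd ((step ^^ m) z))"
  shows "code z (Suc m) = 0 \<longleftrightarrow> fst ((step ^^ m) z) 0"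
proof -
  let ?y = "(step ^^ m) z"
  have J: "snd ?y \<in> J" by (rule orbit_in_J[OF assms(1)])
  have "code z (Suc m) = 0 \<longleftrightarrow> snd (step ?y) \<le> u - 1"
    using idx_eq_0_iff[OF step_in_J[OF J]] by (simp add: code_def)
  also have "\<dots> \<longleftrightarrow> fst ?y 0"
    using T_sw[OF J assms(2)] u_less_2 by (simp add: step_sw[OF assms(2)])
  finally show ?thesis .
qed

text \<open>Whichever branch is taken, the digit is the amount subtracted after multiplication by
  \<beta>; this makes the expansion series telescope.\<close>

lemma expansion_digit_code:
  assumes "snd z \<in> J"
  shows "real (expansion_digit \<beta> n (code z) j) = \<beta> * snd ((step ^^ j) z) - snd ((step ^^ Suc j) z)"
proof -
  let ?y = "(step ^^ j) z"
  have J: "snd ?y \<in> J" by (rule orbit_in_J[OF assms])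
  have e: "expansion_digit \<beta> n (code z) j =
      (if \<not> sw (snd ?y) \<or> code z (Suc j) = 0 then ld (snd ?y) else ld (snd ?y) - 1)"
    by (rule expansion_digit_idx[OF J]) (simp add: code_def)
  show ?thesis
  proof (cases "sw (snd ?y)")
    case False
    thus ?thesis unfolding e by (simp add: step_not_sw T_eq)
  next
    case True
    hence "1 \<le> ld (snd ?y)" by (simp add: sw_def)
    thus ?thesis unfolding e code_Suc_eq_0_iff[OF assms True] using True
      by (simp add: step_sw T_eq of_nat_diff)
  qed
qed

text \<open>The remainder after m terms is an orbit point divided by \<beta>^m, hence at most
  u/\<beta>^m.\<close>

lemma expansion_sums:
  assumes "snd z \<in> J"
  shows "(\<lambda>j. real (expansion_digit \<beta> n (code z) j) / \<beta> ^ Suc j) sums snd z"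
proof -
  let ?x = "\<lambda>j. snd ((step ^^ j) z)"
  have part: "(\<Sum>j<m. real (expansion_digit \<beta> n (code z) j) / \<beta> ^ Suc j) = snd z - ?x m / \<beta> ^ m" for m
  proof (induction m)
    case (Suc m)
    have "real (expansion_digit \<beta> n (code z) m) / \<beta> ^ Suc m = ?x m / \<beta> ^ m - ?x (Suc m) / \<beta> ^ Suc m"
      unfolding expansion_digit_code[OF assms] by (simp add: diff_divide_distrib)
    thus ?case using Suc by simp
  qed simp
  have "(\<lambda>m. ?x m / \<beta> ^ m) \<longlonglongrightarrow> 0"
  proof (rule Lim_null_comparison)
    show "\<forall>\<^sub>F m in sequentially. norm (?x m / \<beta> ^ m) \<le> u * (1 / \<beta>) ^ m"
    proof (intro always_eventually allI)
      fix m
      have "0 \<le> ?x m" "?x m \<le> u" using orbit_in_J[OF assms, of m] by (auto simp: in_J)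
      thus "norm (?x m / \<beta> ^ m) \<le> u * (1 / \<beta>) ^ m"
        by (simp add: power_one_over divide_right_mono)
    qed
    have "(\<lambda>m. (1 / \<beta>) ^ m) \<longlonglongrightarrow> 0" using beta_gt_1 by (intro LIMSEQ_realpow_zero) auto
    from tendsto_mult_right_zero[OF this] show "(\<lambda>m. u * (1 / \<beta>) ^ m) \<longlonglongrightarrow> 0" .
  qed
  hence "(\<lambda>m. snd z - ?x m / \<beta> ^ m) \<longlonglongrightarrow> snd z - 0" by (intro tendsto_diff tendsto_const)
  thus ?thesis unfolding sums_def part by simp
qed

text \<open>Before the j-th switch time, counted from 0, exactly j coins have been spent, so the
  coin read off there is coordinate j of the original sequence. Infinitely many switches recover all
  coordinates.\<close>

lemma psi_code:
  assumes "snd z \<in> J" "infinite {i. sw (snd ((step ^^ i) z))}"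
  shows "psi \<beta> n (code z) = z"
proof -
  let ?S = "{i. sw (snd ((step ^^ i) z))}"
  have "(code z (Suc (enumerate ?S j)) = 0) = fst z j" for j
  proof -
    define m where "m = enumerate ?S j"
    have m: "m \<in> ?S" "card {i\<in>?S. i < m} = j"
      using enumerate_eq_iff[OF assms(2), of j m] by (auto simp: m_def)
    have "code z (Suc m) = 0 \<longleftrightarrow> fst ((step ^^ m) z) 0"
      using m(1) by (intro code_Suc_eq_0_iff[OF assms(1)]) simp
    also have "\<dots> \<longleftrightarrow> fst z j" using m(2) by (simp add: fst_orbit)
    finally show ?thesis by (simp add: m_def)
  qed
  hence "fst (psi \<beta> n (code z)) = fst z"
    unfolding psi_def switch_times_code[OF assms(1)] by auto
  moreover have "snd (psi \<beta> n (code z)) = snd z"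
    using sums_unique[OF expansion_sums[OF assms(1)]] by (simp add: psi_def)
  ultimately show ?thesis by (simp add: prod_eq_iff)
qed

subsection \<open>The Markov measure\<close>

abbreviation "YC w m \<equiv> {y \<in> Y_seqs \<beta> n. \<forall>i\<le>m. y i = w i}"

lemma Y_le: "y \<in> Y_seqs \<beta> n \<Longrightarrow> y i \<le> L"
  by (simp add: Y_seqs_def)

lemma space_Y: "space (Y_space \<beta> n) = Y_seqs \<beta> n"
  unfolding Y_space_def space_restrict_space space_PiM by (auto simp: Y_seqs_def PiE_UNIV_domain)

lemma Y_coord: "(\<lambda>y. y i) \<in> Y_space \<beta> n \<rightarrow>\<^sub>M count_space UNIV"
proof -
  have "(\<lambda>y. y i) \<in> (\<Pi>\<^sub>M i\<in>UNIV. count_space {0..L}) \<rightarrow>\<^sub>M count_space {0..L}"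
    by (rule measurable_component_singleton) simp
  hence "(\<lambda>y. y i) \<in> Y_space \<beta> n \<rightarrow>\<^sub>M count_space {0..L}"
    unfolding Y_space_def by (rule measurable_restrict_space1)
  thus ?thesis by (rule measurable_compose) simp
qed

lemma YC_sets: "YC w m \<in> sets (Y_space \<beta> n)"
proof -
  have "(\<lambda>y. y i) -` {w i} \<inter> space (Y_space \<beta> n) \<in> sets (Y_space \<beta> n)" for i
    by (rule measurable_sets[OF Y_coord]) simp
  hence "(\<Inter>i\<in>{..m}. (\<lambda>y. y i) -` {w i} \<inter> space (Y_space \<beta> n)) \<in> sets (Y_space \<beta> n)"
    by (intro sets.finite_INT) auto
  also have "(\<Inter>i\<in>{..m}. (\<lambda>y. y i) -` {w i} \<inter> space (Y_space \<beta> n)) = YC w m"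
    by (auto simp: space_Y)
  finally show ?thesis .
qed

text \<open>The empty set is added to make the family closed under intersections. The bound concerns
  only the letters that the cylinder reads.\<close>

definition cyls :: "(nat \<Rightarrow> nat) set set" where
  "cyls = insert {} {YC w m |w m. \<forall>i\<le>m. w i \<le> L}"

lemma sets_Y_space: "sets (Y_space \<beta> n) = sigma_sets (Y_seqs \<beta> n) cyls"
proof
  have sub: "cyls \<subseteq> Pow (Y_seqs \<beta> n)" by (auto simp: cyls_def)
  let ?M = "sigma (Y_seqs \<beta> n) cyls"
  have sp: "space ?M = Y_seqs \<beta> n" and st: "sets ?M = sigma_sets (Y_seqs \<beta> n) cyls"
    using sub by auto
  have coord: "(\<lambda>y. y i) \<in> ?M \<rightarrow>\<^sub>M count_space {0..L}" for i
  proof (subst measurable_count_space_eq2, simp, intro conjI ballI)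
    show "(\<lambda>y. y i) \<in> space ?M \<rightarrow> {0..L}" unfolding sp using Y_le by auto
    fix a assume "a \<in> {0..L}"
    \<comment> \<open>Extensional words: fixing the values beyond i leaves finitely many
      representatives, so the coordinate event is a finite union of cylinders.\<close>
    let ?W = "{w \<in> Pi\<^sub>E {..i} (\<lambda>_. {0..L}). w i = a}"
    have "finite ?W" by (intro finite_subset[OF _ finite_PiE[of "{..i}" "\<lambda>_. {0..L}"]]) auto
    moreover have "YC w i \<in> sets ?M" if "w \<in> ?W" for w
    proof -
      have "\<forall>k\<le>i. w k \<le> L" using that by (auto simp: PiE_iff)
      hence "YC w i \<in> cyls" unfolding cyls_def by blast
      thus ?thesis unfolding st by (rule sigma_sets.Basic)
    qed
    ultimately have "(\<Union>w\<in>?W. YC w i) \<in> sets ?M" by (intro sets.finite_UN)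
    moreover have "(\<lambda>y. y i) -` {a} \<inter> space ?M = (\<Union>w\<in>?W. YC w i)"
    proof (intro equalityI subsetI)
      fix y assume y: "y \<in> (\<lambda>y. y i) -` {a} \<inter> space ?M"
      hence "restrict y {..i} \<in> ?W" unfolding sp using Y_le by auto
      moreover have "y \<in> YC (restrict y {..i}) i" using y unfolding sp by simp
      ultimately show "y \<in> (\<Union>w\<in>?W. YC w i)" by blast
    next
      fix y assume "y \<in> (\<Union>w\<in>?W. YC w i)"
      then obtain w where "w i = a" "y \<in> Y_seqs \<beta> n" "y i = w i" by auto
      thus "y \<in> (\<lambda>y. y i) -` {a} \<inter> space ?M" unfolding sp by simp
    qed
    ultimately show "(\<lambda>y. y i) -` {a} \<inter> space ?M \<in> sets ?M" by simp
  qed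
  have "(\<lambda>y. y) \<in> ?M \<rightarrow>\<^sub>M Y_space \<beta> n" unfolding Y_space_def
  proof (rule measurable_restrict_space2)
    show "(\<lambda>y. y) \<in> space ?M \<rightarrow> Y_seqs \<beta> n" unfolding sp by blast
    show "(\<lambda>y. y) \<in> ?M \<rightarrow>\<^sub>M (\<Pi>\<^sub>M i\<in>UNIV. count_space {0..L})"
      by (rule measurable_PiM_single') (use coord Y_le sp in auto)
  qed
  note id = this
  show "sets (Y_space \<beta> n) \<subseteq> sigma_sets (Y_seqs \<beta> n) cyls"
  proof
    fix X assume X: "X \<in> sets (Y_space \<beta> n)"
    have "X \<subseteq> Y_seqs \<beta> n" using sets.sets_into_space[OF X] unfolding space_Y .
    hence "(\<lambda>y. y) -` X \<inter> space ?M = X" unfolding sp by blast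
    thus "X \<in> sigma_sets (Y_seqs \<beta> n) cyls" using measurable_sets[OF id X] unfolding st by simp
  qed
  have "cyls \<subseteq> sets (Y_space \<beta> n)" using YC_sets sets.empty_sets unfolding cyls_def by blast
  thus "sigma_sets (Y_seqs \<beta> n) cyls \<subseteq> sets (Y_space \<beta> n)"
    using sets.sigma_sets_subset[of cyls "Y_space \<beta> n"] unfolding space_Y by simp
qed

text \<open>Two cylinders are nested or disjoint, according to whether the shorter word is a prefix
  of the longer.\<close>

lemma Int_stable_cyls: "Int_stable cyls"
proof (rule Int_stableI)
  have ne: "YC w m \<inter> YC w' m' \<in> cyls"
    if w: "\<forall>i\<le>m. w i \<le> L" "\<forall>i\<le>m'. w' i \<le> L" and le: "m \<le> m'" for w w' m m'
  proof (cases "\<forall>i\<le>m. w i = w' i")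
    case True
    hence "YC w m \<inter> YC w' m' = YC w' m'" using le by auto
    thus ?thesis using w(2) unfolding cyls_def by blast
  next
    case False
    then obtain i where "i \<le> m" "w i \<noteq> w' i" by blast
    hence "YC w m \<inter> YC w' m' = {}" using le by auto
    thus ?thesis by (simp add: cyls_def)
  qed
  fix a b assume "a \<in> cyls" "b \<in> cyls"
  then consider "a = {} \<or> b = {}" | w m w' m' where "a = YC w m" "b = YC w' m'"
      "\<forall>i\<le>m. w i \<le> L" "\<forall>i\<le>m'. w' i \<le> L"
    unfolding cyls_def by blast
  thus "a \<inter> b \<in> cyls"
  proof cases
    case 1 thus ?thesis by (auto simp: cyls_def)
  next
    case (2 w m w' m')
    thus ?thesis using ne[OF 2(3,4)] ne[OF 2(4,3)] by (cases "m \<le> m'") (simp_all add: Int_commute)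
  qed
qed

lemma Y_measure_eqI:
  assumes "prob_space M1" "prob_space M2"
    and s: "sets M1 = sets (Y_space \<beta> n)" "sets M2 = sets (Y_space \<beta> n)"
    and eq: "\<And>w m. \<forall>i. w i \<in> {0..L} \<Longrightarrow> measure M1 (YC w m) = measure M2 (YC w m)"
  shows "M1 = M2"
proof (rule measure_eqI_generator_eq_countable[OF Int_stable_cyls])
  interpret M1: prob_space M1 by fact
  interpret M2: prob_space M2 by fact
  show "cyls \<subseteq> Pow (Y_seqs \<beta> n)" by (auto simp: cyls_def)
  show "sets M1 = sigma_sets (Y_seqs \<beta> n) cyls" "sets M2 = sigma_sets (Y_seqs \<beta> n) cyls"
    using s sets_Y_space by auto
  show "emeasure M1 X = emeasure M2 X" if X: "X \<in> cyls" for X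
  proof (cases "X = {}")
    case False
    then obtain w m where w: "X = YC w m" "\<forall>i\<le>m. w i \<le> L" using X False unfolding cyls_def by blast
    \<comment> \<open>The assumed equality speaks of words with all letters in range, so the word is
      padded with the letter 0 without changing the cylinder.\<close>
    let ?w = "\<lambda>i. if i \<le> m then w i else 0"
    have Xw: "X = YC ?w m" unfolding w(1) by auto
    have "\<forall>i. ?w i \<in> {0..L}" using w(2) by auto
    hence "measure M1 X = measure M2 X" unfolding Xw by (rule eq)
    thus ?thesis by (simp only: M1.emeasure_eq_measure M2.emeasure_eq_measure)
  qed simp
  show "(\<lambda>a. YC (\<lambda>_. a) 0) ` {0..L} \<subseteq> cyls"
  proof (rule image_subsetI)
    fix a assume "a \<in> {0..L}"
    hence "\<forall>i\<le>(0::nat). a \<le> L" by simp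
    thus "YC (\<lambda>_. a) 0 \<in> cyls" unfolding cyls_def
      by (intro insertI2 CollectI exI[of _ "\<lambda>_. a"] exI[of _ "0::nat"] conjI refl)
  qed
  show "\<Union>((\<lambda>a. YC (\<lambda>_. a) 0) ` {0..L}) = Y_seqs \<beta> n"
  proof (intro equalityI subsetI)
    fix y assume y: "y \<in> Y_seqs \<beta> n"
    hence "y \<in> YC (\<lambda>_. y 0) 0" "y 0 \<in> {0..L}" using Y_le[OF y, of 0] by simp_all
    thus "y \<in> \<Union>((\<lambda>a. YC (\<lambda>_. a) 0) ` {0..L})" by (intro UN_I[of "y 0"])
  qed blast
  show "countable ((\<lambda>a. YC (\<lambda>_. a) 0) ` {0..L})" by (intro countable_finite) simp
  show "emeasure M1 a \<noteq> \<infinity>" for a by (simp add: M1.emeasure_eq_measure)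
qed

lemma code_measurable_nu: "code \<in> nu \<rightarrow>\<^sub>M Y_space \<beta> n"
  using code_measurable unfolding measurable_cong_sets[OF sets_nu refl] .

lemma space_nu: "space nu = space rho"
  by (rule sets_eq_imp_space_eq[OF sets_nu])

definition code_law :: "(nat \<Rightarrow> nat) measure" where
  "code_law = distr nu (Y_space \<beta> n) code"

lemma prob_space_code_law: "prob_space code_law"
  unfolding code_law_def by (rule nu.prob_space_distr[OF code_measurable_nu])

text \<open>The density weight divides by the length of the initial piece, which is the factor left
  over in \<open>emeasure_cylinder\<close>.\<close>

lemma measure_code_law_cylinder:
  assumes w: "\<forall>i. w i \<in> {0..L}"
  shows "measure code_law (YC w m) = pmf \<pi> (w 0) * (\<Prod>i<m. P (w i) (w (Suc i)))"
proof -
  have w': "\<forall>i. w i \<le> L" using w by simp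
  have "code -` YC w m \<inter> space nu = cylinder w m"
    using code_in_Y by (auto simp: cylinder_def space_nu space_rho)
  hence "measure code_law (YC w m) = measure nu (cylinder w m)"
    unfolding code_law_def by (simp add: measure_distr[OF code_measurable_nu YC_sets])
  moreover have "emeasure nu (cylinder w m) = ennreal (pmf \<pi> (w 0) / len (w 0)) *
      ennreal (len (w 0) * (\<Prod>i<m. P (w i) (w (Suc i))))"
    unfolding emeasure_cylinder[OF w', symmetric]
  proof (rule emeasure_nu_cell[OF cylinder_sets])
    fix z assume "z \<in> cylinder w m"
    hence "code z 0 = w 0" unfolding cylinder_def by blast
    thus "idx (snd z) = w 0" by (simp add: code_0)
  qed
  ultimately have "measure code_law (YC w m) = enn2real (ennreal (pmf \<pi> (w 0) / len (w 0)) *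
      ennreal (len (w 0) * (\<Prod>i<m. P (w i) (w (Suc i)))))"
    by (simp only: measure_def)
  also have "\<dots> = pmf \<pi> (w 0) / len (w 0) * (len (w 0) * (\<Prod>i<m. P (w i) (w (Suc i))))"
  proof -
    have "0 \<le> (\<Prod>i<m. P (w i) (w (Suc i)))" using w' by (intro prod_nonneg P_nonneg ballI) blast+
    moreover have "0 < len (w 0)" using len_pos w' by blast
    ultimately show ?thesis by (simp add: enn2real_mult)
  qed
  finally show ?thesis using len_pos[of "w 0"] w' by simp
qed

text \<open>Both halves of the definite description: the law of the code has the prescribed cylinder
  values, and these determine a probability measure.\<close>

lemma markov_Q_eq: "markov_Q \<beta> n p = code_law"
  unfolding markov_Q_def
proof (rule the_equality)
  show "prob_space code_law \<and> sets code_law = sets (Y_space \<beta> n) \<and>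
    (\<forall>w m. (\<forall>i. w i \<in> {0..L}) \<longrightarrow>
      measure code_law (YC w m) = pmf \<pi> (w 0) * (\<Prod>i<m. P (w i) (w (Suc i))))"
    using prob_space_code_law measure_code_law_cylinder by (simp add: code_law_def)
  fix N assume N: "prob_space N \<and> sets N = sets (Y_space \<beta> n) \<and>
    (\<forall>w m. (\<forall>i. w i \<in> {0..L}) \<longrightarrow>
      measure N (YC w m) = pmf \<pi> (w 0) * (\<Prod>i<m. P (w i) (w (Suc i))))"
  show "N = code_law"
  proof (rule Y_measure_eqI)
    show "measure N (YC w m) = measure code_law (YC w m)" if "\<forall>i. w i \<in> {0..L}" for w m
    proof -
      have "measure N (YC w m) = pmf \<pi> (w 0) * (\<Prod>i<m. P (w i) (w (Suc i)))"
        by (rule conjunct2[OF conjunct2[OF N], THEN spec[of _ w], THEN spec[of _ m], THEN mp, OF that])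
      thus ?thesis using measure_code_law_cylinder[OF that] by simp
    qed
  qed (use N prob_space_code_law in \<open>simp_all add: code_law_def\<close>)
qed

subsection \<open>Measurability of the coding map\<close>

abbreviation "S \<equiv> switch_indices \<beta> n"

abbreviation "YI \<equiv> restrict_space (Y_space \<beta> n) (Y_inf \<beta> n)"

lemma space_YI: "space YI = Y_inf \<beta> n"
  by (auto simp: space_restrict_space space_Y Y_inf_def)

lemma YI_coord: "(\<lambda>y. y i) \<in> YI \<rightarrow>\<^sub>M count_space UNIV"
  by (rule measurable_restrict_space1[OF Y_coord])

lemma Y_inf_sets: "Y_inf \<beta> n \<in> sets (Y_space \<beta> n)"
proof -
  have "{y\<in>space (Y_space \<beta> n). y i \<in> S} \<in> sets (Y_space \<beta> n)" for i
  proof -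
    have "(\<lambda>y. y i) -` S \<inter> space (Y_space \<beta> n) \<in> sets (Y_space \<beta> n)"
      by (rule measurable_sets[OF Y_coord]) simp
    also have "(\<lambda>y. y i) -` S \<inter> space (Y_space \<beta> n) = {y\<in>space (Y_space \<beta> n). y i \<in> S}" by auto
    finally show ?thesis .
  qed
  hence "{y\<in>space (Y_space \<beta> n). \<forall>m. \<exists>i\<in>{m<..}. y i \<in> S} \<in> sets (Y_space \<beta> n)"
    by (intro sets.sets_Collect_countable_All sets.sets_Collect_countable_Bex) auto
  also have "{y\<in>space (Y_space \<beta> n). \<forall>m. \<exists>i\<in>{m<..}. y i \<in> S} = Y_inf \<beta> n"
    unfolding space_Y Y_inf_def infinite_nat_iff_unbounded by auto
  finally show ?thesis .
qed

lemma switch_count_measurable: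
  "(\<lambda>y. card {i. y i \<in> S \<and> i < m}) \<in> YI \<rightarrow>\<^sub>M count_space UNIV"
proof (induction m)
  case (Suc m)
  have eq: "card {i. y i \<in> S \<and> i < Suc m} =
      (if y m \<in> S then Suc (card {i. y i \<in> S \<and> i < m}) else card {i. y i \<in> S \<and> i < m})" for y
  proof (cases "y m \<in> S")
    case True
    hence "{i. y i \<in> S \<and> i < Suc m} = insert m {i. y i \<in> S \<and> i < m}" by (auto simp: less_Suc_eq)
    thus ?thesis using True by simp
  next
    case False
    hence "{i. y i \<in> S \<and> i < Suc m} = {i. y i \<in> S \<and> i < m}" by (auto simp: less_Suc_eq)
    thus ?thesis using False by simp
  qed
  have "{y\<in>space YI. y m \<in> S} = (\<lambda>y. y m) -` S \<inter> space YI" by auto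
  also have "\<dots> \<in> sets YI" by (rule measurable_sets[OF YI_coord]) simp
  finally show ?case unfolding eq
    by (intro measurable_If Suc measurable_compose[OF Suc, of Suc]) simp_all
qed simp

lemma psi_fst_measurable: "(\<lambda>y. fst (psi \<beta> n y)) \<in> YI \<rightarrow>\<^sub>M (\<Pi>\<^sub>M i\<in>UNIV. count_space UNIV)"
proof (rule measurable_PiM_single')
  fix j :: nat
  have "(\<lambda>y. enumerate {i. y i \<in> S} j) \<in> YI \<rightarrow>\<^sub>M count_space UNIV"
  proof (subst measurable_count_space_eq2_countable, intro conjI ballI)
    fix m :: nat
    \<comment> \<open>Whether the j-th switch time is m can be seen from the coordinates up to
      m.\<close>
    have "(\<lambda>y. enumerate {i. y i \<in> S} j) -` {m} \<inter> space YI =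
        ((\<lambda>y. y m) -` S \<inter> space YI) \<inter> ((\<lambda>y. card {i. y i \<in> S \<and> i < m}) -` {j} \<inter> space YI)"
    proof -
      have "enumerate {i. y i \<in> S} j = m \<longleftrightarrow> y m \<in> S \<and> card {i. y i \<in> S \<and> i < m} = j"
        if "y \<in> space YI" for y
      proof -
        have "infinite {i. y i \<in> S}" using that unfolding space_YI by (simp add: Y_inf_def)
        thus ?thesis using enumerate_eq_iff[of "{i. y i \<in> S}" j m] by simp
      qed
      thus ?thesis by auto
    qed
    also have "\<dots> \<in> sets YI"
      by (intro sets.Int measurable_sets[OF YI_coord] measurable_sets[OF switch_count_measurable]) simp_all
    finally show "(\<lambda>y. enumerate {i. y i \<in> S} j) -` {m} \<inter> space YI \<in> sets YI" .
  qed simp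
  hence "(\<lambda>y. y (Suc (enumerate {i. y i \<in> S} j))) \<in> YI \<rightarrow>\<^sub>M count_space UNIV"
    by (rule measurable_compose_countable[where f = "\<lambda>m y. y (Suc m)", OF YI_coord])
  hence "(\<lambda>y. y (Suc (enumerate {i. y i \<in> S} j)) = 0) \<in> YI \<rightarrow>\<^sub>M count_space UNIV"
    by (rule measurable_compose) simp
  thus "(\<lambda>y. fst (psi \<beta> n y) j) \<in> YI \<rightarrow>\<^sub>M count_space UNIV" by (simp add: psi_def)
qed auto

text \<open>Each symbol is the index of some point, so the digit formula for points applies even to
  sequences not known to be codes.\<close>

lemma expansion_digit_le: assumes "y \<in> Y_seqs \<beta> n" shows "expansion_digit \<beta> n y j \<le> B"
proof -
  obtain x where x: "x \<in> J" "idx x = y j" using Y_le[OF assms] by (rule idx_surj)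
  show ?thesis using expansion_digit_idx[where y = y and j = j, OF x(1) x(2)[symmetric]] ld_le[OF x(1)]
    by (auto split: if_splits)
qed

text \<open>The top point has the constant expansion with the largest digit, so it dominates every
  expansion series.\<close>

lemma geometric_B: "(\<lambda>j. real B / \<beta> ^ Suc j) sums u"
proof -
  have "(\<lambda>j. (1 / \<beta>) ^ j) sums (1 / (1 - 1 / \<beta>))" using beta_gt_1 by (intro geometric_sums) simp
  hence "(\<lambda>j. real B / \<beta> * (1 / \<beta>) ^ j) sums (real B / \<beta> * (1 / (1 - 1 / \<beta>)))" by (rule sums_mult)
  moreover have "real B / \<beta> * (1 / (1 - 1 / \<beta>)) = u" using beta_gt_1
    by (simp add: top_pt_def field_simps)
  ultimately show ?thesis by (simp add: power_one_over)
qed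

lemma psi_snd_in_J: assumes "y \<in> Y_seqs \<beta> n" shows "snd (psi \<beta> n y) \<in> J"
proof -
  let ?f = "\<lambda>j. real (expansion_digit \<beta> n y j) / \<beta> ^ Suc j"
  have le: "?f j \<le> real B / \<beta> ^ Suc j" for j
    using expansion_digit_le[OF assms] by (intro divide_right_mono) auto
  have sm: "summable ?f"
    by (rule summable_comparison_test'[OF sums_summable[OF geometric_B], of 0]) (use le in simp)
  have "suminf ?f \<le> u"
    using suminf_le[OF le sm sums_summable[OF geometric_B]] sums_unique[OF geometric_B] by simp
  moreover have "0 \<le> suminf ?f" by (intro suminf_nonneg[OF sm]) simp
  ultimately show ?thesis by (simp add: psi_def in_J)
qed

lemma psi_snd_measurable: "(\<lambda>y. snd (psi \<beta> n y)) \<in> YI \<rightarrow>\<^sub>M restrict_space borel J"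
proof (rule measurable_restrict_space2)
  show "(\<lambda>y. snd (psi \<beta> n y)) \<in> space YI \<rightarrow> J"
    unfolding space_YI using psi_snd_in_J by (auto simp: Y_inf_def)
  \<comment> \<open>The digit is a function of two consecutive symbols, which lie in a countable
    type; measurability then needs nothing about the definite descriptions.\<close>
  define F where "F a c = (if a \<in> eq_indices \<beta> n then (THE k. k \<in> {0..B} \<and> a \<in> eq_index_set \<beta> n k)
      else (let k = (THE k. k \<in> {1..B} \<and> a = switch_index \<beta> n k) in if c = 0 then k else k - 1))"
    for a c :: nat
  have "(\<lambda>y. real (F (y j) (y (Suc j)))) \<in> borel_measurable YI" for j
  proof (rule measurable_compose_countable[where f = "\<lambda>a y. real (F a (y (Suc j)))", OF _ YI_coord])
    fix a :: nat
    show "(\<lambda>y. real (F a (y (Suc j)))) \<in> borel_measurable YI"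
      by (rule measurable_compose[OF YI_coord]) simp
  qed
  moreover have "expansion_digit \<beta> n y j = F (y j) (y (Suc j))" for y j
    by (simp add: expansion_digit_def F_def)
  ultimately have "(\<lambda>y. real (expansion_digit \<beta> n y j) / \<beta> ^ Suc j) \<in> borel_measurable YI" for j
    by (intro borel_measurable_divide) simp_all
  hence "(\<lambda>y. \<Sum>j. real (expansion_digit \<beta> n y j) / \<beta> ^ Suc j) \<in> borel_measurable YI"
    by (rule borel_measurable_suminf)
  thus "(\<lambda>y. snd (psi \<beta> n y)) \<in> YI \<rightarrow>\<^sub>M borel" by (simp add: psi_def)
qed

abbreviation "target \<equiv> (\<Pi>\<^sub>M i\<in>(UNIV::nat set). count_space (UNIV::bool set)) \<Otimes>\<^sub>M restrict_space borel J"

lemma psi_measurable: "psi \<beta> n \<in> YI \<rightarrow>\<^sub>M target"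
  using measurable_Pair[OF psi_fst_measurable psi_snd_measurable] by simp

lemma sets_mu': "sets mu = sets (restrict_space borel J)"
  unfolding sets_mu by (rule sets_restrict_space_cong) simp

lemma sets_target: "sets target = sets nu"
  by (rule sets_pair_measure_cong) (simp_all add: sets_bern sets_mu')

text \<open>Pulling X back by \<open>psi\<close> and then by \<open>code\<close> returns X up to the
  null set of finitely switching points, because \<open>psi\<close> inverts \<open>code\<close>
  elsewhere.\<close>

lemma Q_psi_eq: "Q_psi \<beta> n p = nu"
proof (rule measure_eqI)
  show "sets (Q_psi \<beta> n p) = sets nu" unfolding Q_psi_def using sets_target by simp
  fix X assume "X \<in> sets (Q_psi \<beta> n p)"
  hence X: "X \<in> sets target" unfolding Q_psi_def by simp
  hence Xnu: "X \<in> sets nu" using sets_target by simp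
  have sl: "sets code_law = sets (Y_space \<beta> n)" by (simp add: code_law_def)
  have Yi: "Y_inf \<beta> n \<in> sets code_law" using Y_inf_sets sl by simp
  have sr: "sets (restrict_space code_law (Y_inf \<beta> n)) = sets YI"
    by (rule sets_restrict_space_cong[OF sl])
  have spr: "space (restrict_space code_law (Y_inf \<beta> n)) = Y_inf \<beta> n"
    using sets_eq_imp_space_eq[OF sr] space_YI by simp
  have pm: "psi \<beta> n \<in> restrict_space code_law (Y_inf \<beta> n) \<rightarrow>\<^sub>M target"
    using psi_measurable unfolding measurable_cong_sets[OF sr refl] .
  let ?V = "psi \<beta> n -` X \<inter> Y_inf \<beta> n"
  have "?V \<in> sets (restrict_space code_law (Y_inf \<beta> n))" using measurable_sets[OF pm X] spr by simp
  hence V: "?V \<in> sets (Y_space \<beta> n)"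
    using sets_restrict_space_iff[of "Y_inf \<beta> n" code_law ?V] Yi sl sets.sets_into_space[OF Yi]
    by (simp add: Int_absorb2)
  have "emeasure (Q_psi \<beta> n p) X = emeasure (restrict_space code_law (Y_inf \<beta> n)) ?V"
    unfolding Q_psi_def markov_Q_eq by (subst emeasure_distr[OF pm X]) (simp only: spr)
  also have "\<dots> = emeasure code_law ?V"
    using Yi sets.sets_into_space[OF Yi] by (intro emeasure_restrict_space) (auto simp: Int_absorb2)
  also have "\<dots> = emeasure nu (code -` ?V \<inter> space nu)"
    unfolding code_law_def by (rule emeasure_distr[OF code_measurable_nu V])
  also have "\<dots> = emeasure nu X"
  proof (rule emeasure_eq_AE)
    show "code -` ?V \<inter> space nu \<in> sets nu" by (rule measurable_sets[OF code_measurable_nu V])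
    show "X \<in> sets nu" by (rule Xnu)
    have "AE z in nu. z \<notin> {z\<in>space rho. finite {i. sw (snd ((step ^^ i) z))}}"
      by (rule AE_not_in[OF finitely_switching_null])
    moreover have "AE z in nu. z \<in> space nu" by (rule AE_space)
    ultimately show "AE z in nu. z \<in> code -` ?V \<inter> space nu \<longleftrightarrow> z \<in> X"
    proof eventually_elim
      fix z assume z: "z \<notin> {z\<in>space rho. finite {i. sw (snd ((step ^^ i) z))}}" "z \<in> space nu"
      hence zJ: "snd z \<in> J" and inf: "infinite {i. sw (snd ((step ^^ i) z))}"
        by (auto simp: space_nu space_rho)
      have "code z \<in> Y_inf \<beta> n"
        using code_in_Y[OF zJ] inf switch_times_code[OF zJ] by (simp add: Y_inf_def)
      thus "z \<in> code -` ?V \<inter> space nu \<longleftrightarrow> z \<in> X" using psi_code[OF zJ inf] z(2) by simp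
    qed
  qed
  finally show "emeasure (Q_psi \<beta> n p) X = emeasure nu X" .
qed

end

theorem theorem6:
  fixes \<beta> p :: real and n :: nat and b :: "nat \<Rightarrow> nat"
  assumes "\<beta> > 1" and "\<beta> \<notin> \<int>"
    and "n \<ge> 2"
    and "finite_greedy_expansion \<beta> 1 n b"
    and "\<forall>i\<in>{1..n}. b i \<ge> 1"
    and "\<beta>\<^sup>2 \<noteq> real (b 1) * \<beta> + 1"
    and "0 < p" and "p < 1"
  shows "\<exists>\<mu>. prob_space \<mu> \<and> sets \<mu> = sets (restrict_space borel (J_int \<beta>)) \<and>
           Q_psi \<beta> n p = bernoulli_measure p \<Otimes>\<^sub>M \<mu>"
proof -
  interpret random_greedy \<beta> n b p
    by unfold_locales (fact assms)+
  show ?thesis by (intro exI[of _ mu] conjI prob_space_mu sets_mu' Q_psi_eq)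
qed

end
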